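(* Let $n\ge1$ and let $p$ be a prime. In the local Hecke algebra of $\mathrm{Sp}(2n)$ at $p$ the following relation holds: $$T(p^2)=T(p)^2-\sum_{s=1}^n c_s\,T_s(p^2),$$ where the coefficients $c_s$ are positive and given by $$c_s=\sum_{i=1}^s p^{i(i+1)/2}\binom{s}{i}_p=\Big(\prod_{i=1}^s (p^i+1)\Big)-1.$$
   Context: Let $J=\begin{pmatrix}0&I_n\\-I_n&0\end{pmatrix}$, $G=\mathrm{Sp}(2n,\mathbb{Q}_p)$, $K=\mathrm{Sp}(2n,\mathbb{Z}_p)$. The local Hecke algebra is the algebra of locally constant, compactly supported, bi-$K$-invariant functions $G\to\mathbb{Z}$ under convolution (Haar measure normalized so $K$ has volume 1); $\mathbf{1}_{K\gamma K}$ denotes the characteristic function of a double coset. Define $T(p)=\mathbf{1}_{K\gamma K}$ with $\gamma=\mathrm{diag}(1,\dots,1,p,\dots,p)$ ($n$ ones, $n$ entries $p$); for $j=0,\dots,n$, $T_j(p^2)=\mathbf{1}_{K\gamma K}$ with $\gamma=\mathrm{diag}(1^{(n-j)},p^{(j)},(p^2)^{(n-j)},p^{(j)})$ (exponents in parentheses indicate multiplicities); and $T(p^r)$ is the sum of $\mathbf{1}_{K\gamma K}$ over the distinct double cosets $K\gamma K$ with $\gamma$ in $O_n(p^r)=\{\gamma : \gamma^tJ\gamma=p^rJ\}$. The Gaussian binomial coefficient is $\binom{m}{\ell}_p=\prod_{i=1}^\ell\frac{p^{m-\ell+i}-1}{p^i-1}$, the number of $\ell$-dimensional subspaces of $\m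athbb{F}_p^m$.
   Formalization: G is taken to be the symplectic similitudes over Q_p with factor a power of p, since γ in T(p) is not in Sp(2n,Q_p), and O_n(p^r) is restricted to matrices with entries in Z_p, since otherwise T(p^2) would be a sum over infinitely many double cosets. *)

theory Defs
  imports
    "HOL-Analysis.Bochner_Integration"
    "HOL-Computational_Algebra.Fraction_Field"
    "HOL-Algebra.Coset"
    "Jordan_Normal_Form.Matrix"
    "Berlekamp_Zassenhaus.Finite_Field"
begin

section \<open>The \<open>p\<close>-adic integers and the \<open>p\<close>-adic numbers\<close>

text \<open>
  The prime \<open>p\<close> is the cardinality of the type argument, which is of class \<open>prime_card\<close>.
  The ring of \<open>p\<close>-adic integers is the inverse limit of the rings of integers modulo \<open>p ^ k\<close>,
  residue classes being represented by their least non-negative members.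
\<close>

typedef (overloaded) ('p :: prime_card) padic_int =
  "{x :: nat \<Rightarrow> int. \<forall>k. x k = x (Suc k) mod int CARD('p) ^ k}"
  morphisms residue Abs_padic_int
  by (rule exI[of _ "\<lambda>_. 0"]) simp

setup_lifting type_definition_padic_int

lemma residue_mod [simp]:
  fixes x :: "'p :: prime_card padic_int"
  shows "residue x k mod int CARD('p) ^ k = residue x k"
  using residue[of x] by (metis (mono_tags, lifting) mem_Collect_eq mod_mod_trivial)

lemma residue_mod_le:
  fixes x :: "'p :: prime_card padic_int"
  assumes "k \<le> m"
  shows "residue x m mod int CARD('p) ^ k = residue x k"
  using assms
proof (induction m rule: dec_induct)
  case base
  show ?case by simp
next
  case (step m)
  have "residue x m = residue x (Suc m) mod int CARD('p) ^ m"
    using residue[of x] by blast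
  then have "residue x (Suc m) mod int CARD('p) ^ k = residue x m mod int CARD('p) ^ k"
    using step.hyps by (simp add: mod_mod_cancel le_imp_power_dvd)
  then show ?case using step.IH by simp
qed

lemma mod_Suc_power:
  "a mod int q ^ k = (a mod int q ^ Suc k) mod int q ^ k"
  by (simp add: mod_mod_cancel)

instantiation padic_int :: (prime_card) comm_ring_1
begin

lift_definition zero_padic_int :: "'a padic_int" is "\<lambda>_. 0" by simp

lift_definition one_padic_int :: "'a padic_int" is "\<lambda>k. 1 mod int CARD('a) ^ k"
  using mod_Suc_power by blast

lift_definition plus_padic_int :: "'a padic_int \<Rightarrow> 'a padic_int \<Rightarrow> 'a padic_int"
  is "\<lambda>x y k. (x k + y k) mod int CARD('a) ^ k"
  by (metis mod_Suc_power mod_add_eq)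

lift_definition uminus_padic_int :: "'a padic_int \<Rightarrow> 'a padic_int"
  is "\<lambda>x k. (- x k) mod int CARD('a) ^ k"
  by (metis mod_Suc_power mod_minus_eq)

lift_definition minus_padic_int :: "'a padic_int \<Rightarrow> 'a padic_int \<Rightarrow> 'a padic_int"
  is "\<lambda>x y k. (x k - y k) mod int CARD('a) ^ k"
  by (metis mod_Suc_power mod_diff_eq)

lift_definition times_padic_int :: "'a padic_int \<Rightarrow> 'a padic_int \<Rightarrow> 'a padic_int"
  is "\<lambda>x y k. (x k * y k) mod int CARD('a) ^ k"
  by (metis mod_Suc_power mod_mult_eq)

lemma residue_eqI: "(\<And>k. residue x k = residue y k) \<Longrightarrow> x = (y :: 'a padic_int)"
  by (metis ext residue_inject)

instance
proof
  fix a b c :: "'a padic_int"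
  show "a * b * c = a * (b * c)"
    by (rule residue_eqI) (simp add: times_padic_int.rep_eq mod_simps mult.assoc)
  show "a * b = b * a"
    by (rule residue_eqI) (simp add: times_padic_int.rep_eq mult.commute)
  show "1 * a = a"
    by (rule residue_eqI) (simp add: times_padic_int.rep_eq one_padic_int.rep_eq mod_simps)
  show "a + b + c = a + (b + c)"
    by (rule residue_eqI) (simp add: plus_padic_int.rep_eq mod_simps add.assoc)
  show "a + b = b + a"
    by (rule residue_eqI) (simp add: plus_padic_int.rep_eq add.commute)
  show "0 + a = a"
    by (rule residue_eqI) (simp add: plus_padic_int.rep_eq zero_padic_int.rep_eq)
  show "- a + a = 0"
    by (rule residue_eqI)
      (simp add: plus_padic_int.rep_eq uminus_padic_int.rep_eq zero_padic_int.rep_eq mod_simps)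
  show "a - b = a + - b"
    by (rule residue_eqI)
      (simp add: plus_padic_int.rep_eq uminus_padic_int.rep_eq minus_padic_int.rep_eq mod_simps)
  show "(a + b) * c = a * c + b * c"
    by (rule residue_eqI)
      (simp add: plus_padic_int.rep_eq times_padic_int.rep_eq mod_simps distrib_right)
  have "1 < int CARD('a)"
    using prime_card_int[where 'a = 'a] prime_gt_1_int by blast
  then have "residue (0 :: 'a padic_int) 1 \<noteq> residue 1 1"
    by (simp add: zero_padic_int.rep_eq one_padic_int.rep_eq)
  then show "(0 :: 'a padic_int) \<noteq> 1" by metis
qed

end

instance padic_int :: (prime_card) idom
proof
  fix a b :: "'a padic_int"
  assume "a \<noteq> 0" "b \<noteq> 0"
  then obtain k l where kl: "residue a k \<noteq> 0" "residue b l \<noteq> 0"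
    by (metis residue_eqI zero_padic_int.rep_eq)
  let ?p = "int CARD('a)"
  let ?a = "residue a (k + l)" and ?b = "residue b (k + l)"
  have na: "\<not> ?p ^ k dvd ?a"
    using kl(1) residue_mod_le[of k "k + l" a] by (simp add: dvd_eq_mod_eq_0)
  have nb: "\<not> ?p ^ l dvd ?b"
    using kl(2) residue_mod_le[of l "k + l" b] by (simp add: dvd_eq_mod_eq_0)
  have "\<not> ?p ^ (k + l) dvd ?a * ?b"
  proof
    assume "?p ^ (k + l) dvd ?a * ?b"
    then obtain x y where xy: "x + y = k + l" "?p ^ x dvd ?a" "?p ^ y dvd ?b"
      using prime_elem_power_dvd_prod[of ?p "k + l" ?a ?b] prime_card_int[where 'a = 'a] by auto
    then have "k \<le> x \<or> l \<le> y" by linarith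
    then show False
      using xy na nb by (meson dvd_trans le_imp_power_dvd)
  qed
  then have "residue (a * b) (k + l) \<noteq> residue 0 (k + l)"
    by (simp add: times_padic_int.rep_eq zero_padic_int.rep_eq dvd_eq_mod_eq_0)
  then show "a * b \<noteq> 0" by metis
qed

type_synonym 'p padic = "'p padic_int fract"

definition Zp :: "'p :: prime_card padic set" where
  "Zp = range (\<lambda>a. Fract a 1)"

abbreviation pp :: "'p :: prime_card padic" where
  "pp \<equiv> of_nat CARD('p)"

section \<open>The symplectic group and its similitudes\<close>

definition J_mat :: "nat \<Rightarrow> 'a :: comm_ring_1 mat" where
  "J_mat n = four_block_mat (0\<^sub>m n n) (1\<^sub>m n) (- 1\<^sub>m n) (0\<^sub>m n n)"

text \<open>
  The matrix \<open>diag(1, \<dots>, 1, p, \<dots>, p)\<close> and its relatives do not lie in the symplectic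
  group itself. The ambient group is therefore the group of symplectic similitudes of \<open>Q\<^sub>p\<close>
  whose factor is a power of \<open>p\<close>. It contains \<open>Sp(2n, Q\<^sub>p)\<close>, and \<open>Sp(2n, Z\<^sub>p)\<close> is a compact
  open subgroup of it. (In the group of all similitudes \<open>Sp(2n, Z\<^sub>p)\<close> is not open, so there
  it could not have volume 1.)
\<close>

definition sim_group :: "nat \<Rightarrow> 'p :: prime_card padic mat monoid" where
  "sim_group n = \<lparr>carrier = {g \<in> carrier_mat (2 * n) (2 * n).
       \<exists>r :: int. g\<^sup>T * J_mat n * g = (pp powi r) \<cdot>\<^sub>m J_mat n},
     mult = (*), one = 1\<^sub>m (2 * n)\<rparr>"

definition integral_mat :: "'p :: prime_card padic mat \<Rightarrow> bool" where
  "integral_mat g \<longleftrightarrow> elements_mat g \<subseteq> Zp"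

definition Sp_Zp :: "nat \<Rightarrow> 'p :: prime_card padic mat set" where
  "Sp_Zp n = {g \<in> carrier_mat (2 * n) (2 * n).
     integral_mat g \<and> g\<^sup>T * J_mat n * g = J_mat n}"

text \<open>Integral similitudes of factor \<open>p ^ r\<close>; without integrality there would be infinitely
  many double cosets.\<close>

definition O_set :: "nat \<Rightarrow> nat \<Rightarrow> 'p :: prime_card padic mat set" where
  "O_set n r = {g \<in> carrier_mat (2 * n) (2 * n).
     integral_mat g \<and> g\<^sup>T * J_mat n * g = (pp ^ r) \<cdot>\<^sub>m J_mat n}"

definition double_coset :: "nat \<Rightarrow> 'p :: prime_card padic mat \<Rightarrow> 'p padic mat set" where
  "double_coset n g = Sp_Zp n <#>\<^bsub>sim_group n\<^esub> {g} <#>\<^bsub>sim_group n\<^esub> Sp_Zp n"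

section \<open>Topology and Haar measure\<close>

text \<open>
  The \<open>p\<close>-adic topology: the matrices congruent to \<open>g\<close> modulo \<open>p ^ m\<close>, for varying \<open>m\<close>, form a
  basis of neighbourhoods of \<open>g\<close>.
\<close>

definition padic_open :: "nat \<Rightarrow> 'p :: prime_card padic mat set \<Rightarrow> bool" where
  "padic_open n U \<longleftrightarrow> U \<subseteq> carrier (sim_group n) \<and>
     (\<forall>g\<in>U. \<exists>m :: nat. \<forall>h\<in>carrier (sim_group n).
        elements_mat (h - g) \<subseteq> (\<lambda>z. pp ^ m * z) ` Zp \<longrightarrow> h \<in> U)"

definition sim_topology :: "nat \<Rightarrow> 'p :: prime_card padic mat topology" where
  "sim_topology n = topology (padic_open n)"

lemma Zp_mult: "x \<in> Zp \<Longrightarrow> y \<in> Zp \<Longrightarrow> x * y \<in> Zp"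
  unfolding Zp_def by auto

lemma pp_power_in_Zp: "(pp :: 'p :: prime_card padic) ^ m \<in> Zp"
proof -
  have "(pp :: 'p padic) = Fract (of_nat CARD('p)) 1"
    by (rule of_nat_fract)
  then have pp: "(pp :: 'p padic) \<in> Zp" unfolding Zp_def by auto
  have "(1 :: 'p padic) \<in> Zp" unfolding Zp_def One_fract_def by auto
  with pp show "(pp :: 'p padic) ^ m \<in> Zp"
    by (induction m) (auto intro: Zp_mult)
qed

lemma padic_balls_decreasing:
  assumes "m \<le> k"
  shows "(\<lambda>z. (pp :: 'p :: prime_card padic) ^ k * z) ` Zp \<subseteq> (\<lambda>z. pp ^ m * z) ` Zp"
proof clarify
  fix z :: "'p padic" assume "z \<in> Zp"
  then have "pp ^ (k - m) * z \<in> Zp" by (intro Zp_mult pp_power_in_Zp)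
  moreover have "pp ^ k * z = pp ^ m * (pp ^ (k - m) * z)"
    using assms by (simp flip: mult.assoc power_add)
  ultimately show "pp ^ k * z \<in> (\<lambda>z. pp ^ m * z) ` Zp" by blast
qed

lemma istopology_padic_open: "istopology (padic_open n)"
  unfolding istopology_def
proof (intro conjI allI impI)
  fix S T :: "'p :: prime_card padic mat set"
  assume S: "padic_open n S" and T: "padic_open n T"
  show "padic_open n (S \<inter> T)"
    unfolding padic_open_def
  proof (intro conjI ballI)
    show "S \<inter> T \<subseteq> carrier (sim_group n)" using S unfolding padic_open_def by blast
    fix g assume "g \<in> S \<inter> T"
    with S T obtain k m where
      "\<forall>h\<in>carrier (sim_group n). elements_mat (h - g) \<subseteq> (\<lambda>z. pp ^ k * z) ` Zp \<longrightarrow> h \<in> S"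
      "\<forall>h\<in>carrier (sim_group n). elements_mat (h - g) \<subseteq> (\<lambda>z. pp ^ m * z) ` Zp \<longrightarrow> h \<in> T"
      unfolding padic_open_def by blast
    then have "\<forall>h\<in>carrier (sim_group n).
        elements_mat (h - g) \<subseteq> (\<lambda>z. pp ^ max k m * z) ` Zp \<longrightarrow> h \<in> S \<inter> T"
      using padic_balls_decreasing[of k "max k m"] padic_balls_decreasing[of m "max k m"]
      by (meson IntI max.cobounded1 max.cobounded2 subset_trans)
    then show "\<exists>m. \<forall>h\<in>carrier (sim_group n).
        elements_mat (h - g) \<subseteq> (\<lambda>z. pp ^ m * z) ` Zp \<longrightarrow> h \<in> S \<inter> T" by blast
  qed
next
  fix \<U> :: "'p :: prime_card padic mat set set"
  assume *: "\<forall>S\<in>\<U>. padic_open n S"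
  show "padic_open n (\<Union>\<U>)"
    unfolding padic_open_def
  proof (intro conjI ballI)
    show "\<Union>\<U> \<subseteq> carrier (sim_group n)" using * unfolding padic_open_def by blast
    fix g assume "g \<in> \<Union>\<U>"
    then obtain S where S: "S \<in> \<U>" "g \<in> S" by blast
    with * obtain m where
      "\<forall>h\<in>carrier (sim_group n). elements_mat (h - g) \<subseteq> (\<lambda>z. pp ^ m * z) ` Zp \<longrightarrow> h \<in> S"
      unfolding padic_open_def by blast
    with S show "\<exists>m. \<forall>h\<in>carrier (sim_group n).
        elements_mat (h - g) \<subseteq> (\<lambda>z. pp ^ m * z) ` Zp \<longrightarrow> h \<in> \<Union>\<U>" by blast
  qed
qed

lemma openin_sim_topology: "openin (sim_topology n) = padic_open n"
  unfolding sim_topology_def using istopology_padic_open by (rule topology_inverse')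

lemma topspace_sim_topology: "topspace (sim_topology n) = carrier (sim_group n)"
proof -
  have "padic_open n (carrier (sim_group n))" unfolding padic_open_def by blast
  moreover have "U \<subseteq> carrier (sim_group n)" if "padic_open n U" for U
    using that unfolding padic_open_def by blast
  ultimately show ?thesis unfolding topspace_def openin_sim_topology by blast
qed

text \<open>Left Haar measures giving \<open>Sp(2n, Z\<^sub>p)\<close> volume 1. The group is locally compact and second
  countable, so regularity needs no separate mention.\<close>

definition normalized_haar :: "nat \<Rightarrow> 'p :: prime_card padic mat measure \<Rightarrow> bool" where
  "normalized_haar n \<mu> \<longleftrightarrow>
     space \<mu> = carrier (sim_group n) \<and>
     sets \<mu> = sigma_sets (carrier (sim_group n)) {U. openin (sim_topology n) U} \<and>
     (\<forall>g\<in>carrier (sim_group n). \<forall>A\<in>sets \<mu>. emeasure \<mu> (g <#\<^bsub>sim_group n\<^esub> A) = emeasure \<mu> A) \<and>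
     (\<forall>C\<in>sets \<mu>. compactin (sim_topology n) C \<longrightarrow> emeasure \<mu> C < \<infinity>) \<and>
     emeasure \<mu> (Sp_Zp n) = 1"

section \<open>The Hecke algebra\<close>

text \<open>Functions on the group are extended by 0 to all matrices, and integers are regarded as
  reals so that convolution can be an integral.\<close>

definition hecke_algebra :: "nat \<Rightarrow> ('p :: prime_card padic mat \<Rightarrow> real) set" where
  "hecke_algebra n = {f.
     (\<forall>x. f x \<in> \<int>) \<and>
     (\<forall>x. x \<notin> carrier (sim_group n) \<longrightarrow> f x = 0) \<and>
     (\<forall>x\<in>carrier (sim_group n). \<exists>U. openin (sim_topology n) U \<and> x \<in> U \<and> (\<forall>y\<in>U. f y = f x)) \<and>
     compactin (sim_topology n) (sim_topology n closure_of {x. f x \<noteq> 0}) \<and>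
     (\<forall>k\<in>Sp_Zp n. \<forall>l\<in>Sp_Zp n. \<forall>x\<in>carrier (sim_group n).
        f (k \<otimes>\<^bsub>sim_group n\<^esub> x \<otimes>\<^bsub>sim_group n\<^esub> l) = f x)}"

definition convolution :: "nat \<Rightarrow> 'p :: prime_card padic mat measure \<Rightarrow>
    ('p padic mat \<Rightarrow> real) \<Rightarrow> ('p padic mat \<Rightarrow> real) \<Rightarrow> 'p padic mat \<Rightarrow> real" where
  "convolution n \<mu> f g x =
     (if x \<in> carrier (sim_group n)
      then \<integral>y. f y * g (inv\<^bsub>sim_group n\<^esub> y \<otimes>\<^bsub>sim_group n\<^esub> x) \<partial>\<mu> else 0)"

definition diag_list :: "'a :: zero list \<Rightarrow> 'a mat" where
  "diag_list xs = mat_diag (length xs) (\<lambda>i. xs ! i)"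

definition T_p :: "nat \<Rightarrow> 'p :: prime_card padic mat \<Rightarrow> real" where
  "T_p n = indicator (double_coset n (diag_list (replicate n 1 @ replicate n pp)))"

definition T_p2 :: "nat \<Rightarrow> nat \<Rightarrow> 'p :: prime_card padic mat \<Rightarrow> real" where
  "T_p2 n j = indicator (double_coset n (diag_list
     (replicate (n - j) 1 @ replicate j pp @ replicate (n - j) (pp ^ 2) @ replicate j pp)))"

definition T_pow :: "nat \<Rightarrow> nat \<Rightarrow> 'p :: prime_card padic mat \<Rightarrow> real" where
  "T_pow n r x = (\<Sum>D \<in> double_coset n ` O_set n r. indicator D x)"

definition gauss_binomial :: "nat \<Rightarrow> nat \<Rightarrow> nat \<Rightarrow> real" where
  "gauss_binomial q m l = (\<Prod>i = 1..l. (real q ^ (m - l + i) - 1) / (real q ^ i - 1))"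

end

theory Submission
  imports Defs "Jordan_Normal_Form.Determinant"
begin

text \<open>
  An element \<open>g\<close> of \<open>O\<^sub>n(p\<^sup>r)\<close> is determined up to right multiplication by \<open>K\<close> by the lattice
  \<open>g Z\<^sub>p\<^sup>2\<^sup>n\<close>, which is its own dual up to \<open>p\<^sup>r\<close>. For \<open>r = 1\<close> this lattice contains \<open>p Z\<^sub>p\<^sup>2\<^sup>n\<close>
  and is the preimage of a Lagrangian subspace of \<open>F\<^sub>p\<^sup>2\<^sup>n\<close>. Hence \<open>T(p)\<^sup>2\<close> takes at \<open>x\<close> in
  \<open>O\<^sub>n(p\<^sup>2)\<close> the number of Lagrangians containing the image of \<open>x\<close> modulo \<open>p\<close>. On the double coset
  of \<open>T\<^sub>j(p\<^sup>2)\<close> this image is isotropic of dimension \<open>n - j\<close>, and the number is that of the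
  Lagrangians of a symplectic space of dimension \<open>2 j\<close>, namely \<open>(p + 1) \<dots> (p\<^sup>j + 1)\<close>. Since
  \<open>O\<^sub>n(p\<^sup>2)\<close> is the disjoint union of these double cosets, the relation follows, and the
  \<open>q\<close>-binomial theorem turns the product into the sum defining \<open>c\<^sub>j\<close>.
\<close>

text \<open>On the double coset of \<open>T_p2 n j\<close> the function \<open>T_pow n 2\<close> is
  1 and the convolution square is (p + 1) ... (p^j + 1), so the coefficient to subtract is this
  product minus 1. It vanishes for j = 0, where a single Lagrangian contains the image, and the sum
  therefore starts at 1. The integral becomes a count because the cosets yK are open, hence
  measurable, and have volume 1 by invariance. Openness is where it matters that the similitude
  factors of the ambient group are powers of p. Two things call for matrices over Z_p: lifting a
  Lagrangian to a similitude, and diagonalizing an element of O_n(p^2). Both rest on one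
  construction, a symplectic basis adapted to a set of vectors that is its own dual up to p^r. The
  count of Lagrangians is an induction that replaces V by the hyperplane of V orthogonal to a vector
  v. There v becomes radical, so nondegeneracy is lost; all counts are therefore stated for
  degenerate V, relative to the size of the radical, instead of passing to quotient spaces.\<close>

unbundle no vec_syntax

section \<open>Arithmetic of the \<open>p\<close>-adic integers\<close>

lemma residue_of_nat:
  "residue (of_nat m :: 'p :: prime_card padic_int) k = int m mod int CARD('p) ^ k"
proof (induction m)
  case 0
  then show ?case by (simp add: zero_padic_int.rep_eq)
next
  case (Suc m)
  then show ?case
    by (simp add: plus_padic_int.rep_eq one_padic_int.rep_eq mod_simps)
qed

lemma residue_range:
  fixes x :: "'p :: prime_card padic_int"
  shows "0 \<le> residue x k" "residue x k < int CARD('p) ^ k"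
proof -
  have "0 < int CARD('p)" by simp
  then have "0 < int CARD('p) ^ k" by simp
  then show "0 \<le> residue x k" "residue x k < int CARD('p) ^ k"
    by (metis residue_mod pos_mod_sign, metis residue_mod pos_mod_bound \<open>0 < int CARD('p) ^ k\<close>)
qed

lemma prime_gt_one: "1 < int CARD('p :: prime_card)"
  using prime_card_int[where 'a = 'p] prime_gt_1_int by blast

text \<open>Characteristic 0: modulo p^t with t at least m and k, both numbers are their own
  residues, because t < 2^t \<le> p^t. The trace argument for \<open>sp_proj\<close> rests on
  this.\<close>

lemma of_nat_padic_inj: "of_nat m = (of_nat k :: 'p :: prime_card padic_int) \<longleftrightarrow> m = k"
proof
  assume eq: "of_nat m = (of_nat k :: 'p padic_int)"
  define t where "t = max m k"
  have "2 ^ t \<le> int CARD('p) ^ t"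
    using prime_gt_one[where 'p = 'p] by (intro power_mono) auto
  moreover have "int t < 2 ^ t" by (metis of_nat_less_two_power)
  ultimately have "int t < int CARD('p) ^ t" by linarith
  then have t: "int m < int CARD('p) ^ t" "int k < int CARD('p) ^ t" unfolding t_def by linarith+
  from eq have "int m mod int CARD('p) ^ t = int k mod int CARD('p) ^ t"
    using residue_of_nat[where 'p = 'p] by metis
  then show "m = k" using t by simp
qed simp

definition \<pi> :: "'p :: prime_card padic_int" where
  "\<pi> = of_nat CARD('p)"

lemma residue_pi_power:
  "residue (\<pi> ^ j :: 'p :: prime_card padic_int) k = int CARD('p) ^ j mod int CARD('p) ^ k"
  using residue_of_nat[where 'p = 'p, of "CARD('p) ^ j" k] by (simp add: \<pi>_def)

text \<open>Level k alone decides because the quotient can be written down: its residue modulo p^i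
  is the residue of x modulo p^(i+k), divided by p^k.\<close>

lemma pi_power_dvd_iff:
  fixes x :: "'p :: prime_card padic_int"
  shows "\<pi> ^ k dvd x \<longleftrightarrow> residue x k = 0"
proof
  assume "\<pi> ^ k dvd x"
  then obtain y where "x = \<pi> ^ k * y" by blast
  then show "residue x k = 0" by (simp add: times_padic_int.rep_eq residue_pi_power)
next
  let ?p = "int CARD('p)"
  assume z: "residue x k = 0"
  define y where "y i = residue x (i + k) div ?p ^ k" for i
  have d: "?p ^ k dvd residue x (i + k)" for i
    using z residue_mod_le[of k "i + k" x] by (simp add: dvd_eq_mod_eq_0)
  have yk: "residue x (i + k) = ?p ^ k * y i" for i
    using d[of i] by (simp add: y_def)
  have p0: "?p ^ k \<noteq> 0" by simp
  have "y i = y (Suc i) mod ?p ^ i" for i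
  proof -
    have "?p ^ k * y i = residue x (Suc i + k) mod ?p ^ (i + k)"
      using residue_mod_le[of "i + k" "Suc i + k" x] yk[of i] by simp
    also have "\<dots> = (?p ^ k * y (Suc i)) mod (?p ^ k * ?p ^ i)"
      by (simp only: yk power_add mult.commute)
    also have "\<dots> = ?p ^ k * (y (Suc i) mod ?p ^ i)" by (rule mult_mod_right[symmetric])
    finally show ?thesis using p0 by simp
  qed
  then have r: "residue (Abs_padic_int y :: 'p padic_int) = y"
    by (intro Abs_padic_int_inverse CollectI allI)
  have "x = \<pi> ^ k * (Abs_padic_int y :: 'p padic_int)"
  proof (rule residue_eqI)
    fix i :: nat
    have "residue x i = residue x (i + k) mod ?p ^ i" using residue_mod_le[of i "i + k" x] by simp
    also have "\<dots> = residue (\<pi> ^ k * Abs_padic_int y :: 'p padic_int) i"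
      by (simp add: times_padic_int.rep_eq residue_pi_power r yk mod_simps)
    finally show "residue x i = residue (\<pi> ^ k * Abs_padic_int y :: 'p padic_int) i" .
  qed
  then show "\<pi> ^ k dvd x" by simp
qed

lemma pi_dvd_iff: "\<pi> dvd x \<longleftrightarrow> residue x 1 = 0"
  using pi_power_dvd_iff[of 1 x] by simp

lemma pi_not_dvd_one: "\<not> \<pi> dvd (1 :: 'p :: prime_card padic_int)"
  using prime_gt_one[where 'p = 'p] by (simp add: pi_dvd_iff one_padic_int.rep_eq)

lemma pi_nonzero [simp]: "\<pi> \<noteq> (0 :: 'p :: prime_card padic_int)"
  using of_nat_padic_inj[of "CARD('p)" 0, where 'p = 'p] by (simp add: \<pi>_def)

text \<open>Z_p is local with maximal ideal generated by p. Modulo each p^k the residue of x is a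
  unit, and the inverses form a coherent sequence because an inverse modulo p^k is unique.\<close>

lemma not_pi_dvd_imp_unit:
  fixes x :: "'p :: prime_card padic_int"
  assumes "\<not> \<pi> dvd x"
  shows "x dvd 1"
proof -
  let ?p = "int CARD('p)"
  have "\<not> ?p dvd residue x k" if "k \<ge> 1" for k
    using assms residue_mod_le[OF that, of x] by (simp add: pi_dvd_iff dvd_eq_mod_eq_0)
  then have "coprime (residue x k) (?p ^ k)" for k
    using prime_card_int[where 'a = 'p]
    by (metis coprime_1_right coprime_commute coprime_power_left_iff less_one not_le power_0
        prime_imp_coprime)
  then have "\<exists>y. residue x k * y mod ?p ^ k = 1 mod ?p ^ k" for k
    using cong_solve_coprime_int[of "residue x k" "?p ^ k"] by (auto simp: cong_def)
  then obtain y where y: "\<And>k. residue x k * y k mod ?p ^ k = 1 mod ?p ^ k" by metis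
  define z where "z k = y k mod ?p ^ k" for k
  have "z k = z (Suc k) mod ?p ^ k" for k
  proof -
    have "residue x k * y (Suc k) mod ?p ^ k = residue x (Suc k) * y (Suc k) mod ?p ^ k"
      using residue_mod_le[of k "Suc k" x] mod_mult_left_eq[of "residue x (Suc k)" "?p ^ k" "y (Suc k)"]
      by simp
    also have "\<dots> = (residue x (Suc k) * y (Suc k) mod ?p ^ Suc k) mod ?p ^ k"
      by (rule mod_Suc_power)
    also have "\<dots> = 1 mod ?p ^ k" unfolding y by (rule mod_Suc_power[symmetric])
    finally have e: "residue x k * y (Suc k) mod ?p ^ k = 1 mod ?p ^ k" .
    \<comment> \<open>Uniqueness of the inverse: insert x y(k+1) = 1 modulo p^k, then cancel x y(k)
      = 1.\<close>
    have "y k mod ?p ^ k = y k * (residue x k * y (Suc k)) mod ?p ^ k"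
      using mod_mult_right_eq[of "y k" "residue x k * y (Suc k)" "?p ^ k"]
        mod_mult_right_eq[of "y k" 1 "?p ^ k"] by (simp add: e)
    also have "\<dots> = (residue x k * y k) * y (Suc k) mod ?p ^ k" by (simp add: ac_simps)
    also have "\<dots> = y (Suc k) mod ?p ^ k" 
      using mod_mult_left_eq[of "residue x k * y k" "?p ^ k" "y (Suc k)"]
        mod_mult_left_eq[of 1 "?p ^ k" "y (Suc k)"] by (simp add: y)
    finally show ?thesis by (simp only: z_def mod_Suc_power[symmetric])
  qed
  then have r: "residue (Abs_padic_int z :: 'p padic_int) = z"
    by (intro Abs_padic_int_inverse CollectI allI)
  have "x * Abs_padic_int z = 1"
    by (rule residue_eqI)
      (simp add: times_padic_int.rep_eq r z_def y one_padic_int.rep_eq mod_simps)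
  then show ?thesis by (metis dvdI)
qed

text \<open>The p-adic filtration is separated. Contents of nonzero vectors are therefore finite,
  and an identity can be verified modulo all powers of p.\<close>

lemma not_all_pi_powers_dvd:
  fixes x :: "'p :: prime_card padic_int"
  assumes "\<And>k. \<pi> ^ k dvd x"
  shows "x = 0"
  using assms by (intro residue_eqI) (simp add: pi_power_dvd_iff zero_padic_int.rep_eq)

section \<open>Reduction to F_p and the embedding into Q_p\<close>

definition red :: "'p :: prime_card padic_int \<Rightarrow> 'p mod_ring" where
  "red x = of_int (residue x 1)"

lemma of_int_mod_ring_mod:
  "(of_int (a mod int CARD('p)) :: 'p :: prime_card mod_ring) = of_int a"
  using of_int_mod_CHAR[of a, where 'a = "'p mod_ring"] by simp

lemma red_hom: "comm_ring_hom (red :: 'p :: prime_card padic_int \<Rightarrow> 'p mod_ring)"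
  by unfold_locales
    (simp_all add: red_def plus_padic_int.rep_eq times_padic_int.rep_eq zero_padic_int.rep_eq
      one_padic_int.rep_eq of_int_mod_ring_mod)

interpretation red: comm_ring_hom "red :: 'p :: prime_card padic_int \<Rightarrow> 'p mod_ring"
  by (rule red_hom)

lemma red_eq_0_iff: "red x = 0 \<longleftrightarrow> \<pi> dvd (x :: 'p :: prime_card padic_int)"
proof
  assume "red x = 0"
  then have "to_int_mod_ring (of_int_mod_ring (residue x 1) :: 'p mod_ring) = to_int_mod_ring 0"
    unfolding red_def of_int_of_int_mod_ring by simp
  then have "residue x 1 = to_int_mod_ring (0 :: 'p mod_ring)"
    using residue_range[of x 1] by (simp only: to_int_mod_ring_of_int_mod_ring power_one_right)
  then show "\<pi> dvd x" by (simp add: pi_dvd_iff)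
qed (simp add: red_def pi_dvd_iff)

lemma red_surj: "\<exists>x :: 'p :: prime_card padic_int. red x = a"
proof -
  obtain i where "a = of_nat i" using surj_of_nat_mod_ring[of a] by blast
  then have "red (of_nat i) = a" by (simp add: red.hom_of_nat)
  then show ?thesis by blast
qed

lemma to_fract_hom: "inj_comm_ring_hom (to_fract :: 'p :: prime_card padic_int \<Rightarrow> 'p padic)"
  by unfold_locales simp_all

interpretation emb: inj_comm_ring_hom "to_fract :: 'p :: prime_card padic_int \<Rightarrow> 'p padic"
  by (rule to_fract_hom)

lemma Zp_eq: "Zp = range to_fract"
  by (auto simp: Zp_def to_fract_def)

lemma to_fract_pi: "to_fract \<pi> = (pp :: 'p :: prime_card padic)"
  unfolding \<pi>_def by (simp add: to_fract_def of_nat_fract)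

text \<open>A denominator is a power of p times a unit, and the unit is inverted inside Z_p.\<close>

lemma padic_denominator:
  fixes z :: "'p :: prime_card padic"
  shows "\<exists>s. pp ^ s * z \<in> Zp"
proof -
  obtain a b where z: "z = Fract a b" "b \<noteq> 0" by (rule Fract_cases)
  then obtain k where "\<not> \<pi> ^ k dvd b" using not_all_pi_powers_dvd by blast
  then obtain s where s: "\<pi> ^ s dvd b" "\<not> \<pi> ^ Suc s dvd b"
    using ex_least_nat_less[of "\<lambda>k. \<not> \<pi> ^ k dvd b" k] by auto
  then obtain u where u: "b = \<pi> ^ s * u" by blast
  with s(2) have "\<not> \<pi> dvd u" by (auto simp: mult.assoc power_Suc2 simp del: power_Suc)
  then obtain v where v: "u * v = 1" using not_pi_dvd_imp_unit by (metis dvdE)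
  have "pp ^ s * z = to_fract (\<pi> ^ s) * Fract a b" by (simp add: z to_fract_pi emb.hom_power)
  also have "\<dots> = to_fract (a * v)"
    using z(2) v by (simp add: to_fract_def eq_fract u) (metis mult.commute mult.left_commute mult_1)
  finally show ?thesis unfolding Zp_eq by blast
qed

section \<open>Gaussian binomial coefficients\<close>

lemma power_minus_one_nonzero:
  assumes "q \<ge> 2" "i \<ge> 1"
  shows "real q ^ i - 1 \<noteq> 0"
proof -
  have "1 < real q ^ i" using assms by (intro one_less_power) auto
  then show ?thesis by simp
qed

lemma gauss_binomial_0: "gauss_binomial q m 0 = 1"
  by (simp add: gauss_binomial_def)

lemma gauss_binomial_self:
  assumes "q \<ge> 2"
  shows "gauss_binomial q m m = 1"
proof -
  have "real q ^ i - 1 \<noteq> 0" if "i \<in> {1..m}" for i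
    using power_minus_one_nonzero[OF assms, of i] that by simp
  then show ?thesis unfolding gauss_binomial_def by (intro prod.neutral) auto
qed

text \<open>The quotient of neighbours in a row, cleared of denominators: raising l by one adds one
  factor to the numerator and one to the denominator.\<close>

lemma gauss_binomial_Suc:
  assumes "q \<ge> 2" "l < m"
  shows "gauss_binomial q m (Suc l) * (real q ^ Suc l - 1) = gauss_binomial q m l * (real q ^ (m - l) - 1)"
proof -
  note nz = power_minus_one_nonzero[OF assms(1)]
  \<comment> \<open>Reversing the index frees the factors of k, which makes the products for l and l
    + 1 comparable.\<close>
  have num: "(\<Prod>i = 1..k. real q ^ (m - k + i) - 1) = (\<Prod>i<k. real q ^ (m - i) - 1)" if "k \<le> m" for k
    by (rule prod.reindex_bij_witness[of _ "\<lambda>i. k - i" "\<lambda>i. k - i"]) (use that in auto)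
  have "gauss_binomial q m k * (\<Prod>i = 1..k. real q ^ i - 1) = (\<Prod>i<k. real q ^ (m - i) - 1)" if "k \<le> m" for k
  proof -
    have "(\<Prod>i = 1..k. real q ^ i - 1) \<noteq> 0" using nz by simp
    then show ?thesis unfolding gauss_binomial_def prod_dividef num[OF that, symmetric] by simp
  qed
  note g = this[of l] this[of "Suc l"]
  have "(\<Prod>i = 1..l. real q ^ i - 1) \<noteq> 0" using nz by simp
  moreover have "gauss_binomial q m (Suc l) * (real q ^ Suc l - 1) * (\<Prod>i = 1..l. real q ^ i - 1)
      = gauss_binomial q m l * (real q ^ (m - l) - 1) * (\<Prod>i = 1..l. real q ^ i - 1)"
    using g assms(2) by (simp add: mult_ac)
  ultimately show ?thesis by simp
qed

text \<open>The companion ratio in the column direction, derived from the row ratio by induction on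
  l.\<close>

lemma gauss_binomial_top:
  assumes "q \<ge> 2" "l \<le> m"
  shows "gauss_binomial q (Suc m) l * (real q ^ (Suc m - l) - 1) = gauss_binomial q m l * (real q ^ Suc m - 1)"
  using assms(2)
proof (induction l)
  case (Suc l)
  note nz = power_minus_one_nonzero[OF assms(1)]
  have e: "gauss_binomial q (Suc m) (Suc l) * (real q ^ Suc l - 1) = gauss_binomial q (Suc m) l * (real q ^ (Suc m - l) - 1)"
    "gauss_binomial q m (Suc l) * (real q ^ Suc l - 1) = gauss_binomial q m l * (real q ^ (m - l) - 1)"
    using gauss_binomial_Suc[OF assms(1), of l] Suc.prems by auto
  have "gauss_binomial q (Suc m) (Suc l) * (real q ^ (m - l) - 1) * (real q ^ Suc l - 1)
      = gauss_binomial q m l * (real q ^ Suc m - 1) * (real q ^ (m - l) - 1)"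
    using e(1) Suc.IH Suc.prems by (simp add: mult_ac)
  also have "\<dots> = gauss_binomial q m (Suc l) * (real q ^ Suc m - 1) * (real q ^ Suc l - 1)"
    using e(2) by (simp add: mult_ac)
  finally show ?case using nz[of "Suc l"] by simp
qed (simp add: gauss_binomial_0)

lemma gauss_binomial_pascal:
  assumes q: "q \<ge> 2" and l: "l < m"
  shows "gauss_binomial q (Suc m) (Suc l) = gauss_binomial q m (Suc l) + real q ^ (m - l) * gauss_binomial q m l"
proof -
  note nz = power_minus_one_nonzero[OF q]
  have pow: "real q ^ (m - l) * real q ^ Suc l = real q ^ Suc m"
    using l by (simp flip: power_add)
  have "gauss_binomial q (Suc m) (Suc l) * (real q ^ Suc l - 1) = gauss_binomial q m l * (real q ^ Suc m - 1)"
    using gauss_binomial_Suc[OF q, of l "Suc m"] gauss_binomial_top[OF q, of l m] l by simp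
  \<comment> \<open>This splitting of q^(m+1) - 1 produces the two terms of the Pascal
    recursion.\<close>
  also have "real q ^ Suc m - 1 = (real q ^ (m - l) - 1) + real q ^ (m - l) * (real q ^ Suc l - 1)"
    unfolding pow[symmetric] by (simp add: algebra_simps)
  also have "gauss_binomial q m l * (real q ^ (m - l) - 1 + real q ^ (m - l) * (real q ^ Suc l - 1))
      = gauss_binomial q m l * (real q ^ (m - l) - 1) + real q ^ (m - l) * gauss_binomial q m l * (real q ^ Suc l - 1)"
    by (simp only: distrib_left mult_ac)
  also have "\<dots> = (gauss_binomial q m (Suc l) + real q ^ (m - l) * gauss_binomial q m l) * (real q ^ Suc l - 1)"
    unfolding gauss_binomial_Suc[OF q l, symmetric] by (simp only: distrib_right)
  finally show ?thesis using nz[of "Suc l"] by simp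
qed

text \<open>Cauchy's q-binomial theorem for (1 + x)(1 + x q) ... (1 + x q^(s-1)) at x = q, where the
  usual exponents i(i-1)/2 turn into i(i+1)/2. By the Pascal recursion, passing from s to s + 1
  multiplies the sum by 1 + q^(s+1).\<close>

lemma q_binomial_theorem:
  assumes q: "q \<ge> 2"
  shows "(\<Sum>i\<le>s. real q ^ (i * (i + 1) div 2) * gauss_binomial q s i) = (\<Prod>i = 1..s. real q ^ i + 1)"
proof (induction s)
  case 0
  show ?case by (simp add: gauss_binomial_0)
next
  case (Suc s)
  let ?g = "gauss_binomial q" and ?t = "\<lambda>i :: nat. i * (i + 1) div 2"
  have tri: "?t (Suc i) = ?t i + Suc i" for i by simp
  have split: "(\<Sum>i\<le>Suc s. f i) = f 0 + (\<Sum>i<s. f (Suc i)) + f (Suc s)" for f :: "nat \<Rightarrow> real"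
    using sum.lessThan_Suc_shift[of f s] by (simp add: lessThan_Suc_atMost[symmetric])
  have split': "(\<Sum>i\<le>s. f i) = f 0 + (\<Sum>i<s. f (Suc i))" for f :: "nat \<Rightarrow> real"
    unfolding lessThan_Suc_atMost[symmetric] by (rule sum.lessThan_Suc_shift)
  have split'': "(\<Sum>i\<le>s. f i) = (\<Sum>i<s. f i) + f s" for f :: "nat \<Rightarrow> real"
    by (simp add: lessThan_Suc_atMost[symmetric])
  have "(\<Sum>i\<le>Suc s. real q ^ ?t i * ?g (Suc s) i)
      = 1 + (\<Sum>i<s. real q ^ ?t (Suc i) * ?g (Suc s) (Suc i)) + real q ^ ?t (Suc s)"
    unfolding split by (simp only: gauss_binomial_0 gauss_binomial_self[OF q]) simp
  also have "(\<Sum>i<s. real q ^ ?t (Suc i) * ?g (Suc s) (Suc i))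
      = (\<Sum>i<s. real q ^ ?t (Suc i) * ?g s (Suc i) + real q ^ Suc s * (real q ^ ?t i * ?g s i))"
  proof (rule sum.cong[OF refl])
    fix i assume "i \<in> {..<s}"
    then have i: "i < s" by simp
    \<comment> \<open>With t(i) = i(i+1)/2 the exponents satisfy t(i+1) + (s - i) = (s + 1) + t(i),
      so the second Pascal term is q^(s+1) times a term of the sum for s.\<close>
    have "real q ^ ?t (Suc i) * real q ^ (s - i) = real q ^ Suc s * real q ^ ?t i"
      unfolding tri power_add[symmetric] using i by (intro arg_cong[of _ _ "\<lambda>k. real q ^ k"]) simp
    then show "real q ^ ?t (Suc i) * ?g (Suc s) (Suc i)
        = real q ^ ?t (Suc i) * ?g s (Suc i) + real q ^ Suc s * (real q ^ ?t i * ?g s i)"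
      unfolding gauss_binomial_pascal[OF q i] by (simp only: distrib_left mult.assoc[symmetric])
  qed
  also have "\<dots> = (\<Sum>i<s. real q ^ ?t (Suc i) * ?g s (Suc i)) + real q ^ Suc s * (\<Sum>i<s. real q ^ ?t i * ?g s i)"
    by (simp only: sum.distrib sum_distrib_left)
  also have "1 + \<dots> + real q ^ ?t (Suc s)
      = (1 + (\<Sum>i<s. real q ^ ?t (Suc i) * ?g s (Suc i)))
        + real q ^ Suc s * ((\<Sum>i<s. real q ^ ?t i * ?g s i) + real q ^ ?t s)"
    unfolding tri power_add by (simp only: distrib_left) (simp only: ac_simps)
  also have "1 + (\<Sum>i<s. real q ^ ?t (Suc i) * ?g s (Suc i)) = (\<Prod>i = 1..s. real q ^ i + 1)"
    using Suc.IH unfolding split' by (simp only: gauss_binomial_0) simp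
  also have "(\<Sum>i<s. real q ^ ?t i * ?g s i) + real q ^ ?t s = (\<Prod>i = 1..s. real q ^ i + 1)"
    using Suc.IH unfolding split'' by (simp only: gauss_binomial_self[OF q] mult_1_right)
  finally show ?case by (simp add: algebra_simps)
qed

text \<open>The subtracted 1 is the term i = 0 of the q-binomial sum.\<close>

lemma q_binomial_coefficient:
  assumes "q \<ge> 2"
  shows "(\<Sum>i = 1..s. real q ^ (i * (i + 1) div 2) * gauss_binomial q s i) = (\<Prod>i = 1..s. real q ^ i + 1) - 1"
proof -
  have "{..s} = insert 0 {1..s}" by auto
  then show ?thesis
    using q_binomial_theorem[OF assms, of s] by (simp add: gauss_binomial_0)
qed

section \<open>The symplectic form\<close>

text \<open>The bilinear form of \<open>J_mat n\<close> in coordinates, see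
  \<open>scalar_prod_J\<close>. The explicit sum makes sense over any commutative ring and commutes
  with reduction modulo p.\<close>

definition sp_form :: "nat \<Rightarrow> 'a :: comm_ring_1 vec \<Rightarrow> 'a vec \<Rightarrow> 'a" where
  "sp_form n v w = (\<Sum>i<n. v $ i * w $ (n + i) - v $ (n + i) * w $ i)"

lemma sp_form_swap: "sp_form n w v = - sp_form n v w"
  unfolding sp_form_def sum_negf[symmetric] by (rule sum.cong) (simp_all add: algebra_simps)

lemma sp_form_self [simp]: "sp_form n v v = 0"
  by (simp add: sp_form_def)

lemma sp_form_add_left:
  assumes "u \<in> carrier_vec (2 * n)" "v \<in> carrier_vec (2 * n)"
  shows "sp_form n (u + v) w = sp_form n u w + sp_form n v w"
  using assms unfolding sp_form_def sum.distrib[symmetric]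
  by (intro sum.cong) (auto simp: algebra_simps)

lemma sp_form_diff_left:
  assumes "u \<in> carrier_vec (2 * n)" "v \<in> carrier_vec (2 * n)"
  shows "sp_form n (u - v) w = sp_form n u w - sp_form n v w"
  using assms unfolding sp_form_def sum_subtractf[symmetric]
  by (intro sum.cong) (auto simp: algebra_simps)

lemma sp_form_smult_left:
  assumes "v \<in> carrier_vec (2 * n)"
  shows "sp_form n (c \<cdot>\<^sub>v v) w = c * sp_form n v w"
  using assms unfolding sp_form_def sum_distrib_left
  by (intro sum.cong) (auto simp: algebra_simps)

lemma sp_form_diff_right:
  assumes "u \<in> carrier_vec (2 * n)" "v \<in> carrier_vec (2 * n)"
  shows "sp_form n w (u - v) = sp_form n w u - sp_form n w v"
  using assms sp_form_diff_left[of u n v w] by (simp add: sp_form_swap[of n w])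

lemma sp_form_smult_right:
  assumes "v \<in> carrier_vec (2 * n)"
  shows "sp_form n w (c \<cdot>\<^sub>v v) = c * sp_form n w v"
  using assms sp_form_smult_left[of v n c w] by (simp add: sp_form_swap[of n w])

lemma sp_form_zero_left [simp]: "sp_form n (0\<^sub>v (2 * n)) w = 0"
  by (simp add: sp_form_def)

lemma sum_split_half:
  fixes n :: nat
  shows "(\<Sum>i<2 * n. f i) = (\<Sum>i<n. f i) + (\<Sum>i<n. f (n + i))"
proof -
  have "(\<Sum>i<2 * n. f i) = (\<Sum>i<n. f i) + (\<Sum>i=n..<n + n. f i)"
    by (simp add: sum.atLeastLessThan_concat lessThan_atLeast0 mult_2)
  also have "(\<Sum>i=n..<n + n. f i) = (\<Sum>i<n. f (n + i))"
    using sum.shift_bounds_nat_ivl[of f 0 n n] by (simp add: lessThan_atLeast0 add.commute)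
  finally show ?thesis .
qed

lemma J_mat_carrier [simp]: "J_mat n \<in> carrier_mat (2 * n) (2 * n)"
  unfolding J_mat_def using four_block_carrier_mat[of "0\<^sub>m n n" n n "0\<^sub>m n n" n n]
  by (simp add: mult_2)

lemma J_mat_dim [simp]: "dim_row (J_mat n) = 2 * n" "dim_col (J_mat n) = 2 * n"
  using J_mat_carrier[of n] by blast+

lemma J_mat_index:
  assumes "i < 2 * n" "j < 2 * n"
  shows "J_mat n $$ (i, j) = (if j = n + i then 1 else if i = n + j then - 1 else 0)"
  using assms unfolding J_mat_def by (auto simp: index_mat_four_block)

lemma J_mat_mult_vec_index:
  assumes "w \<in> carrier_vec (2 * n)" "i < 2 * n"
  shows "(J_mat n *\<^sub>v w) $ i = (if i < n then w $ (n + i) else - w $ (i - n))"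
proof -
  have "(J_mat n *\<^sub>v w) $ i = (\<Sum>j<2 * n. J_mat n $$ (i, j) * w $ j)"
    using assms by (simp add: scalar_prod_def lessThan_atLeast0)
  also have "\<dots> = (\<Sum>j<2 * n. if j = (if i < n then n + i else i - n)
      then (if i < n then w $ j else - w $ j) else 0)"
    using assms(2) by (intro sum.cong) (auto simp: J_mat_index)
  also have "\<dots> = (if i < n then w $ (n + i) else - w $ (i - n))"
    using assms(2) by (subst sum.delta) auto
  finally show ?thesis .
qed

lemma scalar_prod_J:
  assumes "v \<in> carrier_vec (2 * n)" "w \<in> carrier_vec (2 * n)"
  shows "v \<bullet> (J_mat n *\<^sub>v w) = sp_form n v w"
proof -
  have "v \<bullet> (J_mat n *\<^sub>v w) = (\<Sum>i<2 * n. v $ i * (J_mat n *\<^sub>v w) $ i)"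
    by (simp add: scalar_prod_def lessThan_atLeast0 del: index_mult_mat_vec)
  also have "\<dots> = (\<Sum>i<n. v $ i * w $ (n + i)) + (\<Sum>i<n. v $ (n + i) * - w $ i)"
    unfolding sum_split_half using assms
    by (simp add: J_mat_mult_vec_index del: index_mult_mat_vec)
  finally show ?thesis by (simp add: sp_form_def sum_subtractf sum_negf)
qed

lemma transpose_J_mult_index:
  assumes "A \<in> carrier_mat (2 * n) a" "C \<in> carrier_mat (2 * n) c" "i < a" "j < c"
  shows "(A\<^sup>T * J_mat n * C) $$ (i, j) = sp_form n (col A i) (col C j)"
proof -
  have "A\<^sup>T * J_mat n * C = A\<^sup>T * (J_mat n * C)"
    using assms by (intro assoc_mult_mat[of _ a "2 * n" _ "2 * n" _ c]) auto
  then have "(A\<^sup>T * J_mat n * C) $$ (i, j) = row (A\<^sup>T) i \<bullet> col (J_mat n * C) j"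
    using assms by (simp del: col_mult2)
  also have "\<dots> = col A i \<bullet> (J_mat n *\<^sub>v col C j)"
    using assms by (simp only: col_mult2[OF J_mat_carrier assms(2,4)] row_transpose carrier_matD)
  also have "\<dots> = sp_form n (col A i) (col C j)"
    using assms by (intro scalar_prod_J carrier_vecI) auto
  finally show ?thesis .
qed

lemma J_mat_sqr: "J_mat n * J_mat n = - (1\<^sub>m (2 * n) :: 'a :: comm_ring_1 mat)"
proof (rule eq_matI)
  fix i j assume "i < dim_row (- (1\<^sub>m (2 * n) :: 'a mat))" "j < dim_col (- (1\<^sub>m (2 * n) :: 'a mat))"
  then have ij: "i < 2 * n" "j < 2 * n" by simp_all
  have "(J_mat n * J_mat n :: 'a mat) $$ (i, j) = (J_mat n *\<^sub>v col (J_mat n) j) $ i"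
    using ij by simp
  also have "\<dots> = (- 1\<^sub>m (2 * n)) $$ (i, j)"
    using ij by (subst J_mat_mult_vec_index) (auto simp: J_mat_index intro!: carrier_vecI)
  finally show "(J_mat n * J_mat n :: 'a mat) $$ (i, j) = (- 1\<^sub>m (2 * n)) $$ (i, j)" .
qed simp_all

lemma sp_form_unit_left:
  assumes "v \<in> carrier_vec (2 * n)" "l < 2 * n"
  shows "sp_form n (unit_vec (2 * n) l) v = (if l < n then v $ (n + l) else - v $ (l - n))"
proof -
  have "sp_form n (unit_vec (2 * n) l) v = (J_mat n *\<^sub>v v) $ l"
    using assms
    by (subst scalar_prod_J[symmetric])
      (auto intro!: scalar_prod_left_unit carrier_vecI simp del: index_mult_mat_vec)
  then show ?thesis using assms J_mat_mult_vec_index by metis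
qed

lemma (in comm_ring_hom) sp_form_hom:
  assumes "v \<in> carrier_vec (2 * n)" "w \<in> carrier_vec (2 * n)"
  shows "sp_form n (map_vec hom v) (map_vec hom w) = hom (sp_form n v w)"
  using assms unfolding sp_form_def hom_sum by (intro sum.cong) (simp_all add: hom_minus hom_mult)

lemma (in comm_ring_hom) J_mat_hom: "map_mat hom (J_mat n) = J_mat n"
  by (intro eq_matI) (auto simp: J_mat_index hom_uminus)

definition lincomb_vec :: "nat \<Rightarrow> nat \<Rightarrow> (nat \<Rightarrow> 'a :: comm_ring_1) \<Rightarrow> (nat \<Rightarrow> 'a vec) \<Rightarrow> 'a vec" where
  "lincomb_vec N k c u = vec N (\<lambda>l. \<Sum>i<k. c i * u i $ l)"

lemma lincomb_vec_carrier [simp]: "lincomb_vec N k c u \<in> carrier_vec N"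
  by (simp add: lincomb_vec_def)

lemma sp_form_lincomb_left:
  "sp_form n (lincomb_vec (2 * n) k c u) w = (\<Sum>i<k. c i * sp_form n (u i) w)"
proof -
  have "sp_form n (lincomb_vec (2 * n) k c u) w =
      (\<Sum>j<n. \<Sum>i<k. c i * (u i $ j * w $ (n + j) - u i $ (n + j) * w $ j))"
    unfolding sp_form_def lincomb_vec_def
    by (intro sum.cong refl)
      (simp add: sum_distrib_right sum_subtractf[symmetric] right_diff_distrib mult.assoc)
  also have "\<dots> = (\<Sum>i<k. c i * sp_form n (u i) w)"
    unfolding sp_form_def sum_distrib_left by (rule sum.swap)
  finally show ?thesis .
qed

lemma sp_form_unit_expand:
  assumes "v \<in> carrier_vec (2 * n)"
  shows "(\<Sum>l<2 * n. v $ l * sp_form n (unit_vec (2 * n) l) w) = sp_form n v w"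
proof -
  have "lincomb_vec (2 * n) (2 * n) (\<lambda>l. v $ l) (unit_vec (2 * n)) = v"
  proof (rule eq_vecI)
    fix j assume "j < dim_vec v"
    then have j: "j < 2 * n" using assms by simp
    have "(\<Sum>i<2 * n. v $ i * unit_vec (2 * n) i $ j) = (\<Sum>i<2 * n. if i = j then v $ i else 0)"
      using j by (intro sum.cong) auto
    then show "lincomb_vec (2 * n) (2 * n) (\<lambda>l. v $ l) (unit_vec (2 * n)) $ j = v $ j"
      using j by (simp add: lincomb_vec_def)
  qed (use assms in \<open>simp_all add: lincomb_vec_def\<close>)
  then show ?thesis
    using sp_form_lincomb_left[of n "2 * n" "\<lambda>l. v $ l" "unit_vec (2 * n)" w] by simp
qed

section \<open>Lagrangian subspaces over a finite field\<close>

lemma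
  fixes I :: "nat set"
  assumes "I \<subseteq> {..<N}"
  defines "W \<equiv> {v \<in> carrier_vec N. \<forall>i\<in>I. v $ i = (0 :: 'a :: {zero, finite})}"
  shows finite_coordinate_subspace: "finite W"
    and card_coordinate_subspace: "card W = CARD('a) ^ (N - card I)"
proof -
  define A where "A = PiE {..<N} (\<lambda>i. if i \<in> I then {0 :: 'a} else UNIV)"
  have "bij_betw (vec N) A W"
  proof (rule bij_betw_byWitness[of _ "\<lambda>v. restrict (($) v) {..<N}"])
    show "\<forall>f\<in>A. restrict (($) (vec N f)) {..<N} = f"
      by (auto simp: A_def PiE_iff extensional_def fun_eq_iff)
    show "(\<lambda>v. restrict (($) v) {..<N}) ` W \<subseteq> A"
      by (auto simp: A_def W_def PiE_iff split: if_splits)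
    show "vec N ` A \<subseteq> W"
    proof clarify
      fix f assume f: "f \<in> A"
      have "f i = 0" if "i \<in> I" for i
        using f that assms(1) PiE_mem[of f "{..<N}" _ i] unfolding A_def by (auto split: if_splits)
      then show "vec N f \<in> W" using assms(1) by (auto simp: W_def)
    qed
  qed (auto simp: W_def)
  moreover have "finite A" unfolding A_def by (intro finite_PiE) auto
  moreover have "card A = CARD('a) ^ (N - card I)"
  proof -
    have "card A = (\<Prod>i<N. if i \<in> I then 1 else CARD('a))"
      unfolding A_def by (subst card_PiE) (auto intro!: prod.cong)
    also have "\<dots> = (\<Prod>i\<in>{..<N} - I. CARD('a))"
      by (intro prod.mono_neutral_cong_right) auto
    also have "\<dots> = CARD('a) ^ (N - card I)"
      using assms(1) by (simp add: card_Diff_subset finite_subset)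
    finally show ?thesis .
  qed
  ultimately show "finite W" "card W = CARD('a) ^ (N - card I)"
    by (metis bij_betw_finite, metis bij_betw_same_card)
qed

text \<open>The complement is taken inside V, which may be degenerate: \<open>perp n V V\<close> is
  the radical of V.\<close>

definition perp :: "nat \<Rightarrow> 'a :: comm_ring_1 vec set \<Rightarrow> 'a vec set \<Rightarrow> 'a vec set" where
  "perp n V S = {v \<in> V. \<forall>s\<in>S. sp_form n v s = 0}"

definition subspace_vec :: "nat \<Rightarrow> 'a :: comm_ring_1 vec set \<Rightarrow> bool" where
  "subspace_vec N V \<longleftrightarrow> V \<subseteq> carrier_vec N \<and> 0\<^sub>v N \<in> V \<and>
     (\<forall>u\<in>V. \<forall>v\<in>V. u + v \<in> V) \<and> (\<forall>c. \<forall>v\<in>V. c \<cdot>\<^sub>v v \<in> V)"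

lemma subspace_vecD:
  assumes "subspace_vec N V"
  shows "V \<subseteq> carrier_vec N" "0\<^sub>v N \<in> V" "u \<in> V \<Longrightarrow> v \<in> V \<Longrightarrow> u + v \<in> V" "v \<in> V \<Longrightarrow> c \<cdot>\<^sub>v v \<in> V"
  using assms unfolding subspace_vec_def by blast+

lemma subspace_vec_diff:
  assumes "subspace_vec N V" "u \<in> V" "v \<in> V"
  shows "u - v \<in> V"
proof -
  have "u - v = u + (- 1) \<cdot>\<^sub>v v"
    using assms subspace_vecD(1)[OF assms(1)] by (intro eq_vecI) auto
  then show ?thesis using assms subspace_vecD by metis
qed

lemma perp_subset: "perp n V S \<subseteq> V"
  by (auto simp: perp_def)

lemma subspace_vec_perp:
  assumes "subspace_vec (2 * n) V"
  shows "subspace_vec (2 * n) (perp n V S)"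
  using subspace_vecD[OF assms] unfolding subspace_vec_def perp_def
  by (auto simp: sp_form_add_left sp_form_smult_left subset_iff)

lemma finite_subspace_vec:
  "subspace_vec N V \<Longrightarrow> finite (V :: 'a :: {comm_ring_1, finite} vec set)"
  using finite_coordinate_subspace[of "{}" N, where 'a = 'a]
  by (auto dest: subspace_vecD(1) intro: finite_subset)

lemma normalize_pairing:
  fixes V :: "'a :: field vec set"
  assumes V: "subspace_vec (2 * n) V" and v: "v \<in> V" "v \<notin> perp n V V"
  shows "\<exists>w\<in>V. sp_form n w v = 1"
proof -
  obtain u where u: "u \<in> V" "sp_form n v u \<noteq> 0" using v unfolding perp_def by blast
  then have u': "sp_form n u v \<noteq> 0" using sp_form_swap[of n u v] by simp
  have "sp_form n (inverse (sp_form n u v) \<cdot>\<^sub>v u) v = 1"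
    using u u' subspace_vecD(1)[OF V] by (subst sp_form_smult_left) auto
  then show ?thesis using subspace_vecD(4)[OF V u(1)] by blast
qed

text \<open>A vector w with <w, v> = 1 splits the functional <., v> on V, so V is the direct sum of
  the hyperplane orthogonal to v and the line of w.\<close>

lemma card_perp_vector:
  fixes V :: "'a :: {field, finite} vec set"
  assumes V: "subspace_vec (2 * n) V" and v: "v \<in> V" "v \<notin> perp n V V"
  shows "card V = CARD('a) * card (perp n V {v})"
proof -
  obtain w where w: "w \<in> V" "sp_form n w v = 1" using normalize_pairing[OF assms] by blast
  note Vc = subsetD[OF subspace_vecD(1)[OF V]]
  let ?f = "\<lambda>(x, c). x + c \<cdot>\<^sub>v w" and ?g = "\<lambda>y. (y - sp_form n y v \<cdot>\<^sub>v w, sp_form n y v)"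
  have val: "sp_form n (x + c \<cdot>\<^sub>v w) v = c" if "x \<in> perp n V {v}" for x c
    using that w Vc[of x] Vc[OF w(1)]
    by (simp add: perp_def sp_form_add_left sp_form_smult_left)
  have "bij_betw ?f (perp n V {v} \<times> UNIV) V"
  proof (rule bij_betw_byWitness[of _ ?g])
    show "\<forall>a\<in>perp n V {v} \<times> UNIV. ?g (?f a) = a"
    proof
      fix a assume "a \<in> perp n V {v} \<times> (UNIV :: 'a set)"
      then obtain x c where a: "a = (x, c)" and x: "x \<in> perp n V {v}" by blast
      then have "x \<in> carrier_vec (2 * n)" using Vc unfolding perp_def by blast
      then have "x + c \<cdot>\<^sub>v w - c \<cdot>\<^sub>v w = x" using Vc[OF w(1)] by (intro eq_vecI) auto
      then show "?g (?f a) = a" using val[OF x] by (simp add: a)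
    qed
    show "\<forall>y\<in>V. ?f (?g y) = y"
      using Vc Vc[OF w(1)] by (auto intro!: eq_vecI dest!: Vc)
    show "?f ` (perp n V {v} \<times> UNIV) \<subseteq> V"
      using w subspace_vecD(3,4)[OF V] by (auto simp: perp_def)
    show "?g ` V \<subseteq> perp n V {v} \<times> UNIV"
      using w subspace_vecD(4)[OF V] subspace_vec_diff[OF V] Vc
      by (auto simp: perp_def sp_form_diff_left sp_form_smult_left)
  qed
  from bij_betw_same_card[OF this] show ?thesis by (simp add: card_cartesian_product mult.commute)
qed

text \<open>A functional on V that vanishes on the hyperplane orthogonal to v is a multiple of <v,
  .>; conversely v lies in its own hyperplane because the form is alternating.\<close>

lemma radical_perp_vector:
  fixes V :: "'a :: field vec set"
  assumes V: "subspace_vec (2 * n) V" and v: "v \<in> V" "v \<notin> perp n V V"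
  shows "perp n (perp n V {v}) (perp n V {v}) = {r + c \<cdot>\<^sub>v v | r c. r \<in> perp n V V}"
proof -
  obtain w where w: "w \<in> V" "sp_form n w v = 1" using normalize_pairing[OF assms] by blast
  note Vc = subsetD[OF subspace_vecD(1)[OF V]]
  let ?V' = "perp n V {v}"
  show ?thesis
  proof (intro equalityI subsetI)
    fix u assume u: "u \<in> perp n ?V' ?V'"
    then have uV: "u \<in> V" and u0: "\<And>x. x \<in> V \<Longrightarrow> sp_form n x v = 0 \<Longrightarrow> sp_form n u x = 0"
      unfolding perp_def by auto
    \<comment> \<open>Chosen so that <r, w> = 0, given that <v, w> = -1.\<close>
    define c where "c = - sp_form n u w"
    define r where "r = u - c \<cdot>\<^sub>v v"
    have rV: "r \<in> V" unfolding r_def using uV v V subspace_vec_diff subspace_vecD(4) by blast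
    have "sp_form n r x = 0" if x: "x \<in> V" for x
    proof -
      \<comment> \<open>Removing the component along w moves x into the hyperplane, to which u is
        orthogonal.\<close>
      let ?x = "x - sp_form n x v \<cdot>\<^sub>v w"
      have "?x \<in> V" using x w V subspace_vec_diff subspace_vecD(4) by blast
      moreover have "sp_form n ?x v = 0"
        using Vc x w by (simp add: sp_form_diff_left sp_form_smult_left)
      ultimately have "sp_form n u ?x = 0" using u0 by blast
      then have "sp_form n u x = sp_form n x v * sp_form n u w"
        using Vc x w by (simp add: sp_form_diff_right sp_form_smult_right)
      then show ?thesis
        using Vc x uV v(1) sp_form_swap[of n v x]
        by (simp add: r_def sp_form_diff_left sp_form_smult_left c_def)
    qed
    with rV have "r \<in> perp n V V" by (auto simp: perp_def)
    moreover have "u = r + c \<cdot>\<^sub>v v"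
      unfolding r_def using Vc[OF uV] Vc[OF v(1)] by (intro eq_vecI) auto
    ultimately show "u \<in> {r + c \<cdot>\<^sub>v v | r c. r \<in> perp n V V}" by blast
  next
    fix u assume "u \<in> {r + c \<cdot>\<^sub>v v | r c. r \<in> perp n V V}"
    then obtain r c where u: "u = r + c \<cdot>\<^sub>v v" and r: "r \<in> V" "\<And>s. s \<in> V \<Longrightarrow> sp_form n r s = 0"
      unfolding perp_def by blast
    have "u \<in> V" using u r v subspace_vecD[OF V] by blast
    moreover have "sp_form n u s = c * sp_form n v s" if "s \<in> V" for s
      using that u r v Vc by (simp add: sp_form_add_left sp_form_smult_left)
    ultimately show "u \<in> perp n ?V' ?V'"
      using v(1) sp_form_swap[of n v] by (auto simp: perp_def)
  qed
qed

text \<open>The radical gains the line of v while V loses one dimension. The dimension of V modulo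
  its radical thus drops by 2, which drives the inductions on m below.\<close>

lemma card_radical_perp_vector:
  fixes V :: "'a :: {field, finite} vec set"
  assumes V: "subspace_vec (2 * n) V" and v: "v \<in> V" "v \<notin> perp n V V"
  shows "card (perp n (perp n V {v}) (perp n V {v})) = CARD('a) * card (perp n V V)"
proof -
  note Vc = subsetD[OF subspace_vecD(1)[OF V]]
  note R = subspace_vec_perp[OF V, of V]
  let ?f = "\<lambda>(r, c). r + c \<cdot>\<^sub>v v"
  have "inj_on ?f (perp n V V \<times> UNIV)"
  proof (rule inj_onI, clarify)
    fix r c s d
    assume r: "r \<in> perp n V V" and s: "s \<in> perp n V V" and eq: "r + c \<cdot>\<^sub>v v = s + d \<cdot>\<^sub>v v"
    have cv: "r \<in> carrier_vec (2 * n)" "s \<in> carrier_vec (2 * n)" "v \<in> carrier_vec (2 * n)"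
      using r s v(1) Vc perp_subset[of n V V] by blast+
    have d: "s - r = (c - d) \<cdot>\<^sub>v v"
    proof (rule eq_vecI)
      fix i assume "i < dim_vec ((c - d) \<cdot>\<^sub>v v)"
      then have i: "i < 2 * n" using cv by auto
      have "(r + c \<cdot>\<^sub>v v) $ i = (s + d \<cdot>\<^sub>v v) $ i" using eq by simp
      then show "(s - r) $ i = ((c - d) \<cdot>\<^sub>v v) $ i" using i cv by (simp add: algebra_simps)
    qed (use cv in auto)
    have "c = d"
    proof (rule ccontr)
      assume "c \<noteq> d"
      then have "v = inverse (c - d) \<cdot>\<^sub>v (s - r)"
        unfolding d using cv by (intro eq_vecI) auto
      then show False using v(2) subspace_vecD(4)[OF R] subspace_vec_diff[OF R s r] by metis
    qed
    moreover have "r = s"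
    proof (rule eq_vecI)
      fix i assume "i < dim_vec s"
      moreover have "(r + c \<cdot>\<^sub>v v) $ i = (s + d \<cdot>\<^sub>v v) $ i" using eq by simp
      ultimately show "r $ i = s $ i" using cv \<open>c = d\<close> by simp
    qed (use cv in auto)
    ultimately show "r = s \<and> c = d" by simp
  qed
  moreover have "perp n (perp n V {v}) (perp n V {v}) = ?f ` (perp n V V \<times> UNIV)"
    unfolding radical_perp_vector[OF assms] by force
  ultimately show ?thesis by (simp add: card_image card_cartesian_product)
qed

text \<open>For a subspace V, being its own complement in V already makes L a subspace that is
  isotropic, maximal as such, and contains the radical of V. No dimension is prescribed;
  \<open>card_lagrangian\<close> computes the size.\<close>

definition lagrangians :: "nat \<Rightarrow> 'a :: comm_ring_1 vec set \<Rightarrow> 'a vec set set" where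
  "lagrangians n V = {L. L = perp n V L}"

text \<open>A Lagrangian of the hyperplane contains v automatically, since v is radical there. This
  lets inductions replace V by the hyperplane.\<close>

lemma lagrangians_containing:
  fixes V :: "'a :: field vec set"
  assumes V: "subspace_vec (2 * n) V" and v: "v \<in> V" "v \<notin> perp n V V"
  shows "{L \<in> lagrangians n V. v \<in> L} = lagrangians n (perp n V {v})"
proof -
  let ?V' = "perp n V {v}"
  have "v \<in> perp n ?V' ?V'"
    using v(1) sp_form_swap[of n v] by (auto simp: perp_def)
  then have vL: "v \<in> L" if "L = perp n ?V' L" for L
    using that unfolding perp_def by blast
  show ?thesis
  proof (intro equalityI subsetI)
    fix L assume "L \<in> {L \<in> lagrangians n V. v \<in> L}"
    then have "L = perp n V L" "v \<in> L" by (auto simp: lagrangians_def)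
    then show "L \<in> lagrangians n ?V'" unfolding lagrangians_def perp_def by blast
  next
    fix L assume "L \<in> lagrangians n ?V'"
    then have L: "L = perp n ?V' L" by (simp add: lagrangians_def)
    moreover have "v \<in> L" by (rule vL[OF L])
    ultimately show "L \<in> {L \<in> lagrangians n V. v \<in> L}"
      unfolding lagrangians_def perp_def by blast
  qed
qed

lemma finite_lagrangians:
  fixes V :: "'a :: {field, finite} vec set"
  assumes "subspace_vec (2 * n) V"
  shows "finite (lagrangians n V)"
proof (rule finite_subset)
  show "lagrangians n V \<subseteq> Pow V" unfolding lagrangians_def perp_def by blast
  show "finite (Pow V)" using finite_subspace_vec[OF assms] by simp
qed

lemma radical_subset_lagrangian: "L \<in> lagrangians n V \<Longrightarrow> perp n V V \<subseteq> L"
  unfolding lagrangians_def perp_def by blast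

text \<open>Induction on m: a vector v of L outside the radical cuts V down to its hyperplane, of
  which L is again a Lagrangian. There m drops by 1 and the radical grows by the factor q, so the
  formula is unchanged.\<close>

lemma card_lagrangian:
  fixes V :: "'a :: {field, finite} vec set"
  assumes "subspace_vec (2 * n) V" "card V = CARD('a) ^ (2 * m) * card (perp n V V)"
    "L \<in> lagrangians n V"
  shows "card L = CARD('a) ^ m * card (perp n V V)"
  using assms
proof (induction m arbitrary: V)
  case 0
  have "perp n V V = V"
    using 0 by (intro card_subset_eq finite_subspace_vec perp_subset) auto
  then have "L = V"
    using radical_subset_lagrangian[OF 0(3)] 0(3) unfolding lagrangians_def perp_def by blast
  then show ?case using \<open>perp n V V = V\<close> by simp
next
  case (Suc m)
  note V = Suc.prems(1)
  let ?R = "perp n V V"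
  have "card ?R \<noteq> 0"
    using finite_subspace_vec[OF subspace_vec_perp[OF V]] subspace_vecD(2)[OF subspace_vec_perp[OF V]]
    by auto
  moreover have "2 \<le> CARD('a)"
    using card_mono[of UNIV "{0, 1 :: 'a}"] by simp
  ultimately have "card V \<noteq> card ?R" unfolding Suc.prems(2) by simp
  then have "V \<noteq> ?R" by auto
  moreover have "L = perp n V L" using Suc.prems(3) by (simp add: lagrangians_def)
  \<comment> \<open>If L were the radical, its complement in V would be all of V, and V would equal
    its radical.\<close>
  moreover have "sp_form n v s = 0" if "v \<in> V" "s \<in> ?R" for v s
    using that sp_form_swap[of n v s] by (auto simp: perp_def)
  then have "perp n V ?R = V" by (auto simp: perp_def[of n V "perp n V V"])
  ultimately have "L \<noteq> ?R" by metis
  then obtain v where v: "v \<in> L" "v \<notin> ?R"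
    using radical_subset_lagrangian[OF Suc.prems(3)] by blast
  have vV: "v \<in> V" using v(1) Suc.prems(3) unfolding lagrangians_def perp_def by blast
  note V' = subspace_vec_perp[OF V, of "{v}"]
  have L: "L \<in> lagrangians n (perp n V {v})"
    using lagrangians_containing[OF V vV v(2)] Suc.prems(3) v(1) by blast
  note c = card_perp_vector[OF V vV v(2)] card_radical_perp_vector[OF V vV v(2)]
  have "card (perp n V {v}) = CARD('a) ^ (2 * m) * card (perp n (perp n V {v}) (perp n V {v}))"
    using c Suc.prems(2) by (simp add: mult.left_commute)
  from Suc.IH[OF V' this L] show ?case using c by simp
qed

text \<open>Let R be the radical. A vector outside R lies on as many Lagrangians as there are for m
  - 1, and a Lagrangian has (q^m - 1) |R| vectors outside R. Against the (q^(2m) - 1) |R| vectors of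
  V outside R this gives the new factor q^m + 1.\<close>

lemma card_lagrangians:
  fixes V :: "'a :: {field, finite} vec set"
  assumes "subspace_vec (2 * n) V" "card V = CARD('a) ^ (2 * m) * card (perp n V V)"
  shows "card (lagrangians n V) = (\<Prod>i = 1..m. CARD('a) ^ i + 1)"
  using assms
proof (induction m arbitrary: V)
  case 0
  have R: "perp n V V = V"
    using 0 by (intro card_subset_eq finite_subspace_vec perp_subset) auto
  have "lagrangians n V = {V}"
  proof (intro equalityI subsetI)
    fix L assume "L \<in> lagrangians n V"
    then show "L \<in> {V}"
      using radical_subset_lagrangian[of L n V] R unfolding lagrangians_def perp_def by blast
  qed (use R in \<open>auto simp: lagrangians_def\<close>)
  then show ?case by simp
next
  case (Suc m)
  note V = Suc.prems(1)
  let ?R = "perp n V V" and ?q = "CARD('a)"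
  define N where "N = (\<Prod>i = 1..m. ?q ^ i + 1)"
  have finV: "finite V" and finR: "finite ?R" and finL: "finite (lagrangians n V)"
    using finite_subspace_vec V subspace_vec_perp finite_lagrangians by blast+
  have R0: "card ?R \<noteq> 0"
    using finR subspace_vecD(2)[OF subspace_vec_perp[OF V]] by auto
  have q2: "2 \<le> ?q"
    using card_mono[of UNIV "{0, 1 :: 'a}"] by simp
  have N: "card {L \<in> lagrangians n V. v \<in> L} = N" if v: "v \<in> V - ?R" for v
  proof -
    have v: "v \<in> V" "v \<notin> ?R" using v by auto
    note c = card_perp_vector[OF V v] card_radical_perp_vector[OF V v]
    have "card (perp n V {v}) = ?q ^ (2 * m) * card (perp n (perp n V {v}) (perp n V {v}))"
      using c Suc.prems(2) by (simp add: mult.left_commute)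
    from Suc.IH[OF subspace_vec_perp[OF V] this] show ?thesis
      by (simp add: lagrangians_containing[OF V v] N_def)
  qed
  \<comment> \<open>Count the pairs of a Lagrangian and a vector of it outside the radical in two ways.\<close>
  have "(\<Sum>L\<in>lagrangians n V. card {v \<in> V - ?R. v \<in> L}) =
      (\<Sum>v\<in>V - ?R. card {L \<in> lagrangians n V. v \<in> L})"
    using finV finL by (intro sum_multicount_gen) auto
  also have "\<dots> = card (V - ?R) * N" using N by simp
  also have "card (V - ?R) = (?q ^ (2 * Suc m) - 1) * card ?R"
    using finR perp_subset[of n V V] Suc.prems(2) by (simp add: card_Diff_subset diff_mult_distrib)
  also have "(\<Sum>L\<in>lagrangians n V. card {v \<in> V - ?R. v \<in> L}) =
      (\<Sum>L\<in>lagrangians n V. (?q ^ Suc m - 1) * card ?R)"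
  proof (rule sum.cong[OF refl])
    fix L assume L: "L \<in> lagrangians n V"
    then have "{v \<in> V - ?R. v \<in> L} = L - ?R"
      unfolding lagrangians_def perp_def by blast
    then show "card {v \<in> V - ?R. v \<in> L} = (?q ^ Suc m - 1) * card ?R"
      using card_lagrangian[OF V Suc.prems(2) L] finR radical_subset_lagrangian[OF L]
      by (simp add: card_Diff_subset diff_mult_distrib)
  qed
  finally have eq: "card (lagrangians n V) * (?q ^ Suc m - 1) = (?q ^ (2 * Suc m) - 1) * N"
    using R0 by simp
  have "x * x - 1 = (x + 1) * (x - 1)" for x :: nat
    by (cases x) simp_all
  then have fac: "?q ^ (2 * Suc m) - 1 = (?q ^ Suc m + 1) * (?q ^ Suc m - 1)"
    by (simp only: mult_2 power_add)
  have "1 < ?q ^ Suc m" using q2 by (intro one_less_power) auto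
  then have "?q ^ Suc m - 1 \<noteq> 0" by linarith
  moreover have "card (lagrangians n V) * (?q ^ Suc m - 1) = (?q ^ Suc m + 1) * N * (?q ^ Suc m - 1)"
    unfolding eq fac by (simp only: ac_simps)
  ultimately have "card (lagrangians n V) = (?q ^ Suc m + 1) * N"
    by (simp only: mult_cancel_right disj_not2 simp_thms)
  then show ?case by (simp add: N_def mult.commute)
qed

section \<open>Adapted symplectic bases\<close>

definition symplectic_family ::
    "nat \<Rightarrow> nat \<Rightarrow> (nat \<Rightarrow> 'a :: comm_ring_1 vec) \<Rightarrow> (nat \<Rightarrow> 'a vec) \<Rightarrow> bool" where
  "symplectic_family n k e f \<longleftrightarrow>
     (\<forall>i<k. e i \<in> carrier_vec (2 * n) \<and> f i \<in> carrier_vec (2 * n)) \<and>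
     (\<forall>i<k. \<forall>j<k. sp_form n (e i) (e j) = 0 \<and> sp_form n (f i) (f j) = 0 \<and>
        sp_form n (e i) (f j) = (if i = j then 1 else 0))"

text \<open>Removes the components along the pairs without any division, because <e i, f i> = 1. The
  two sums have opposite signs because <f i, e i> = -1.\<close>

definition sp_proj ::
    "nat \<Rightarrow> nat \<Rightarrow> (nat \<Rightarrow> 'a :: comm_ring_1 vec) \<Rightarrow> (nat \<Rightarrow> 'a vec) \<Rightarrow> 'a vec \<Rightarrow> 'a vec" where
  "sp_proj n k e f w = w - lincomb_vec (2 * n) k (\<lambda>i. sp_form n w (f i)) e
     + lincomb_vec (2 * n) k (\<lambda>i. sp_form n w (e i)) f"

definition sp_orthogonal ::
    "nat \<Rightarrow> nat \<Rightarrow> (nat \<Rightarrow> 'a :: comm_ring_1 vec) \<Rightarrow> (nat \<Rightarrow> 'a vec) \<Rightarrow> 'a vec \<Rightarrow> bool" where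
  "sp_orthogonal n k e f w \<longleftrightarrow> (\<forall>j<k. sp_form n w (e j) = 0 \<and> sp_form n w (f j) = 0)"

lemma sp_proj_carrier [simp]: "w \<in> carrier_vec (2 * n) \<Longrightarrow> sp_proj n k e f w \<in> carrier_vec (2 * n)"
  by (simp add: sp_proj_def)

lemma sp_form_proj:
  assumes "w \<in> carrier_vec (2 * n)"
  shows "sp_form n (sp_proj n k e f w) u = sp_form n w u
     - (\<Sum>i<k. sp_form n w (f i) * sp_form n (e i) u) + (\<Sum>i<k. sp_form n w (e i) * sp_form n (f i) u)"
  using assms unfolding sp_proj_def
  by (simp add: sp_form_add_left sp_form_diff_left sp_form_lincomb_left)

lemma sp_proj_orthogonal:
  assumes "symplectic_family n k e f" "w \<in> carrier_vec (2 * n)"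
  shows "sp_orthogonal n k e f (sp_proj n k e f w)"
  unfolding sp_orthogonal_def
proof (intro allI impI)
  fix j assume j: "j < k"
  have fe: "sp_form n (f i) (e j) = (if i = j then - 1 else 0)" if "i < k" for i
    using assms(1) that j sp_form_swap[of n "f i" "e j"] by (auto simp: symplectic_family_def)
  have "(\<Sum>i<k. sp_form n w (f i) * sp_form n (e i) (f j)) = (\<Sum>i<k. if i = j then sp_form n w (f i) else 0)"
    "(\<Sum>i<k. sp_form n w (e i) * sp_form n (f i) (e j)) = (\<Sum>i<k. if i = j then - sp_form n w (e i) else 0)"
    "(\<Sum>i<k. sp_form n w (e i) * sp_form n (f i) (f j)) = 0"
    "(\<Sum>i<k. sp_form n w (f i) * sp_form n (e i) (e j)) = 0"
    using assms(1) j fe by (auto simp: symplectic_family_def intro!: sum.cong[OF refl] sum.neutral simp del: sum.delta)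
  then show "sp_form n (sp_proj n k e f w) (e j) = 0 \<and> sp_form n (sp_proj n k e f w) (f j) = 0"
    using j assms(2) by (simp add: sp_form_proj)
qed

lemma sp_form_proj_of_orthogonal:
  assumes "w \<in> carrier_vec (2 * n)" "sp_orthogonal n k e f u"
  shows "sp_form n (sp_proj n k e f w) u = sp_form n w u"
proof -
  have "sp_form n (e i) u = 0" "sp_form n (f i) u = 0" if "i < k" for i
    using assms(2) that sp_form_swap[of n _ u] by (simp_all add: sp_orthogonal_def)
  then show ?thesis using assms(1) by (simp add: sp_form_proj)
qed

text \<open>The projection to the span of \<open>k\<close> symplectic pairs has trace \<open>2 k\<close>, so it is not the
  identity for \<open>k < n\<close>.\<close>

lemma sp_proj_unit_nonzero:
  fixes e f :: "nat \<Rightarrow> 'p :: prime_card padic_int vec"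
  assumes fam: "symplectic_family n k e f" and k: "k < n"
  shows "\<exists>l<2 * n. sp_proj n k e f (unit_vec (2 * n) l) \<noteq> 0\<^sub>v (2 * n)"
proof (rule ccontr)
  let ?u = "unit_vec (2 * n) :: nat \<Rightarrow> 'p padic_int vec"
  assume "\<not> ?thesis"
  then have z: "\<And>l. l < 2 * n \<Longrightarrow> sp_proj n k e f (?u l) = 0\<^sub>v (2 * n)" by blast
  have one: "(\<Sum>i<k. e i $ l * sp_form n (?u l) (f i) - f i $ l * sp_form n (?u l) (e i)) = 1"
    if l: "l < 2 * n" for l
  proof -
    have "0 = sp_proj n k e f (?u l) $ l" using z[OF l] l by simp
    also have "\<dots> = 1 - (\<Sum>i<k. sp_form n (?u l) (f i) * e i $ l)
        + (\<Sum>i<k. sp_form n (?u l) (e i) * f i $ l)"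
      using l by (simp add: sp_proj_def lincomb_vec_def)
    finally show ?thesis by (simp add: sum_subtractf mult.commute algebra_simps)
  qed
  \<comment> \<open>If every basis vector were killed, the projection to the span of the pairs would
    have trace 2n along the diagonal, whereas each pair contributes 2 to the trace.\<close>
  have "of_nat (2 * n) = (\<Sum>l<2 * n. 1 :: 'p padic_int)" by simp
  also have "\<dots> = (\<Sum>l<2 * n. \<Sum>i<k. e i $ l * sp_form n (?u l) (f i) - f i $ l * sp_form n (?u l) (e i))"
    using one by simp
  also have "\<dots> = (\<Sum>i<k. \<Sum>l<2 * n. e i $ l * sp_form n (?u l) (f i) - f i $ l * sp_form n (?u l) (e i))"
    by (rule sum.swap)
  also have "\<dots> = (\<Sum>i<k. sp_form n (e i) (f i) - sp_form n (f i) (e i))"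
    using fam by (intro sum.cong refl) (simp add: sum_subtractf sp_form_unit_expand symplectic_family_def)
  also have "\<dots> = (\<Sum>i<k. 2)"
  proof (rule sum.cong[OF refl])
    fix i assume "i \<in> {..<k}"
    then show "sp_form n (e i) (f i) - sp_form n (f i) (e i) = 2"
      using fam sp_form_swap[of n "f i" "e i"] by (simp add: symplectic_family_def)
  qed
  also have "\<dots> = of_nat (2 * k)" by simp
  finally have "n = k" unfolding of_nat_padic_inj by simp
  with k show False by simp
qed

definition primitive_vec :: "nat \<Rightarrow> 'p :: prime_card padic_int vec \<Rightarrow> bool" where
  "primitive_vec N v \<longleftrightarrow> (\<exists>i<N. \<not> \<pi> dvd v $ i)"

lemma pi_power_dvd_imp_le:
  fixes x :: "'p :: prime_card padic_int"
  assumes "\<pi> ^ a dvd \<pi> ^ b * x" "\<not> \<pi> dvd x"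
  shows "a \<le> b"
proof (rule ccontr)
  assume "\<not> a \<le> b"
  then have "a = b + Suc (a - b - 1)" by simp
  then have "\<pi> ^ b * (\<pi> * \<pi> ^ (a - b - 1)) dvd \<pi> ^ b * x"
    using assms(1) by (metis power_add power_Suc)
  then have "\<pi> * \<pi> ^ (a - b - 1) dvd x" by simp
  then show False using assms(2) by (meson dvd_mult_left)
qed

lemma primitive_vec_le:
  assumes "primitive_vec N v" "v \<in> carrier_vec N" "\<And>i. i < N \<Longrightarrow> \<pi> ^ a dvd (\<pi> ^ b \<cdot>\<^sub>v v) $ i"
  shows "a \<le> b"
  using assms pi_power_dvd_imp_le unfolding primitive_vec_def by fastforce

text \<open>The exponent a is the least valuation of an entry of a vector in S; it is finite because
  S contains a nonzero entry, and v is a vector attaining it, divided by p^a.\<close>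

lemma content_exists:
  fixes S :: "'p :: prime_card padic_int vec set"
  assumes S: "S \<subseteq> carrier_vec N" and z: "z \<in> S" "z \<noteq> 0\<^sub>v N"
  shows "\<exists>a v. v \<in> carrier_vec N \<and> \<pi> ^ a \<cdot>\<^sub>v v \<in> S \<and> primitive_vec N v \<and>
    (\<forall>w\<in>S. \<forall>i<N. \<pi> ^ a dvd w $ i)"
proof -
  define P where "P k \<longleftrightarrow> (\<exists>w\<in>S. \<exists>i<N. \<not> \<pi> ^ k dvd w $ i)" for k
  have "\<exists>i<N. z $ i \<noteq> 0"
  proof (rule ccontr)
    assume "\<not> ?thesis"
    then have "z = 0\<^sub>v N" using S z(1) by (intro eq_vecI) auto
    with z(2) show False by simp
  qed
  then obtain k where "P k" unfolding P_def using z(1) not_all_pi_powers_dvd by blast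
  moreover have "\<not> P 0" by (simp add: P_def)
  ultimately obtain a where a: "\<not> P a" "P (Suc a)"
    using ex_least_nat_less[of P k] by auto
  then obtain w i where w: "w \<in> S" "i < N" "\<not> \<pi> ^ Suc a dvd w $ i"
    unfolding P_def by blast
  have all: "\<forall>w\<in>S. \<forall>i<N. \<pi> ^ a dvd w $ i" using a(1) by (simp add: P_def)
  then obtain c where c: "\<And>j. j < N \<Longrightarrow> w $ j = \<pi> ^ a * c j"
    using w(1) unfolding dvd_def by metis
  have "\<pi> ^ a \<cdot>\<^sub>v vec N c = w" using S w(1) by (intro eq_vecI) (auto simp: c)
  moreover have "primitive_vec N (vec N c)"
    unfolding primitive_vec_def using w(2,3) by (auto simp: c power_Suc2 simp del: power_Suc)
  ultimately show ?thesis using w(1) all by (intro exI[of _ a] exI[of _ "vec N c"]) simp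
qed

text \<open>Some coordinate of v is a unit, and the basis vector in the dual position pairs with v
  to plus or minus this unit, the sign depending on the half in which the coordinate lies.\<close>

lemma primitive_vec_dual:
  fixes v :: "'p :: prime_card padic_int vec"
  assumes "primitive_vec (2 * n) v" and v: "v \<in> carrier_vec (2 * n)"
  shows "\<exists>u\<in>carrier_vec (2 * n). sp_form n v u = 1"
proof -
  obtain i where i: "i < 2 * n" "\<not> \<pi> dvd v $ i"
    using assms unfolding primitive_vec_def by blast
  define l where "l = (if i < n then n + i else i - n)"
  have l: "l < 2 * n" using i by (auto simp: l_def)
  obtain y where y: "v $ i * y = 1" using not_pi_dvd_imp_unit[OF i(2)] by (metis dvdE)
  have "sp_form n v (unit_vec (2 * n) l) = v $ i \<or> sp_form n v (unit_vec (2 * n) l) = - v $ i"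
    using sp_form_unit_left[OF v l] sp_form_swap[of n v "unit_vec (2 * n) l"] i(1)
    by (auto simp: l_def)
  then have "sp_form n v (y \<cdot>\<^sub>v unit_vec (2 * n) l) = 1 \<or>
      sp_form n v ((- y) \<cdot>\<^sub>v unit_vec (2 * n) l) = 1"
    using y by (auto simp: sp_form_smult_right mult.commute)
  then show ?thesis by (metis smult_carrier_vec unit_vec_carrier)
qed

lemma dvd_sp_form:
  assumes "v \<in> carrier_vec (2 * n)" "\<And>i. i < 2 * n \<Longrightarrow> d dvd v $ i"
  shows "d dvd sp_form n v w"
  using assms unfolding sp_form_def by (intro dvd_sum dvd_diff) auto

text \<open>For \<open>M = g Z\<^sub>p\<^sup>2\<^sup>n\<close> this amounts to the theorem on symplectic elementary divisors; for the
  preimage of a Lagrangian subspace of \<open>F\<^sub>p\<^sup>2\<^sup>n\<close> it lifts that subspace to a similitude. In the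
  induction step \<open>e\<close> is a vector of least content in the part of \<open>M\<close> orthogonal to the pairs found
  so far, and \<open>f\<close> is any vector of that complement dual to \<open>e\<close>.\<close>

theorem adapted_symplectic_family:
  fixes M :: "'p :: prime_card padic_int vec set"
  assumes M: "M = {v \<in> carrier_vec (2 * n). \<forall>w\<in>M. \<pi> ^ r dvd sp_form n v w}" and "k \<le> n"
  shows "\<exists>e f a. symplectic_family n k e f \<and>
    (\<forall>i<k. \<pi> ^ a i \<cdot>\<^sub>v e i \<in> M \<and> \<pi> ^ (r - a i) \<cdot>\<^sub>v f i \<in> M \<and> 2 * a i \<le> r) \<and>
    (\<forall>i<k. \<forall>w\<in>M. sp_orthogonal n i e f w \<longrightarrow> (\<forall>l<2 * n. \<pi> ^ a i dvd w $ l)) \<and>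
    (\<forall>j<k. \<forall>i\<le>j. a i \<le> a j)"
  using \<open>k \<le> n\<close>
proof (induction k)
  case 0
  show ?case by (simp add: symplectic_family_def)
next
  case (Suc k)
  then obtain e f a where fam: "symplectic_family n k e f"
    and mem: "\<And>i. i < k \<Longrightarrow> \<pi> ^ a i \<cdot>\<^sub>v e i \<in> M \<and> \<pi> ^ (r - a i) \<cdot>\<^sub>v f i \<in> M \<and> 2 * a i \<le> r"
    and con: "\<And>i w l. i < k \<Longrightarrow> w \<in> M \<Longrightarrow> sp_orthogonal n i e f w \<Longrightarrow> l < 2 * n \<Longrightarrow> \<pi> ^ a i dvd w $ l"
    and mono: "\<And>i j. j < k \<Longrightarrow> i \<le> j \<Longrightarrow> a i \<le> a j"
    by (metis Suc_leD)
  have k: "k < n" using Suc.prems by simp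
  note ef = fam[unfolded symplectic_family_def]
  have Mc: "v \<in> carrier_vec (2 * n)" if "v \<in> M" for v using that M by blast
  have Md: "\<pi> ^ r dvd sp_form n v w" if "v \<in> M" "w \<in> M" for v w using that M by blast
  have Mi: "v \<in> M" if "v \<in> carrier_vec (2 * n)" "\<And>w. w \<in> M \<Longrightarrow> \<pi> ^ r dvd sp_form n v w" for v
    using that by (subst M) blast
  have split: "\<pi> ^ r = (\<pi> ^ (r - b) * \<pi> ^ b :: 'p padic_int)" if "b \<le> r" for b
    using that by (simp flip: power_add)
  have cancel: "\<pi> ^ b dvd x" if "\<pi> ^ r dvd \<pi> ^ (r - b) * x" "b \<le> r" for b and x :: "'p padic_int"
    using that unfolding split[OF that(2)] by simp
  \<comment> \<open>Self-duality of M against its members p^(a i) e i and p^(r - a i) f i, with the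
    powers of p in front cancelled.\<close>
  have pairing: "\<pi> ^ a i dvd sp_form n w (f i)" "\<pi> ^ (r - a i) dvd sp_form n w (e i)"
    if "i < k" "w \<in> M" for i w
  proof -
    have "a i \<le> r" "r - (r - a i) = a i" using mem[OF that(1)] by auto
    then show "\<pi> ^ a i dvd sp_form n w (f i)" "\<pi> ^ (r - a i) dvd sp_form n w (e i)"
      using cancel[of "a i" "sp_form n w (f i)"] cancel[of "r - a i" "sp_form n w (e i)"]
        Md[OF that(2), of "\<pi> ^ a i \<cdot>\<^sub>v e i"] Md[OF that(2), of "\<pi> ^ (r - a i) \<cdot>\<^sub>v f i"]
        mem[OF that(1)] ef that(1) by (simp_all add: sp_form_smult_right)
  qed
  \<comment> \<open>In each correction term of the projection the two pairings are divisible by p^(a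
    i) and p^(r - a i), so their product is divisible by p^r.\<close>
  have proj_M: "sp_proj n k e f w \<in> M" if w: "w \<in> M" for w
  proof (rule Mi)
    fix x assume x: "x \<in> M"
    have "\<pi> ^ r dvd sp_form n w (f i) * sp_form n (e i) x"
      "\<pi> ^ r dvd sp_form n w (e i) * sp_form n (f i) x" if i: "i < k" for i
    proof -
      have "a i \<le> r" using mem[OF i] by simp
      then show "\<pi> ^ r dvd sp_form n w (f i) * sp_form n (e i) x"
        "\<pi> ^ r dvd sp_form n w (e i) * sp_form n (f i) x"
        using pairing[OF i w] pairing[OF i x] sp_form_swap[of n _ x]
          mult_dvd_mono[of "\<pi> ^ a i" "sp_form n w (f i)" "\<pi> ^ (r - a i)" "sp_form n (e i) x"]
          mult_dvd_mono[of "\<pi> ^ (r - a i)" "sp_form n w (e i)" "\<pi> ^ a i" "sp_form n (f i) x"]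
        by (simp_all flip: power_add)
    qed
    then show "\<pi> ^ r dvd sp_form n (sp_proj n k e f w) x"
      using Md[OF w x] Mc[OF w] by (auto simp: sp_form_proj intro!: dvd_add dvd_diff dvd_sum)
  qed (use w Mc in simp)
  define S where "S = {w \<in> M. sp_orthogonal n k e f w}"
  have orth_smult: "sp_orthogonal n k e f v"
    if "sp_orthogonal n k e f (\<pi> ^ b \<cdot>\<^sub>v v)" "v \<in> carrier_vec (2 * n)" for v b
    using that by (simp add: sp_orthogonal_def sp_form_smult_left)
  obtain z where z: "z \<in> carrier_vec (2 * n)" "z \<noteq> 0\<^sub>v (2 * n)" "sp_orthogonal n k e f z"
    using sp_proj_unit_nonzero[OF fam k] sp_proj_orthogonal[OF fam] by (metis sp_proj_carrier unit_vec_carrier)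
  obtain b z' where z': "z' \<in> carrier_vec (2 * n)" "\<pi> ^ b \<cdot>\<^sub>v z' = z" "primitive_vec (2 * n) z'"
    using content_exists[of "{z}" "2 * n" z] z by auto
  \<comment> \<open>By self-duality M contains p^r times every integral vector. Hence S is not zero,
    and its content b is at most r.\<close>
  have z'S: "\<pi> ^ r \<cdot>\<^sub>v z' \<in> S"
    using orth_smult[of b z'] z z' unfolding S_def
    by (auto intro!: Mi simp: sp_form_smult_left sp_orthogonal_def)
  have "\<pi> ^ r \<cdot>\<^sub>v z' \<noteq> 0\<^sub>v (2 * n)"
  proof
    assume "\<pi> ^ r \<cdot>\<^sub>v z' = 0\<^sub>v (2 * n)"
    then have "Suc r \<le> r" using z' by (intro primitive_vec_le[of "2 * n" z']) auto
    then show False by simp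
  qed
  then obtain b e' where e': "e' \<in> carrier_vec (2 * n)" "\<pi> ^ b \<cdot>\<^sub>v e' \<in> S" "primitive_vec (2 * n) e'"
    and b: "\<And>w i. w \<in> S \<Longrightarrow> i < 2 * n \<Longrightarrow> \<pi> ^ b dvd w $ i"
    using content_exists[of S "2 * n" "\<pi> ^ r \<cdot>\<^sub>v z'"] z'S Mc unfolding S_def by blast
  have br: "b \<le> r" using primitive_vec_le[OF z'(3,1) b[OF z'S]] .
  have e'o: "sp_orthogonal n k e f e'" using orth_smult[of b e'] e' by (simp add: S_def)
  obtain u where u: "u \<in> carrier_vec (2 * n)" "sp_form n e' u = 1"
    using primitive_vec_dual[OF e'(3,1)] by blast
  \<comment> \<open>Projecting u does not change its pairing with e', since e' is orthogonal to the
    earlier pairs.\<close>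
  define f' where "f' = sp_proj n k e f u"
  have f'c: "f' \<in> carrier_vec (2 * n)" using u by (simp add: f'_def)
  have f'o: "sp_orthogonal n k e f f'"
    unfolding f'_def using fam u(1) by (rule sp_proj_orthogonal)
  have e'f': "sp_form n e' f' = 1"
    using sp_form_proj_of_orthogonal[OF u(1) e'o] u(2) sp_form_swap[of n e'] by (simp add: f'_def)
  \<comment> \<open>The vector f' pairs with w as it does with the projection of w, which lies in S
    and is divisible by p^b.\<close>
  have f'M: "\<pi> ^ (r - b) \<cdot>\<^sub>v f' \<in> M"
  proof (rule Mi)
    fix w assume w: "w \<in> M"
    then have "sp_proj n k e f w \<in> S"
      unfolding S_def using proj_M sp_proj_orthogonal[OF fam Mc] by blast
    then have "\<pi> ^ b dvd sp_form n (sp_proj n k e f w) f'"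
      using b Mc unfolding S_def by (intro dvd_sp_form) auto
    then have "\<pi> ^ b dvd sp_form n f' w"
      using sp_form_proj_of_orthogonal[OF Mc[OF w] f'o] sp_form_swap[of n f' w] by simp
    then show "\<pi> ^ r dvd sp_form n (\<pi> ^ (r - b) \<cdot>\<^sub>v f') w"
      unfolding split[OF br] using f'c by (simp add: sp_form_smult_left)
  qed (use f'c in simp)
  then have f'S: "\<pi> ^ (r - b) \<cdot>\<^sub>v f' \<in> S"
    using f'o f'c by (auto simp: S_def sp_orthogonal_def sp_form_smult_left)
  have "primitive_vec (2 * n) f'"
  proof (rule ccontr)
    assume "\<not> ?thesis"
    then have "\<pi> dvd sp_form n f' e'"
      using f'c unfolding primitive_vec_def by (intro dvd_sp_form) auto
    then show False using e'f' sp_form_swap[of n f' e'] pi_not_dvd_one[where 'p = 'p] by simp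
  qed
  \<comment> \<open>The multiple p^(r - b) f' of the primitive vector f' lies in S, where p^b
    divides everything; hence b \<le> r - b.\<close>
  from primitive_vec_le[OF this f'c b[OF f'S]] have b2: "2 * b \<le> r" using br by simp
  \<comment> \<open>The vector p^b e' is also orthogonal to the first i pairs, so the divisibility
    by p^(a i) recorded in \<open>con\<close> applies to it.\<close>
  have mono_b: "a i \<le> b" if i: "i < k" for i
  proof (rule primitive_vec_le[OF e'(3,1)])
    fix l assume "l < 2 * n"
    moreover have "sp_orthogonal n i e f (\<pi> ^ b \<cdot>\<^sub>v e')"
      using e'(2) i by (auto simp: S_def sp_orthogonal_def)
    ultimately show "\<pi> ^ a i dvd (\<pi> ^ b \<cdot>\<^sub>v e') $ l" using con[OF i] e'(2) by (simp add: S_def)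
  qed
  let ?e = "e(k := e')" and ?f = "f(k := f')" and ?a = "a(k := b)"
  have fam': "symplectic_family n (Suc k) ?e ?f"
    unfolding symplectic_family_def
  proof (intro conjI allI impI)
    fix i j assume "i < Suc k" "j < Suc k"
    moreover have "sp_form n (e i) e' = 0" "sp_form n (f i) e' = 0" "sp_form n (e i) f' = 0"
      "sp_form n (f i) f' = 0" if "i < k" for i
      using that e'o f'o sp_form_swap[of n _ e'] sp_form_swap[of n _ f']
      by (simp_all add: sp_orthogonal_def)
    ultimately show "sp_form n (?e i) (?e j) = 0" "sp_form n (?f i) (?f j) = 0"
      "sp_form n (?e i) (?f j) = (if i = j then 1 else 0)"
      using ef e'o f'o e'f' by (auto simp: sp_orthogonal_def less_Suc_eq)
  qed (use ef e'(1) f'c in \<open>auto simp: less_Suc_eq\<close>)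
  have orth: "sp_orthogonal n i ?e ?f = sp_orthogonal n i e f" if "i \<le> k" for i
    using that by (auto simp: sp_orthogonal_def fun_eq_iff)
  show ?case
  proof (rule exI[of _ ?e], rule exI[of _ ?f], rule exI[of _ ?a], intro conjI)
    show "symplectic_family n (Suc k) ?e ?f" by (rule fam')
    show "\<forall>i<Suc k. \<pi> ^ ?a i \<cdot>\<^sub>v ?e i \<in> M \<and> \<pi> ^ (r - ?a i) \<cdot>\<^sub>v ?f i \<in> M \<and> 2 * ?a i \<le> r"
      using mem e'(2) f'M b2 by (auto simp: less_Suc_eq S_def)
    show "\<forall>i<Suc k. \<forall>w\<in>M. sp_orthogonal n i ?e ?f w \<longrightarrow> (\<forall>l<2 * n. \<pi> ^ ?a i dvd w $ l)"
    proof (intro allI ballI impI)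
      fix i w l
      assume "i < Suc k" "w \<in> M" "sp_orthogonal n i ?e ?f w" "l < 2 * n"
      then show "\<pi> ^ ?a i dvd w $ l"
        using con[of i w l] b[of w l] orth[of i] by (cases "i = k") (auto simp: S_def)
    qed
    show "\<forall>j<Suc k. \<forall>i\<le>j. ?a i \<le> ?a j"
      using mono mono_b by (auto simp: less_Suc_eq le_less)
  qed
qed

section \<open>Integral similitudes and their lattices\<close>

lemma mult_mat_vec_unit:
  fixes A :: "'a :: comm_ring_1 mat"
  assumes "A \<in> carrier_mat a b" "j < b"
  shows "A *\<^sub>v unit_vec b j = col A j"
proof (rule eq_vecI)
  fix i assume "i < dim_vec (col A j)"
  then have i: "i < dim_row A" by simp
  have "(A *\<^sub>v unit_vec b j) $ i = row A i \<bullet> unit_vec b j" by (rule index_mult_mat_vec[OF i])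
  also have "\<dots> = row A i $ j" by (rule scalar_prod_right_unit[OF assms(2)])
  finally show "(A *\<^sub>v unit_vec b j) $ i = col A j $ i" using assms i by simp
qed (use assms in auto)

lemma smult_smult_mat: "c \<cdot>\<^sub>m (d \<cdot>\<^sub>m A) = (c * d :: 'a :: comm_ring_1) \<cdot>\<^sub>m A"
  by (intro eq_matI) (auto simp: mult.assoc)

lemma one_smult_mat: "(1 :: 'a :: comm_ring_1) \<cdot>\<^sub>m A = A"
  by (intro eq_matI) auto

lemma uminus_mult_vec:
  assumes "A \<in> carrier_mat a b" "v \<in> carrier_vec b"
  shows "(- A) *\<^sub>v v = - (A *\<^sub>v v :: 'a :: comm_ring_1 vec)"
  using assms by (intro eq_vecI) auto

lemma smult_uminus_vec: "c \<cdot>\<^sub>v (- v) = - (c \<cdot>\<^sub>v v :: 'a :: comm_ring_1 vec)"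
  by (intro eq_vecI) auto

lemma smult_one_mult_vec:
  assumes "v \<in> carrier_vec N"
  shows "(c \<cdot>\<^sub>m 1\<^sub>m N) *\<^sub>v v = (c \<cdot>\<^sub>v v :: 'a :: comm_ring_1 vec)"
  using assms by (intro eq_vecI) (auto simp: smult_scalar_prod_distrib[of _ N])

lemma mult_mat_vec_smult:
  fixes A :: "'a :: comm_ring_1 mat"
  assumes "A \<in> carrier_mat a b" "v \<in> carrier_vec b"
  shows "A *\<^sub>v (c \<cdot>\<^sub>v v) = c \<cdot>\<^sub>v (A *\<^sub>v v)"
  using assms by (intro eq_vecI) (auto simp: scalar_prod_smult_distrib[of _ b])

lemma sim_form_iff:
  fixes A :: "'a :: comm_ring_1 mat"
  assumes "A \<in> carrier_mat (2 * n) (2 * n)"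
  shows "A\<^sup>T * J_mat n * A = c \<cdot>\<^sub>m J_mat n \<longleftrightarrow>
    (\<forall>i<2 * n. \<forall>j<2 * n. sp_form n (col A i) (col A j) = c * J_mat n $$ (i, j))"
proof
  assume "A\<^sup>T * J_mat n * A = c \<cdot>\<^sub>m J_mat n"
  then show "\<forall>i<2 * n. \<forall>j<2 * n. sp_form n (col A i) (col A j) = c * J_mat n $$ (i, j)"
    using transpose_J_mult_index[OF assms assms] by simp
next
  assume *: "\<forall>i<2 * n. \<forall>j<2 * n. sp_form n (col A i) (col A j) = c * J_mat n $$ (i, j)"
  show "A\<^sup>T * J_mat n * A = c \<cdot>\<^sub>m J_mat n"
  proof (rule eq_matI)
    fix i j assume "i < dim_row (c \<cdot>\<^sub>m J_mat n)" "j < dim_col (c \<cdot>\<^sub>m J_mat n)"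
    then have "i < 2 * n" "j < 2 * n" by simp_all
    then show "(A\<^sup>T * J_mat n * A) $$ (i, j) = (c \<cdot>\<^sub>m J_mat n) $$ (i, j)"
      using * transpose_J_mult_index[OF assms assms, of i j] by simp
  qed (use assms in auto)
qed

lemma sp_form_mult:
  fixes A :: "'a :: comm_ring_1 mat"
  assumes A: "A \<in> carrier_mat (2 * n) (2 * n)" "A\<^sup>T * J_mat n * A = c \<cdot>\<^sub>m J_mat n"
    and v: "v \<in> carrier_vec (2 * n)" and w: "w \<in> carrier_vec (2 * n)"
  shows "sp_form n (A *\<^sub>v v) (A *\<^sub>v w) = c * sp_form n v w"
proof -
  note [simp] = J_mat_carrier[of n, where 'a = 'a]
  have Aw: "A *\<^sub>v w \<in> carrier_vec (2 * n)" and Av: "A *\<^sub>v v \<in> carrier_vec (2 * n)"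
    using A v w by (auto intro: mult_mat_vec_carrier)
  then have JAw: "J_mat n *\<^sub>v (A *\<^sub>v w) \<in> carrier_vec (2 * n)"
    by (auto intro: mult_mat_vec_carrier[OF J_mat_carrier])
  have "sp_form n (A *\<^sub>v v) (A *\<^sub>v w) = (A *\<^sub>v v) \<bullet> (J_mat n *\<^sub>v (A *\<^sub>v w))"
    using scalar_prod_J[OF Av Aw] by simp
  also have "\<dots> = (J_mat n *\<^sub>v (A *\<^sub>v w)) \<bullet> (A *\<^sub>v v)"
    using Av JAw by (rule comm_scalar_prod)
  also have "\<dots> = (A\<^sup>T *\<^sub>v (J_mat n *\<^sub>v (A *\<^sub>v w))) \<bullet> v"
    using transpose_vec_mult_scalar[OF A(1) v JAw] by simp
  also have "A\<^sup>T *\<^sub>v (J_mat n *\<^sub>v (A *\<^sub>v w)) = (A\<^sup>T * J_mat n * A) *\<^sub>v w"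
  proof -
    have "A\<^sup>T * J_mat n \<in> carrier_mat (2 * n) (2 * n)" "A\<^sup>T \<in> carrier_mat (2 * n) (2 * n)"
      using A(1) by (auto intro: mult_carrier_mat)
    then show ?thesis
      using A(1) w Aw assoc_mult_mat_vec[of "A\<^sup>T * J_mat n" "2 * n" "2 * n" A "2 * n" w]
        assoc_mult_mat_vec[of "A\<^sup>T" "2 * n" "2 * n" "J_mat n" "2 * n" "A *\<^sub>v w"] by simp
  qed
  also have "\<dots> = c \<cdot>\<^sub>v (J_mat n *\<^sub>v w)"
    unfolding A(2) using w by (intro eq_vecI) (auto simp: smult_scalar_prod_distrib[of _ "2 * n"])
  also have "(c \<cdot>\<^sub>v (J_mat n *\<^sub>v w)) \<bullet> v = c * ((J_mat n *\<^sub>v w) \<bullet> v)"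
    using v mult_mat_vec_carrier[OF J_mat_carrier w] by (intro smult_scalar_prod_distrib) auto
  also have "(J_mat n *\<^sub>v w) \<bullet> v = sp_form n v w"
    using v w comm_scalar_prod[OF mult_mat_vec_carrier[OF J_mat_carrier w] v] scalar_prod_J[OF v w]
    by simp
  finally show ?thesis .
qed

text \<open>The adjoint for the symplectic form. For a similitude of nonzero factor c it is c times
  the inverse, obtained without leaving the ring of the entries.\<close>

definition sp_adjoint :: "nat \<Rightarrow> 'a :: comm_ring_1 mat \<Rightarrow> 'a mat" where
  "sp_adjoint n A = - (J_mat n * (A\<^sup>T * J_mat n))"

lemma sp_adjoint_carrier [simp]:
  assumes "A \<in> carrier_mat (2 * n) (2 * n)"
  shows "sp_adjoint n A \<in> carrier_mat (2 * n) (2 * n)"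
  using assms unfolding sp_adjoint_def by auto

lemma sp_adjoint_mult:
  fixes A :: "'a :: comm_ring_1 mat"
  assumes A: "A \<in> carrier_mat (2 * n) (2 * n)" "A\<^sup>T * J_mat n * A = c \<cdot>\<^sub>m J_mat n"
  shows "sp_adjoint n A * A = c \<cdot>\<^sub>m 1\<^sub>m (2 * n)"
proof -
  have AJ: "A\<^sup>T * J_mat n \<in> carrier_mat (2 * n) (2 * n)" using A(1) by auto
  have "sp_adjoint n A * A = - (J_mat n * (A\<^sup>T * J_mat n) * A)"
    unfolding sp_adjoint_def using A(1) AJ
    by (intro uminus_mult_left_mat) auto
  also have "J_mat n * (A\<^sup>T * J_mat n) * A = J_mat n * (c \<cdot>\<^sub>m J_mat n)"
    using assoc_mult_mat[OF J_mat_carrier AJ A(1)] A(2) by simp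
  also have "\<dots> = c \<cdot>\<^sub>m (J_mat n * J_mat n)"
    by (rule mult_smult_distrib[OF J_mat_carrier J_mat_carrier])
  also have "- (c \<cdot>\<^sub>m (J_mat n * J_mat n)) = c \<cdot>\<^sub>m 1\<^sub>m (2 * n)"
    unfolding J_mat_sqr by (intro eq_matI) auto
  finally show ?thesis .
qed

lemma sim_form_prod:
  fixes A :: "'a :: comm_ring_1 mat"
  assumes A: "A \<in> carrier_mat (2 * n) (2 * n)" "A\<^sup>T * J_mat n * A = c \<cdot>\<^sub>m J_mat n"
    and B: "B \<in> carrier_mat (2 * n) (2 * n)"
  shows "(A * B)\<^sup>T * J_mat n * (A * B) = c \<cdot>\<^sub>m (B\<^sup>T * J_mat n * B)"
proof (rule eq_matI)
  fix i j assume "i < dim_row (c \<cdot>\<^sub>m (B\<^sup>T * J_mat n * B))" "j < dim_col (c \<cdot>\<^sub>m (B\<^sup>T * J_mat n * B))"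
  then have ij: "i < 2 * n" "j < 2 * n" using B by simp_all
  have AB: "A * B \<in> carrier_mat (2 * n) (2 * n)" using A B by auto
  have cB: "col B i \<in> carrier_vec (2 * n)" "col B j \<in> carrier_vec (2 * n)"
    using B by (auto intro: carrier_vecI)
  show "((A * B)\<^sup>T * J_mat n * (A * B)) $$ (i, j) = (c \<cdot>\<^sub>m (B\<^sup>T * J_mat n * B)) $$ (i, j)"
    using ij A B AB cB transpose_J_mult_index[OF AB AB ij] transpose_J_mult_index[OF B B ij]
      sp_form_mult[OF A, of "col B i" "col B j"]
    by (simp add: col_mult2[OF A(1) B])
qed (use A B in auto)

text \<open>Over the fraction field a one-sided inverse is two-sided, and the resulting identity
  descends because the embedding is injective.\<close>

lemma mult_inverse_mat_commute:
  fixes A :: "'a :: idom mat"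
  assumes A: "A \<in> carrier_mat N N" and B: "B \<in> carrier_mat N N" and BA: "B * A = c \<cdot>\<^sub>m 1\<^sub>m N"
    and c: "c \<noteq> 0"
  shows "A * B = c \<cdot>\<^sub>m 1\<^sub>m N"
proof -
  interpret h: inj_comm_ring_hom "to_fract :: 'a \<Rightarrow> 'a fract"
    by unfold_locales simp_all
  let ?d = "inverse (to_fract c)"
  have hA: "map_mat to_fract A \<in> carrier_mat N N" and hB: "map_mat to_fract B \<in> carrier_mat N N"
    using A B by auto
  have one: "map_mat to_fract (c \<cdot>\<^sub>m 1\<^sub>m N) = to_fract c \<cdot>\<^sub>m 1\<^sub>m N"
    by (intro eq_matI) auto
  have "(?d \<cdot>\<^sub>m map_mat to_fract B) * map_mat to_fract A = ?d \<cdot>\<^sub>m (map_mat to_fract B * map_mat to_fract A)"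
    using hA hB by (rule mult_smult_assoc_mat[rotated])
  also have "map_mat to_fract B * map_mat to_fract A = to_fract c \<cdot>\<^sub>m 1\<^sub>m N"
    using h.mat_hom_mult[OF B A] BA one by simp
  also have "?d \<cdot>\<^sub>m (to_fract c \<cdot>\<^sub>m 1\<^sub>m N) = 1\<^sub>m N"
    using c by (intro eq_matI) auto
  finally have "map_mat to_fract A * (?d \<cdot>\<^sub>m map_mat to_fract B) = 1\<^sub>m N"
    using hA hB by (rule_tac mat_mult_left_right_inverse) auto
  then have "?d \<cdot>\<^sub>m (map_mat to_fract A * map_mat to_fract B) = 1\<^sub>m N"
    using mult_smult_distrib[OF hA hB, of ?d] by simp
  then have "to_fract c \<cdot>\<^sub>m (?d \<cdot>\<^sub>m (map_mat to_fract A * map_mat to_fract B)) = to_fract c \<cdot>\<^sub>m 1\<^sub>m N"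
    by simp
  then have "map_mat to_fract A * map_mat to_fract B = to_fract c \<cdot>\<^sub>m 1\<^sub>m N"
    using c by (simp add: smult_smult_mat one_smult_mat)
  then have "map_mat to_fract (A * B) = map_mat to_fract (c \<cdot>\<^sub>m 1\<^sub>m N)"
    by (simp only: h.mat_hom_mult[OF A B] one)
  then show ?thesis by (rule h.mat_hom_inj)
qed

text \<open>The set \<open>O_set n r\<close> with entries in Z_p itself rather than in its image in
  Q_p, see \<open>O_set_eq\<close>; r = 0 gives K. Lattices and reductions modulo p are studied on
  this side.\<close>

definition integral_sims :: "nat \<Rightarrow> nat \<Rightarrow> 'p :: prime_card padic_int mat set" where
  "integral_sims n r = {A \<in> carrier_mat (2 * n) (2 * n). A\<^sup>T * J_mat n * A = (\<pi> ^ r) \<cdot>\<^sub>m J_mat n}"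

lemma integral_simsD:
  assumes "A \<in> integral_sims n r"
  shows "A \<in> carrier_mat (2 * n) (2 * n)" "A\<^sup>T * J_mat n * A = (\<pi> ^ r) \<cdot>\<^sub>m J_mat n"
  using assms by (simp_all add: integral_sims_def)

lemma integral_sims_mult:
  assumes A: "A \<in> integral_sims n a" and B: "B \<in> integral_sims n b"
  shows "A * B \<in> integral_sims n (a + b)"
  using sim_form_prod[OF integral_simsD[OF A] integral_simsD(1)[OF B]]
    integral_simsD[OF A] integral_simsD[OF B]
  by (simp add: integral_sims_def smult_smult_mat power_add)

text \<open>Similitude factors multiply and p^a can be cancelled in a domain. Throughout, this
  supplies the factor of a quotient once the quotient is known to be integral.\<close>

lemma integral_sims_cancel:
  fixes A :: "'p :: prime_card padic_int mat"
  assumes A: "A \<in> integral_sims n a" and B: "B \<in> carrier_mat (2 * n) (2 * n)"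
    and AB: "A * B \<in> integral_sims n (a + b)"
  shows "B \<in> integral_sims n b"
proof -
  have eq: "\<pi> ^ a \<cdot>\<^sub>m (B\<^sup>T * J_mat n * B) = \<pi> ^ (a + b) \<cdot>\<^sub>m J_mat n"
    by (rule trans[OF sim_form_prod[OF integral_simsD[OF A] B, symmetric] integral_simsD(2)[OF AB]])
  have "B\<^sup>T * J_mat n * B = \<pi> ^ b \<cdot>\<^sub>m J_mat n"
  proof (rule eq_matI)
    fix i j assume "i < dim_row (\<pi> ^ b \<cdot>\<^sub>m J_mat n :: 'p padic_int mat)" "j < dim_col (\<pi> ^ b \<cdot>\<^sub>m J_mat n :: 'p padic_int mat)"
    then have ij: "i < 2 * n" "j < 2 * n" by simp_all
    have "(\<pi> ^ a \<cdot>\<^sub>m (B\<^sup>T * J_mat n * B)) $$ (i, j) = (\<pi> ^ (a + b) \<cdot>\<^sub>m J_mat n) $$ (i, j)"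
      using eq by simp
    moreover have "(\<pi> ^ a \<cdot>\<^sub>m (B\<^sup>T * J_mat n * B)) $$ (i, j) = \<pi> ^ a * (B\<^sup>T * J_mat n * B) $$ (i, j)"
      using ij B by (intro index_smult_mat(1)) auto
    ultimately have "\<pi> ^ a * (B\<^sup>T * J_mat n * B) $$ (i, j) = \<pi> ^ a * (\<pi> ^ b * J_mat n $$ (i, j))"
      using ij by (simp add: power_add mult.assoc)
    then have "(B\<^sup>T * J_mat n * B) $$ (i, j) = \<pi> ^ b * J_mat n $$ (i, j)"
      by (metis mult_left_cancel power_not_zero pi_nonzero)
    then show "(B\<^sup>T * J_mat n * B) $$ (i, j) = (\<pi> ^ b \<cdot>\<^sub>m J_mat n) $$ (i, j)"
      using ij by (simp del: index_mult_mat)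
  qed (use B in auto)
  then show ?thesis using B by (simp add: integral_sims_def)
qed

lemma integral_sims_one: "1\<^sub>m (2 * n) \<in> integral_sims n 0"
  by (simp add: integral_sims_def left_mult_one_mat[OF J_mat_carrier] right_mult_one_mat[OF J_mat_carrier]
      one_smult_mat)

lemma integral_sims_inverse:
  fixes A :: "'p :: prime_card padic_int mat"
  assumes A: "A \<in> integral_sims n 0"
  shows "\<exists>B\<in>integral_sims n 0. A * B = 1\<^sub>m (2 * n) \<and> B * A = 1\<^sub>m (2 * n)"
proof -
  let ?B = "sp_adjoint n A"
  have BA: "?B * A = 1 \<cdot>\<^sub>m 1\<^sub>m (2 * n)"
    using sp_adjoint_mult[OF integral_simsD[OF A]] by simp
  have AB: "A * ?B = 1 \<cdot>\<^sub>m 1\<^sub>m (2 * n)"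
    using mult_inverse_mat_commute[OF _ _ BA] integral_simsD(1)[OF A] by simp
  note eqs = AB[unfolded one_smult_mat] BA[unfolded one_smult_mat]
  moreover have "?B \<in> integral_sims n 0"
    using integral_sims_cancel[OF A, of ?B 0] eqs integral_sims_one[of n, where 'a = 'p]
      integral_simsD(1)[OF A] by simp
  ultimately show ?thesis by blast
qed

definition col_lattice :: "'a :: comm_ring_1 mat \<Rightarrow> 'a vec set" where
  "col_lattice A = (\<lambda>v. A *\<^sub>v v) ` carrier_vec (dim_col A)"

lemma lattice_eq: "A \<in> carrier_mat a b \<Longrightarrow> col_lattice A = (\<lambda>v. A *\<^sub>v v) ` carrier_vec b"
  by (simp add: col_lattice_def)

lemma lattice_subset: "col_lattice A \<subseteq> carrier_vec (dim_row A)"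
  by (auto simp: col_lattice_def intro!: mult_mat_vec_carrier)

lemma col_in_col_lattice:
  assumes "A \<in> carrier_mat a b" "j < b"
  shows "col A j \<in> col_lattice A"
  unfolding col_lattice_def using assms mult_mat_vec_unit[OF assms] by (auto intro!: image_eqI[of _ _ "unit_vec b j"])

lemma lattice_mult_subset:
  assumes "A \<in> carrier_mat a b" "B \<in> carrier_mat b c"
  shows "col_lattice (A * B) \<subseteq> col_lattice A"
  unfolding col_lattice_def using assms by (auto simp: assoc_mult_mat_vec[OF assms] intro!: imageI)

lemma sp_adjoint_mult_vec:
  fixes A :: "'a :: comm_ring_1 mat"
  assumes A: "A \<in> carrier_mat (2 * n) (2 * n)" and v: "v \<in> carrier_vec (2 * n)"
  shows "sp_adjoint n A *\<^sub>v v = - (J_mat n *\<^sub>v (A\<^sup>T *\<^sub>v (J_mat n *\<^sub>v v)))"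
proof -
  have AT: "A\<^sup>T \<in> carrier_mat (2 * n) (2 * n)" using A by simp
  show ?thesis
    unfolding sp_adjoint_def
    by (simp only: uminus_mult_vec[OF mult_carrier_mat[OF J_mat_carrier mult_carrier_mat[OF AT J_mat_carrier]] v]
        assoc_mult_mat_vec[OF J_mat_carrier mult_carrier_mat[OF AT J_mat_carrier] v]
        assoc_mult_mat_vec[OF AT J_mat_carrier v])
qed

text \<open>Write A* for \<open>sp_adjoint n A\<close>, so that A A* = p^r. The entries of
  \<open>A\<^sup>T\<close> J v are the pairings of the columns of A with v; if p^r divides them,
  then A* v = p^r w for an integral w, and v = A w.\<close>

lemma lattice_self_dual:
  fixes A :: "'p :: prime_card padic_int mat"
  assumes A: "A \<in> integral_sims n r"
  shows "col_lattice A = {v \<in> carrier_vec (2 * n). \<forall>w\<in>col_lattice A. \<pi> ^ r dvd sp_form n v w}"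
proof (intro equalityI subsetI)
  fix v assume "v \<in> col_lattice A"
  then obtain x where x: "x \<in> carrier_vec (2 * n)" "v = A *\<^sub>v x"
    unfolding lattice_eq[OF integral_simsD(1)[OF A]] by blast
  have "\<pi> ^ r dvd sp_form n v w" if "w \<in> col_lattice A" for w
  proof -
    obtain y where y: "y \<in> carrier_vec (2 * n)" "w = A *\<^sub>v y"
      using \<open>w \<in> col_lattice A\<close> unfolding lattice_eq[OF integral_simsD(1)[OF A]] by blast
    show ?thesis unfolding x y sp_form_mult[OF integral_simsD[OF A] x(1) y(1)] by simp
  qed
  moreover have "v \<in> carrier_vec (2 * n)"
    using \<open>v \<in> col_lattice A\<close> lattice_subset[of A] integral_simsD(1)[OF A] by auto
  ultimately show "v \<in> {v \<in> carrier_vec (2 * n). \<forall>w\<in>col_lattice A. \<pi> ^ r dvd sp_form n v w}" by blast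
next
  fix v assume v': "v \<in> {v \<in> carrier_vec (2 * n). \<forall>w\<in>col_lattice A. \<pi> ^ r dvd sp_form n v w}"
  then have v: "v \<in> carrier_vec (2 * n)" by blast
  note Ac = integral_simsD(1)[OF A]
  define x where "x = A\<^sup>T *\<^sub>v (J_mat n *\<^sub>v v)"
  have AT: "A\<^sup>T \<in> carrier_mat (2 * n) (2 * n)" using Ac by simp
  have xc: "x \<in> carrier_vec (2 * n)"
    unfolding x_def by (rule mult_mat_vec_carrier[OF AT mult_mat_vec_carrier[OF J_mat_carrier v]])
  have "\<pi> ^ r dvd x $ i" if i: "i < 2 * n" for i
  proof -
    have "x $ i = row A\<^sup>T i \<bullet> (J_mat n *\<^sub>v v)"
      unfolding x_def using i AT by (intro index_mult_mat_vec) auto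
    also have "row A\<^sup>T i = col A i" using i Ac by simp
    also have "col A i \<bullet> (J_mat n *\<^sub>v v) = sp_form n (col A i) v"
      using i Ac v by (intro scalar_prod_J) (auto intro: carrier_vecI)
    finally show ?thesis
      using v' col_in_col_lattice[OF Ac i] sp_form_swap[of n "col A i" v] by auto
  qed
  then have "\<forall>i. \<exists>c. i < 2 * n \<longrightarrow> x $ i = \<pi> ^ r * c" unfolding dvd_def by blast
  then obtain c where c: "\<And>i. i < 2 * n \<Longrightarrow> x $ i = \<pi> ^ r * c i" by metis
  define w where "w = - (J_mat n *\<^sub>v vec (2 * n) c)"
  have wc: "w \<in> carrier_vec (2 * n)"
    unfolding w_def using mult_mat_vec_carrier[OF J_mat_carrier, of "vec (2 * n) c"]
    by (intro uminus_carrier_vec[THEN iffD2]) auto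
  have x: "x = \<pi> ^ r \<cdot>\<^sub>v vec (2 * n) c"
    using xc c by (intro eq_vecI) auto
  have Bv: "sp_adjoint n A *\<^sub>v v = \<pi> ^ r \<cdot>\<^sub>v w"
    unfolding sp_adjoint_mult_vec[OF Ac v] x_def[symmetric] x w_def smult_uminus_vec
    by (simp only: mult_mat_vec_smult[OF J_mat_carrier vec_carrier])
  have AB: "A * sp_adjoint n A = \<pi> ^ r \<cdot>\<^sub>m 1\<^sub>m (2 * n)"
    by (rule mult_inverse_mat_commute[OF Ac sp_adjoint_carrier[OF Ac] sp_adjoint_mult[OF integral_simsD[OF A]]]) simp
  have "\<pi> ^ r \<cdot>\<^sub>v v = (A * sp_adjoint n A) *\<^sub>v v"
    by (simp only: AB smult_one_mult_vec[OF v])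
  then have eq: "\<pi> ^ r \<cdot>\<^sub>v v = \<pi> ^ r \<cdot>\<^sub>v (A *\<^sub>v w)"
    by (simp only: assoc_mult_mat_vec[OF Ac sp_adjoint_carrier[OF Ac] v] Bv mult_mat_vec_smult[OF Ac wc])
  have "v = A *\<^sub>v w"
  proof (rule eq_vecI)
    fix i assume i: "i < dim_vec (A *\<^sub>v w)"
    have "(\<pi> ^ r \<cdot>\<^sub>v v) $ i = (\<pi> ^ r \<cdot>\<^sub>v (A *\<^sub>v w)) $ i" using eq by simp
    then show "v $ i = (A *\<^sub>v w) $ i" using i v Ac by (simp del: index_mult_mat_vec)
  qed (use v Ac in auto)
  then show "v \<in> col_lattice A" using wc unfolding lattice_eq[OF Ac] by blast
qed

lemma left_divisible:
  fixes A :: "'p :: prime_card padic_int mat"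
  assumes A: "A \<in> carrier_mat a b" and X: "X \<in> carrier_mat a m"
    and cols: "\<And>j. j < m \<Longrightarrow> col X j \<in> col_lattice A"
  shows "\<exists>Z\<in>carrier_mat b m. X = A * Z"
proof -
  have "\<exists>w\<in>carrier_vec b. col X j = A *\<^sub>v w" if "j < m" for j
    using cols[OF that] A by (auto simp: col_lattice_def)
  then obtain w where w: "\<And>j. j < m \<Longrightarrow> w j \<in> carrier_vec b \<and> col X j = A *\<^sub>v w j" by metis
  define Z where "Z = mat b m (\<lambda>(i, j). w j $ i)"
  have Z: "Z \<in> carrier_mat b m" by (simp add: Z_def)
  have "X = A * Z"
  proof (rule mat_col_eqI)
    fix j assume "j < dim_col (A * Z)"
    then have j: "j < m" using Z by simp
    have "col Z j = w j" using w[OF j] j by (intro eq_vecI) (auto simp: Z_def)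
    then show "col X j = col (A * Z) j" using w[OF j] col_mult2[OF A Z j] by simp
  qed (use A X Z in auto)
  with Z show ?thesis by blast
qed

section \<open>Elementary divisors and reduction modulo \<open>p\<close>\<close>

text \<open>The dual coordinates i and n + i carry exponents with sum r as long as a i \<le> r; the
  subtraction is that of natural numbers.\<close>

definition sp_diag :: "nat \<Rightarrow> nat \<Rightarrow> (nat \<Rightarrow> nat) \<Rightarrow> 'p :: prime_card padic_int mat" where
  "sp_diag n r a = mat_diag (2 * n) (\<lambda>i. if i < n then \<pi> ^ a i else \<pi> ^ (r - a (i - n)))"

lemma sp_diag_carrier [simp]: "sp_diag n r a \<in> carrier_mat (2 * n) (2 * n)"
  by (simp add: sp_diag_def mat_diag_def)

lemma col_mult_sp_diag:
  fixes U :: "'p :: prime_card padic_int mat"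
  assumes "U \<in> carrier_mat (2 * n) (2 * n)" "j < 2 * n"
  shows "col (U * sp_diag n r a) j = (if j < n then \<pi> ^ a j else \<pi> ^ (r - a (j - n))) \<cdot>\<^sub>v col U j"
  unfolding sp_diag_def mat_diag_mult_right[OF assms(1)]
  using assms by (intro eq_vecI) auto

lemma sp_diag_integral_sims:
  assumes "\<And>i. i < n \<Longrightarrow> a i \<le> r"
  shows "(sp_diag n r a :: 'p :: prime_card padic_int mat) \<in> integral_sims n r"
proof -
  let ?d = "\<lambda>i. if i < n then \<pi> ^ a i else \<pi> ^ (r - a (i - n)) :: 'p padic_int"
  define D :: "'p padic_int mat" where "D = sp_diag n r a"
  have D: "D \<in> carrier_mat (2 * n) (2 * n)" by (simp add: D_def)
  have col: "col D i = ?d i \<cdot>\<^sub>v unit_vec (2 * n) i" if "i < 2 * n" for i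
    using that by (intro eq_vecI) (auto simp: D_def sp_diag_def mat_diag_def)
  have pow: "(\<pi> ^ a i * \<pi> ^ (r - a i) :: 'p padic_int) = \<pi> ^ r" if "i < n" for i
    using assms[OF that] by (simp flip: power_add)
  have "sp_form n (col D i) (col D j) = \<pi> ^ r * J_mat n $$ (i, j)"
    if ij: "i < 2 * n" "j < 2 * n" for i j
  proof -
    have "sp_form n (col D i) (col D j)
        = ?d i * sp_form n (unit_vec (2 * n) i) (?d j \<cdot>\<^sub>v unit_vec (2 * n) j)"
      unfolding col[OF ij(1)] col[OF ij(2)] by (rule sp_form_smult_left[OF unit_vec_carrier])
    also have "sp_form n (unit_vec (2 * n) i) (?d j \<cdot>\<^sub>v unit_vec (2 * n) j)
        = ?d j * sp_form n (unit_vec (2 * n) i) (unit_vec (2 * n) j)"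
      by (rule sp_form_smult_right[OF unit_vec_carrier])
    also have "?d i * (?d j * sp_form n (unit_vec (2 * n) i) (unit_vec (2 * n) j))
        = \<pi> ^ r * J_mat n $$ (i, j)"
      unfolding sp_form_unit_left[OF unit_vec_carrier ij(1)] J_mat_index[OF ij]
      using ij pow[of i] pow[of j] by (auto simp: mult.commute)
    finally show ?thesis .
  qed
  then have "D \<in> integral_sims n r"
    using sim_form_iff[OF D, of "\<pi> ^ r"] D by (simp add: integral_sims_def)
  then show ?thesis by (simp add: D_def)
qed

text \<open>The adapted basis as the columns of U; multiplication by the diagonal matrix attaches
  the powers of p that bring them into M.\<close>

lemma adapted_symplectic_matrix:
  fixes M :: "'p :: prime_card padic_int vec set"
  assumes M: "M = {v \<in> carrier_vec (2 * n). \<forall>w\<in>M. \<pi> ^ r dvd sp_form n v w}"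
  shows "\<exists>U\<in>integral_sims n 0. \<exists>a. (\<forall>i<n. 2 * a i \<le> r) \<and> (\<forall>j<n. \<forall>i\<le>j. a i \<le> a j) \<and>
    (\<forall>j<2 * n. col (U * sp_diag n r a) j \<in> M)"
proof -
  obtain e f a where fam: "symplectic_family n n e f"
    and mem: "\<And>i. i < n \<Longrightarrow> \<pi> ^ a i \<cdot>\<^sub>v e i \<in> M \<and> \<pi> ^ (r - a i) \<cdot>\<^sub>v f i \<in> M \<and> 2 * a i \<le> r"
    and mono: "\<forall>j<n. \<forall>i\<le>j. a i \<le> a j"
    using adapted_symplectic_family[OF M order_refl] by blast
  note ef = fam[unfolded symplectic_family_def]
  define u where "u j = (if j < n then e j else f (j - n))" for j
  define U where "U = mat (2 * n) (2 * n) (\<lambda>(i, j). u j $ i)"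
  have U: "U \<in> carrier_mat (2 * n) (2 * n)" by (simp add: U_def)
  have uc: "u j \<in> carrier_vec (2 * n)" if "j < 2 * n" for j
    using that ef by (auto simp: u_def)
  have col: "col U j = u j" if "j < 2 * n" for j
    using that uc[OF that] by (intro eq_vecI) (auto simp: U_def)
  have "sp_form n (col U i) (col U j) = \<pi> ^ 0 * J_mat n $$ (i, j)" if ij: "i < 2 * n" "j < 2 * n" for i j
  proof -
    have "sp_form n (u i) (u j) = J_mat n $$ (i, j)"
      unfolding J_mat_index[OF ij] u_def using ij ef sp_form_swap[of n "f (i - n)" "e j"] by auto
    then show ?thesis using col ij by simp
  qed
  then have "U \<in> integral_sims n 0"
    using sim_form_iff[OF U, of "\<pi> ^ 0"] U by (simp add: integral_sims_def)
  moreover have "col (U * sp_diag n r a) j \<in> M" if j: "j < 2 * n" for j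
    unfolding col_mult_sp_diag[OF U j] col[OF j] using mem j by (auto simp: u_def)
  moreover have "\<forall>i<n. 2 * a i \<le> r" using mem by blast
  ultimately show ?thesis using mono by blast
qed

text \<open>The adapted basis gives only one inclusion: with D the diagonal matrix, the columns of U
  D lie in the lattice of X, so U D = X Z. Both U D and X have factor p^r, hence Z has factor 1 and
  is invertible over Z_p.\<close>

theorem symplectic_elementary_divisors:
  fixes X :: "'p :: prime_card padic_int mat"
  assumes X: "X \<in> integral_sims n r"
  shows "\<exists>U\<in>integral_sims n 0. \<exists>V\<in>integral_sims n 0. \<exists>a.
    (\<forall>i<n. 2 * a i \<le> r) \<and> (\<forall>j<n. \<forall>i\<le>j. a i \<le> a j) \<and> X = U * sp_diag n r a * V"
proof -
  note Xc = integral_simsD(1)[OF X]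
  obtain U a where U: "U \<in> integral_sims n 0" and a: "\<forall>i<n. 2 * a i \<le> r" "\<forall>j<n. \<forall>i\<le>j. a i \<le> a j"
    and mem: "\<And>j. j < 2 * n \<Longrightarrow> col (U * sp_diag n r a) j \<in> col_lattice X"
    using adapted_symplectic_matrix[OF lattice_self_dual[OF X]] by blast
  have "sp_diag n r a \<in> integral_sims n r" using a(1) by (intro sp_diag_integral_sims) auto
  from integral_sims_mult[OF U this]
  have UD: "U * sp_diag n r a \<in> integral_sims n (r + 0)" by simp
  obtain Z where Z: "Z \<in> carrier_mat (2 * n) (2 * n)" "U * sp_diag n r a = X * Z"
    using left_divisible[OF Xc integral_simsD(1)[OF UD] mem] by blast
  have "Z \<in> integral_sims n 0"
    by (rule integral_sims_cancel[OF X Z(1) UD[unfolded Z(2)]])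
  then obtain V where V: "V \<in> integral_sims n 0" "Z * V = 1\<^sub>m (2 * n)"
    using integral_sims_inverse by blast
  have "U * sp_diag n r a * V = X"
    unfolding Z(2) assoc_mult_mat[OF Xc Z(1) integral_simsD(1)[OF V(1)]] V(2)
    using Xc by simp
  with U V(1) a show ?thesis by blast
qed

section \<open>Lattices modulo p and Lagrangian subspaces\<close>

definition red_lattice :: "'p :: prime_card padic_int mat \<Rightarrow> 'p mod_ring vec set" where
  "red_lattice A = map_vec red ` col_lattice A"

lemma red_vec_surj:
  assumes "x \<in> carrier_vec N"
  shows "\<exists>v\<in>carrier_vec N. map_vec red v = (x :: 'p :: prime_card mod_ring vec)"
proof -
  have "\<forall>i. \<exists>y :: 'p padic_int. red y = x $ i" using red_surj by blast
  then obtain y :: "nat \<Rightarrow> 'p padic_int" where y: "\<And>i. red (y i) = x $ i" by metis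
  have "map_vec red (vec N y) = x" using assms y by (intro eq_vecI) auto
  then show ?thesis by (intro bexI[of _ "vec N y"]) auto
qed

lemma lattice_of_similitude_iff:
  fixes A :: "'p :: prime_card padic_int mat"
  assumes A: "A \<in> integral_sims n 1"
  shows "v \<in> col_lattice A \<longleftrightarrow> v \<in> carrier_vec (2 * n) \<and> (\<forall>w\<in>col_lattice A. sp_form n (map_vec red v) (map_vec red w) = 0)"
proof -
  have Lc: "col_lattice A \<subseteq> carrier_vec (2 * n)"
    using lattice_subset[of A] integral_simsD(1)[OF A] by auto
  have "\<pi> ^ 1 dvd sp_form n v w \<longleftrightarrow> sp_form n (map_vec red v) (map_vec red w) = 0"
    if "v \<in> carrier_vec (2 * n)" "w \<in> col_lattice A" for w
    using red.sp_form_hom[OF that(1), of w] that(2) Lc red_eq_0_iff[of "sp_form n v w"] by auto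
  then show ?thesis
    by (subst lattice_self_dual[OF A]) blast
qed

text \<open>Self-duality of the lattice up to p, read modulo p; a vector over F_p is lifted to Z_p
  to apply it.\<close>

lemma red_lattice_lagrangian:
  fixes A :: "'p :: prime_card padic_int mat"
  assumes A: "A \<in> integral_sims n 1"
  shows "red_lattice A \<in> lagrangians n (carrier_vec (2 * n))"
proof -
  have "x \<in> red_lattice A \<longleftrightarrow> x \<in> perp n (carrier_vec (2 * n)) (red_lattice A)" for x
  proof
    assume "x \<in> red_lattice A"
    then obtain v where v: "v \<in> col_lattice A" "x = map_vec red v" unfolding red_lattice_def by blast
    note * = iffD1[OF lattice_of_similitude_iff[OF A] v(1)]
    then have "x \<in> carrier_vec (2 * n)" unfolding v(2) by simp
    moreover have "\<forall>y\<in>red_lattice A. sp_form n x y = 0"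
      unfolding v(2) red_lattice_def using * by blast
    ultimately show "x \<in> perp n (carrier_vec (2 * n)) (red_lattice A)"
      unfolding perp_def by blast
  next
    assume x: "x \<in> perp n (carrier_vec (2 * n)) (red_lattice A)"
    then obtain v where v: "v \<in> carrier_vec (2 * n)" "map_vec red v = x"
      using red_vec_surj[of x "2 * n"] unfolding perp_def by blast
    have "sp_form n (map_vec red v) (map_vec red w) = 0" if "w \<in> col_lattice A" for w
      using x that unfolding v(2)[symmetric] red_lattice_def perp_def by blast
    then have "v \<in> col_lattice A" using v(1) lattice_of_similitude_iff[OF A] by blast
    then show "x \<in> red_lattice A" using v unfolding red_lattice_def by blast
  qed
  then show ?thesis unfolding lagrangians_def by blast
qed

text \<open>A lattice that is self-dual up to p contains every multiple of p, so it is the full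
  preimage of its reduction. This is why a subspace over F_p records the whole lattice.\<close>

lemma lattice_iff_red:
  fixes A :: "'p :: prime_card padic_int mat"
  assumes A: "A \<in> integral_sims n 1"
  shows "v \<in> col_lattice A \<longleftrightarrow> v \<in> carrier_vec (2 * n) \<and> map_vec red v \<in> red_lattice A"
proof
  assume "v \<in> col_lattice A"
  then show "v \<in> carrier_vec (2 * n) \<and> map_vec red v \<in> red_lattice A"
    using lattice_of_similitude_iff[OF A] unfolding red_lattice_def by blast
next
  assume "v \<in> carrier_vec (2 * n) \<and> map_vec red v \<in> red_lattice A"
  then show "v \<in> col_lattice A"
    using red_lattice_lagrangian[OF A] lattice_of_similitude_iff[OF A]
    unfolding red_lattice_def lagrangians_def perp_def by blast
qed

text \<open>Left divisibility by A is inclusion of the column lattices, and inclusion in a full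
  preimage can be tested modulo p.\<close>

lemma left_divisible_iff_red:
  fixes A :: "'p :: prime_card padic_int mat"
  assumes A: "A \<in> integral_sims n 1" and X: "X \<in> carrier_mat (2 * n) (2 * n)"
  shows "(\<exists>Z\<in>carrier_mat (2 * n) (2 * n). X = A * Z) \<longleftrightarrow> red_lattice X \<subseteq> red_lattice A"
proof
  assume "\<exists>Z\<in>carrier_mat (2 * n) (2 * n). X = A * Z"
  then show "red_lattice X \<subseteq> red_lattice A"
    using lattice_mult_subset[OF integral_simsD(1)[OF A]] unfolding red_lattice_def by blast
next
  assume *: "red_lattice X \<subseteq> red_lattice A"
  have "col X j \<in> col_lattice A" if j: "j < 2 * n" for j
  proof -
    have c: "col X j \<in> col_lattice X" by (rule col_in_col_lattice[OF X j])
    moreover have "col_lattice X \<subseteq> carrier_vec (2 * n)" using lattice_subset[of X] X by auto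
    ultimately show ?thesis using * unfolding lattice_iff_red[OF A] red_lattice_def by blast
  qed
  then show "\<exists>Z\<in>carrier_mat (2 * n) (2 * n). X = A * Z"
    by (rule left_divisible[OF integral_simsD(1)[OF A] X])
qed

text \<open>Equal reductions give divisibility, and the quotient has factor 1. Together with
  \<open>red_lattice_surj\<close> this puts the cosets AK in O_n(p) in bijection with the
  Lagrangians.\<close>

lemma red_lattice_eq_iff:
  fixes A :: "'p :: prime_card padic_int mat"
  assumes A: "A \<in> integral_sims n 1" and B: "B \<in> integral_sims n 1"
  shows "red_lattice A = red_lattice B \<longleftrightarrow> (\<exists>Z\<in>integral_sims n 0. B = A * Z)"
proof
  assume "red_lattice A = red_lattice B"
  then obtain Z where Z: "Z \<in> carrier_mat (2 * n) (2 * n)" "B = A * Z"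
    using left_divisible_iff_red[OF A integral_simsD(1)[OF B]] by blast
  moreover have "Z \<in> integral_sims n 0"
    using integral_sims_cancel[OF A Z(1), of 0] B Z(2) by simp
  ultimately show "\<exists>Z\<in>integral_sims n 0. B = A * Z" by blast
next
  note Ac = integral_simsD(1)[OF A]
  assume "\<exists>Z\<in>integral_sims n 0. B = A * Z"
  then obtain Z where Z: "Z \<in> integral_sims n 0" "B = A * Z" by blast
  obtain W where W: "W \<in> integral_sims n 0" "Z * W = 1\<^sub>m (2 * n)"
    using integral_sims_inverse[OF Z(1)] by blast
  note Zc = integral_simsD(1)[OF Z(1)] and Wc = integral_simsD(1)[OF W(1)]
  have "B * W = A" unfolding Z(2) assoc_mult_mat[OF Ac Zc Wc] W(2) using Ac by simp
  then have "col_lattice A \<subseteq> col_lattice B"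
    using lattice_mult_subset[OF integral_simsD(1)[OF B] Wc] by simp
  moreover have "col_lattice B \<subseteq> col_lattice A" unfolding Z(2) by (rule lattice_mult_subset[OF Ac Zc])
  ultimately have "col_lattice A = col_lattice B" by blast
  then show "red_lattice A = red_lattice B" by (simp add: red_lattice_def)
qed

text \<open>The preimage M of L is self-dual up to p, so an adapted basis gives a similitude A with
  columns in M. Its reduction is a Lagrangian inside L, and taking complements reverses this
  inclusion.\<close>

lemma red_lattice_surj:
  fixes L :: "'p :: prime_card mod_ring vec set"
  assumes L: "L \<in> lagrangians n (carrier_vec (2 * n))"
  shows "\<exists>A\<in>integral_sims n 1. red_lattice A = L"
proof -
  have Lp: "x \<in> L \<longleftrightarrow> x \<in> carrier_vec (2 * n) \<and> (\<forall>y\<in>L. sp_form n x y = 0)" for x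
    using L unfolding lagrangians_def perp_def by blast
  define M where "M = {v \<in> carrier_vec (2 * n). map_vec red v \<in> L}"
  have red_M: "map_vec red ` M = L"
  proof (intro equalityI subsetI)
    fix y assume "y \<in> L"
    moreover then obtain w where "w \<in> carrier_vec (2 * n)" "map_vec red w = y"
      using red_vec_surj[of y "2 * n"] Lp by blast
    ultimately show "y \<in> map_vec red ` M" unfolding M_def by blast
  qed (auto simp: M_def)
  have dvd: "\<pi> ^ 1 dvd sp_form n v w \<longleftrightarrow> sp_form n (map_vec red v) (map_vec red w) = 0"
    if "v \<in> carrier_vec (2 * n)" "w \<in> M" for v w
    using red.sp_form_hom[OF that(1), of w] that(2) red_eq_0_iff[of "sp_form n v w"]
    by (auto simp: M_def)
  have "v \<in> M \<longleftrightarrow> v \<in> carrier_vec (2 * n) \<and> (\<forall>w\<in>M. \<pi> ^ 1 dvd sp_form n v w)" for v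
  proof -
    have "v \<in> M \<longleftrightarrow> v \<in> carrier_vec (2 * n) \<and> (\<forall>y\<in>map_vec red ` M. sp_form n (map_vec red v) y = 0)"
      unfolding red_M unfolding M_def using Lp[of "map_vec red v"] by auto
    then show ?thesis using dvd by auto
  qed
  then have M: "M = {v \<in> carrier_vec (2 * n). \<forall>w\<in>M. \<pi> ^ 1 dvd sp_form n v w}" by blast
  obtain U a where U: "U \<in> integral_sims n 0" and a: "\<forall>i<n. 2 * a i \<le> (1 :: nat)"
    and mem: "\<And>j. j < 2 * n \<Longrightarrow> col (U * sp_diag n 1 a) j \<in> M"
    using adapted_symplectic_matrix[OF M] by blast
  define A where "A = U * sp_diag n 1 a"
  have "sp_diag n 1 a \<in> integral_sims n 1" using a by (intro sp_diag_integral_sims) auto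
  from integral_sims_mult[OF U this] have A: "A \<in> integral_sims n 1" by (simp add: A_def)
  have colA: "map_vec red (col A j) \<in> L" if "j < 2 * n" for j
    using mem[OF that] by (simp add: A_def M_def)
  have iso: "sp_form n x y = 0" if x: "x \<in> red_lattice A" and y: "y \<in> L" for x y
  proof -
    obtain v where v: "v \<in> carrier_vec (2 * n)" "x = map_vec red (A *\<^sub>v v)"
      using x unfolding red_lattice_def lattice_eq[OF integral_simsD(1)[OF A]] by blast
    obtain w where w: "w \<in> M" "y = map_vec red w" using y red_M by blast
    have wc: "w \<in> carrier_vec (2 * n)" using w(1) by (simp add: M_def)
    have Av: "A *\<^sub>v v = lincomb_vec (2 * n) (2 * n) (\<lambda>j. v $ j) (col A)"
      using v(1) integral_simsD(1)[OF A]
      by (intro eq_vecI) (auto simp: lincomb_vec_def scalar_prod_def lessThan_atLeast0 mult.commute intro!: sum.cong)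
    have "\<pi> dvd sp_form n (col A j) w" if j: "j < 2 * n" for j
    proof -
      have "col A j \<in> M" using mem[OF j] by (simp add: A_def)
      then show ?thesis using M w(1) by auto
    qed
    then have "\<pi> dvd sp_form n (A *\<^sub>v v) w"
      unfolding Av sp_form_lincomb_left by (intro dvd_sum dvd_mult) auto
    then have "red (sp_form n (A *\<^sub>v v) w) = 0" by (simp add: red_eq_0_iff)
    then show ?thesis
      unfolding v(2) w(2)
      by (subst red.sp_form_hom[OF mult_mat_vec_carrier[OF integral_simsD(1)[OF A] v(1)] wc])
  qed
  have Ap: "x \<in> red_lattice A \<longleftrightarrow> x \<in> carrier_vec (2 * n) \<and> (\<forall>y\<in>red_lattice A. sp_form n x y = 0)" for x
    using red_lattice_lagrangian[OF A] unfolding lagrangians_def perp_def by blast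
  have "red_lattice A \<subseteq> L" using iso Ap Lp by blast
  moreover have "L \<subseteq> red_lattice A"
  proof
    fix y assume y: "y \<in> L"
    have "sp_form n y x = 0" if "x \<in> red_lattice A" for x
      using iso[OF that y] sp_form_swap[of n y x] by simp
    then show "y \<in> red_lattice A" using y Ap Lp by blast
  qed
  ultimately show ?thesis using A by blast
qed

section \<open>Normal forms for the factors p and p^2, and Lagrangians above their images\<close>

definition sp2_diag :: "nat \<Rightarrow> nat \<Rightarrow> 'p :: prime_card padic_int mat" where
  "sp2_diag n j = sp_diag n 2 (\<lambda>i. if i < n - j then 0 else 1)"

lemma sp2_diag_integral_sims: "sp2_diag n j \<in> integral_sims n 2"
  unfolding sp2_diag_def by (intro sp_diag_integral_sims) auto

lemma sp_diag_cong: "(\<And>i. i < n \<Longrightarrow> a i = b i) \<Longrightarrow> sp_diag n r a = sp_diag n r b"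
  unfolding sp_diag_def mat_diag_def by (intro eq_matI) auto

text \<open>The bound 2 a i \<le> 1 forces all exponents to be 0.\<close>

lemma integral_sims_1_decomp:
  fixes X :: "'p :: prime_card padic_int mat"
  assumes "X \<in> integral_sims n 1"
  shows "\<exists>U\<in>integral_sims n 0. \<exists>V\<in>integral_sims n 0. X = U * sp_diag n 1 (\<lambda>_. 0) * V"
proof -
  obtain U V a where UV: "U \<in> integral_sims n 0" "V \<in> integral_sims n 0"
    and a: "\<forall>i<n. 2 * a i \<le> (1 :: nat)" and X: "X = U * sp_diag n 1 a * V"
    using symplectic_elementary_divisors[OF assms] by blast
  have "(sp_diag n 1 a :: 'p padic_int mat) = sp_diag n 1 (\<lambda>_. 0)"
    using a by (intro sp_diag_cong) auto
  with UV X show ?thesis by auto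
qed

text \<open>The bound 2 a i \<le> 2 leaves the exponents 0 and 1, and monotonicity puts the zeros
  first; j counts the ones.\<close>

lemma integral_sims_2_decomp:
  fixes X :: "'p :: prime_card padic_int mat"
  assumes "X \<in> integral_sims n 2"
  shows "\<exists>j\<le>n. \<exists>U\<in>integral_sims n 0. \<exists>V\<in>integral_sims n 0. X = U * sp2_diag n j * V"
proof -
  obtain U V a where UV: "U \<in> integral_sims n 0" "V \<in> integral_sims n 0"
    and a: "\<forall>i<n. 2 * a i \<le> (2 :: nat)" and mono: "\<forall>j<n. \<forall>i\<le>j. a i \<le> a j"
    and X: "X = U * sp_diag n 2 a * V"
    using symplectic_elementary_divisors[OF assms] by blast
  \<comment> \<open>The number of exponents 0. The alternative i = n makes the minimum exist when
    all exponents are 0.\<close>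
  define m where "m = (LEAST i. i = n \<or> a i \<noteq> 0)"
  have m: "m = n \<or> a m \<noteq> 0" unfolding m_def by (rule LeastI[of _ n]) simp
  have mn: "m \<le> n" unfolding m_def by (rule Least_le) simp
  have lt: "a i = 0" if "i < m" for i using not_less_Least[of i] that unfolding m_def by blast
  have "a i = (if i < n - (n - m) then 0 else 1)" if i: "i < n" for i
  proof (cases "i < m")
    case True
    then show ?thesis using lt mn by simp
  next
    case False
    then have "a m \<noteq> 0" "a m \<le> a i" using m mono i by auto
    moreover have "a i \<le> 1" using a i by auto
    ultimately show ?thesis using False mn by simp
  qed
  then have "(sp_diag n 2 a :: 'p padic_int mat) = sp2_diag n (n - m)"
    unfolding sp2_diag_def by (intro sp_diag_cong) auto
  with UV X show ?thesis by (intro exI[of _ "n - m"]) auto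
qed

text \<open>The span of the first n - j basis vectors, which is the image of
  \<open>sp2_diag n j\<close> modulo p.\<close>

definition coord_isotropic :: "nat \<Rightarrow> nat \<Rightarrow> 'a :: zero vec set" where
  "coord_isotropic n j = {v \<in> carrier_vec (2 * n). \<forall>i\<in>{n - j..<2 * n}. v $ i = 0}"

lemma card_coord_isotropic:
  "j \<le> n \<Longrightarrow> card (coord_isotropic n j :: 'a :: {zero, finite} vec set) = CARD('a) ^ (n - j)"
  unfolding coord_isotropic_def
  using card_coordinate_subspace[of "{n - j..<2 * n}" "2 * n", where 'a = 'a] by (simp add: subset_iff)

lemma perp_coord_isotropic:
  "perp n (carrier_vec (2 * n)) (coord_isotropic n j) =
    {v \<in> carrier_vec (2 * n). \<forall>i\<in>{n..<n + (n - j)}. v $ i = (0 :: 'a :: field)}" (is "?P = ?V")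
proof (intro equalityI subsetI)
  fix v assume v: "v \<in> ?P"
  then have vc: "v \<in> carrier_vec (2 * n)" by (simp add: perp_def)
  have "v $ i = 0" if i: "i \<in> {n..<n + (n - j)}" for i
  proof -
    have "unit_vec (2 * n) (i - n) \<in> (coord_isotropic n j :: 'a vec set)"
      using i by (auto simp: coord_isotropic_def)
    then have "sp_form n (unit_vec (2 * n) (i - n)) v = 0"
      using v sp_form_swap[of n v] by (auto simp: perp_def)
    moreover have "i - n < n" "i - n < 2 * n" "n + (i - n) = i" using i by auto
    ultimately show ?thesis using sp_form_unit_left[OF vc, of "i - n"] by simp
  qed
  with vc show "v \<in> ?V" by blast
next
  fix v assume v: "v \<in> ?V"
  have "sp_form n v w = 0" if w: "w \<in> coord_isotropic n j" for w
    unfolding sp_form_def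
  proof (rule sum.neutral, rule ballI)
    fix i assume "i \<in> {..<n}"
    then show "v $ i * w $ (n + i) - v $ (n + i) * w $ i = 0"
      using v w by (cases "i < n - j") (auto simp: coord_isotropic_def)
  qed
  then show "v \<in> ?P" using v by (simp add: perp_def)
qed

text \<open>Let W be the coordinate subspace and V its complement. Then W is the radical of V, so
  the Lagrangians above W are exactly those of V; the dimensions n + j and n - j leave 2j modulo the
  radical.\<close>

lemma card_lagrangians_above_coord:
  fixes n j :: nat
  assumes j: "j \<le> n"
  shows "card {L \<in> lagrangians n (carrier_vec (2 * n) :: 'a :: {field, finite} vec set). coord_isotropic n j \<subseteq> L}
    = (\<Prod>i = 1..j. CARD('a) ^ i + 1)"
proof -
  let ?C = "carrier_vec (2 * n) :: 'a vec set" and ?W = "coord_isotropic n j :: 'a vec set"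
  define V where "V = perp n ?C ?W"
  have V: "V = {v \<in> ?C. \<forall>i\<in>{n..<n + (n - j)}. v $ i = 0}"
    unfolding V_def by (rule perp_coord_isotropic)
  have subV: "subspace_vec (2 * n) V"
    unfolding V_def by (rule subspace_vec_perp) (auto simp: subspace_vec_def)
  have WV: "?W \<subseteq> V"
  proof -
    have "{n..<n + (n - j)} \<subseteq> {n - j..<2 * n}" by auto
    then show ?thesis unfolding V coord_isotropic_def by blast
  qed
  have rad: "perp n V V = ?W"
  proof (intro equalityI subsetI)
    fix v assume v: "v \<in> perp n V V"
    then have vc: "v \<in> ?C" unfolding perp_def V by blast
    have form: "sp_form n (unit_vec (2 * n) l) v = 0" if "l < 2 * n" "l \<notin> {n..<n + (n - j)}" for l
    proof -
      have "unit_vec (2 * n) l \<in> V" unfolding V using that by auto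
      then show ?thesis using v sp_form_swap[of n v] by (auto simp: perp_def)
    qed
    have "v $ i = 0" if i: "i \<in> {n - j..<2 * n}" for i
    proof (cases "i < n")
      case True
      then show ?thesis using form[of "n + i"] i sp_form_unit_left[OF vc, of "n + i"] by auto
    next
      case False
      then show ?thesis using form[of "i - n"] i sp_form_unit_left[OF vc, of "i - n"] by auto
    qed
    with vc show "v \<in> ?W" unfolding coord_isotropic_def by blast
  next
    fix v assume v: "v \<in> ?W"
    have "sp_form n v w = 0" if "w \<in> V" for w
      using that v sp_form_swap[of n v w] unfolding V_def perp_def by auto
    then show "v \<in> perp n V V" using v WV unfolding perp_def by blast
  qed
  have "card V = CARD('a) ^ (2 * n - (n - j))"
  proof -
    have "{n..<n + (n - j)} \<subseteq> {..<2 * n}" by auto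
    from card_coordinate_subspace[OF this, where 'a = 'a] show ?thesis unfolding V by simp
  qed
  also have "\<dots> = CARD('a) ^ (2 * j) * card (perp n V V)"
    unfolding rad card_coord_isotropic[OF j] power_add[symmetric] using j by (simp add: add.commute)
  finally have "card (lagrangians n V) = (\<Prod>i = 1..j. CARD('a) ^ i + 1)"
    by (rule card_lagrangians[OF subV])
  moreover have "{L \<in> lagrangians n ?C. ?W \<subseteq> L} = lagrangians n V"
  proof (intro equalityI subsetI)
    fix L assume "L \<in> {L \<in> lagrangians n ?C. ?W \<subseteq> L}"
    then have L: "L = perp n ?C L" "?W \<subseteq> L" by (auto simp: lagrangians_def)
    then show "L \<in> lagrangians n V" unfolding lagrangians_def V_def perp_def by blast
  next
    fix L assume L: "L \<in> lagrangians n V"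
    then have "?W \<subseteq> L" using radical_subset_lagrangian[OF L] rad by simp
    moreover from this L have "L = perp n ?C L" unfolding lagrangians_def V_def perp_def by blast
    ultimately show "L \<in> {L \<in> lagrangians n ?C. ?W \<subseteq> L}" unfolding lagrangians_def by blast
  qed
  ultimately show ?thesis by simp
qed

lemma mat_diag_mult_vec_index:
  assumes "v \<in> carrier_vec N" "i < N"
  shows "(mat_diag N f *\<^sub>v v) $ i = (f i * v $ i :: 'a :: comm_ring_1)"
proof -
  have "(mat_diag N f *\<^sub>v v) $ i = (\<Sum>k<N. (if i = k then f k else 0) * v $ k)"
    using assms by (simp add: mat_diag_def scalar_prod_def lessThan_atLeast0)
  also have "\<dots> = (\<Sum>k<N. if i = k then f i * v $ k else 0)"
    by (intro sum.cong) auto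
  finally show ?thesis using assms(2) by simp
qed

lemma red_pi [simp]: "red \<pi> = (0 :: 'p :: prime_card mod_ring)"
  by (simp add: red_eq_0_iff)

text \<open>Of the diagonal entries 1, p and p^2 only the n - j ones survive reduction.\<close>

lemma red_lattice_sp2_diag:
  assumes j: "j \<le> n"
  shows "red_lattice (sp2_diag n j :: 'p :: prime_card padic_int mat) = coord_isotropic n j"
proof -
  let ?d = "\<lambda>i. if i < n then \<pi> ^ (if i < n - j then 0 else 1)
    else \<pi> ^ (2 - (if i - n < n - j then 0 else 1)) :: 'p padic_int"
  let ?D = "sp2_diag n j :: 'p padic_int mat"
  have Dc: "?D \<in> carrier_mat (2 * n) (2 * n)" by (simp add: sp2_diag_def)
  have D: "(?D *\<^sub>v x) $ i = ?d i * x $ i" if "x \<in> carrier_vec (2 * n)" "i < 2 * n" for x i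
    unfolding sp2_diag_def sp_diag_def by (rule mat_diag_mult_vec_index[OF that])
  have d: "red (?d i) = (if i < n - j then 1 else 0)" for i
    by (auto simp: red.hom_power)
  show ?thesis
  proof (intro equalityI subsetI)
    fix y assume "y \<in> red_lattice ?D"
    then obtain x where x: "x \<in> carrier_vec (2 * n)" "y = map_vec red (?D *\<^sub>v x)"
      unfolding red_lattice_def lattice_eq[OF Dc] by blast
    have Dx: "?D *\<^sub>v x \<in> carrier_vec (2 * n)" by (rule mult_mat_vec_carrier[OF Dc x(1)])
    have "y $ i = 0" if "i \<in> {n - j..<2 * n}" for i
    proof -
      have i: "i < 2 * n" "\<not> i < n - j" using that by auto
      have "y $ i = red ((?D *\<^sub>v x) $ i)" unfolding x(2) using i(1) by (intro index_map_vec) (simp only: carrier_vecD[OF Dx])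
      also have "\<dots> = red (?d i) * red (x $ i)" unfolding D[OF x(1) i(1)] by (rule red.hom_mult)
      also have "\<dots> = 0" unfolding d using i by simp
      finally show ?thesis .
    qed
    moreover have "y \<in> carrier_vec (2 * n)" unfolding x(2) by (rule map_carrier_vec[THEN iffD2, OF Dx])
    ultimately show "y \<in> coord_isotropic n j" unfolding coord_isotropic_def by blast
  next
    fix y :: "'p mod_ring vec" assume y: "y \<in> coord_isotropic n j"
    then have yc: "y \<in> carrier_vec (2 * n)" unfolding coord_isotropic_def by blast
    obtain v where v: "v \<in> carrier_vec (2 * n)" "map_vec red v = y" using red_vec_surj[OF yc] by blast
    have Dv: "?D *\<^sub>v v \<in> carrier_vec (2 * n)" by (rule mult_mat_vec_carrier[OF Dc v(1)])
    have "map_vec red (?D *\<^sub>v v) = y"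
    proof (rule eq_vecI)
      fix i assume "i < dim_vec y"
      then have i: "i < 2 * n" using yc by simp
      have "map_vec red (?D *\<^sub>v v) $ i = red ((?D *\<^sub>v v) $ i)" using i by (intro index_map_vec) (simp only: carrier_vecD[OF Dv])
      also have "\<dots> = red (?d i) * red (v $ i)" unfolding D[OF v(1) i] by (rule red.hom_mult)
      also have "red (v $ i) = y $ i" using v i by auto
      also have "red (?d i) * y $ i = y $ i" unfolding d using y i by (auto simp: coord_isotropic_def)
      finally show "map_vec red (?D *\<^sub>v v) $ i = y $ i" .
    qed (simp only: index_map_vec carrier_vecD[OF Dv] carrier_vecD[OF yc])
    then show "y \<in> red_lattice ?D" unfolding red_lattice_def lattice_eq[OF Dc] using v(1) by blast
  qed
qed

lemma lattice_mult_unimodular: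
  fixes A :: "'p :: prime_card padic_int mat"
  assumes A: "A \<in> carrier_mat (2 * n) (2 * n)" and Z: "Z \<in> integral_sims n 0"
  shows "col_lattice (A * Z) = col_lattice A"
proof -
  obtain W where W: "W \<in> integral_sims n 0" "Z * W = 1\<^sub>m (2 * n)"
    using integral_sims_inverse[OF Z] by blast
  note Zc = integral_simsD(1)[OF Z] and Wc = integral_simsD(1)[OF W(1)]
  have "A * Z * W = A" unfolding assoc_mult_mat[OF A Zc Wc] W(2) using A by simp
  then have "col_lattice A \<subseteq> col_lattice (A * Z)"
    using lattice_mult_subset[OF mult_carrier_mat[OF A Zc] Wc] by simp
  then show ?thesis using lattice_mult_subset[OF A Zc] by blast
qed

lemma red_lattice_mult_left:
  fixes U :: "'p :: prime_card padic_int mat"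
  assumes U: "U \<in> carrier_mat (2 * n) (2 * n)" and X: "X \<in> carrier_mat (2 * n) (2 * n)"
  shows "red_lattice (U * X) = (\<lambda>x. map_mat red U *\<^sub>v x) ` red_lattice X"
proof -
  have "map_vec red (U * X *\<^sub>v v) = map_mat red U *\<^sub>v map_vec red (X *\<^sub>v v)"
    if v: "v \<in> carrier_vec (2 * n)" for v
    unfolding assoc_mult_mat_vec[OF U X v]
    by (rule red.mult_mat_vec_hom[OF U mult_mat_vec_carrier[OF X v]])
  then show ?thesis
    unfolding red_lattice_def lattice_eq[OF mult_carrier_mat[OF U X]] lattice_eq[OF X] image_image
    by (rule image_cong[OF refl])
qed

context
  fixes U U' :: "'p :: prime_card padic_int mat" and n :: nat
  assumes U: "U \<in> integral_sims n 0" and U': "U' \<in> integral_sims n 0"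
    and inv: "U' * U = 1\<^sub>m (2 * n)"
begin

lemma red_inverse_mult_vec:
  assumes "x \<in> carrier_vec (2 * n)"
  shows "map_mat red U' *\<^sub>v (map_mat red U *\<^sub>v x) = x"
proof -
  note Uc = integral_simsD(1)[OF U] and Uc' = integral_simsD(1)[OF U']
  have "map_mat red U' *\<^sub>v (map_mat red U *\<^sub>v x) = (map_mat red U' * map_mat red U) *\<^sub>v x"
    using Uc Uc' assms by (intro assoc_mult_mat_vec[symmetric]) auto
  also have "map_mat red U' * map_mat red U = 1\<^sub>m (2 * n)"
    by (simp only: red.mat_hom_mult[OF Uc' Uc, symmetric] inv red.mat_hom_one)
  finally show ?thesis using assms by simp
qed

text \<open>Instead of checking that the reduction of U preserves the form, L is lifted to a
  similitude A and the product U A is reduced.\<close>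

lemma lagrangian_image:
  assumes L: "L \<in> lagrangians n (carrier_vec (2 * n))"
  shows "(\<lambda>x. map_mat red U *\<^sub>v x) ` L \<in> lagrangians n (carrier_vec (2 * n))"
proof -
  obtain A where A: "A \<in> integral_sims n 1" "red_lattice A = L"
    using red_lattice_surj[OF L] by blast
  have "U * A \<in> integral_sims n 1" using integral_sims_mult[OF U A(1)] by simp
  from red_lattice_lagrangian[OF this] show ?thesis
    by (simp only: red_lattice_mult_left[OF integral_simsD(1)[OF U] integral_simsD(1)[OF A(1)]] A(2))
qed

lemma image_image_red_inverse:
  assumes "S \<subseteq> carrier_vec (2 * n)"
  shows "(\<lambda>x. map_mat red U' *\<^sub>v x) ` (\<lambda>x. map_mat red U *\<^sub>v x) ` S = S"
  unfolding image_image using assms red_inverse_mult_vec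
  by (subst image_cong[OF refl, of _ _ id]) auto

end

lemma lagrangian_subset: "L \<in> lagrangians n V \<Longrightarrow> L \<subseteq> V"
  unfolding lagrangians_def perp_def by blast

text \<open>The factor V does not change the lattice, and U acts modulo p by an invertible map that
  permutes the Lagrangians, so both counts reduce to the diagonal case. The first tells the double
  cosets apart; the second is the value of the convolution square.\<close>

lemma
  fixes U V :: "'p :: prime_card padic_int mat"
  assumes U: "U \<in> integral_sims n 0" and V: "V \<in> integral_sims n 0" and j: "j \<le> n"
  defines "X \<equiv> U * sp2_diag n j * V"
  shows card_red_lattice_sp2: "card (red_lattice X) = CARD('p) ^ (n - j)"
    and card_lagrangians_above_sp2:
      "card {L \<in> lagrangians n (carrier_vec (2 * n)). red_lattice X \<subseteq> L} = (\<Prod>i = 1..j. CARD('p) ^ i + 1)"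
proof -
  let ?D = "sp2_diag n j :: 'p padic_int mat" and ?C = "carrier_vec (2 * n) :: 'p mod_ring vec set"
  let ?W = "coord_isotropic n j :: 'p mod_ring vec set"
  note Uc = integral_simsD(1)[OF U] and Dc = integral_simsD(1)[OF sp2_diag_integral_sims, of n j]
  obtain U' where U': "U' \<in> integral_sims n 0" "U * U' = 1\<^sub>m (2 * n)" "U' * U = 1\<^sub>m (2 * n)"
    using integral_sims_inverse[OF U] by blast
  let ?h = "\<lambda>x. map_mat red U *\<^sub>v x" and ?h' = "\<lambda>x. map_mat red U' *\<^sub>v x"
  have WC: "?W \<subseteq> ?C" by (auto simp: coord_isotropic_def)
  have X: "red_lattice X = ?h ` ?W"
    unfolding red_lattice_sp2_diag[OF j, symmetric] red_lattice_mult_left[OF Uc Dc, symmetric]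
    unfolding X_def red_lattice_def lattice_mult_unimodular[OF mult_carrier_mat[OF Uc Dc] V] ..
  note h'h = image_image_red_inverse[OF U U'(1,3)] and hh' = image_image_red_inverse[OF U'(1) U U'(2)]
  have "inj_on ?h ?W"
    by (rule inj_on_inverseI[of _ ?h']) (rule red_inverse_mult_vec[OF U U'(1,3) subsetD[OF WC]])
  then show "card (red_lattice X) = CARD('p) ^ (n - j)"
    unfolding X using card_coord_isotropic[OF j, where 'a = "'p mod_ring"] by (simp add: card_image)
  have "bij_betw (image ?h) {L \<in> lagrangians n ?C. ?W \<subseteq> L} {L \<in> lagrangians n ?C. red_lattice X \<subseteq> L}"
  proof (rule bij_betw_byWitness[of _ "image ?h'"])
    show "\<forall>L\<in>{L \<in> lagrangians n ?C. ?W \<subseteq> L}. ?h' ` ?h ` L = L"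
      by (intro ballI h'h lagrangian_subset[of _ n]) simp
    show "\<forall>L\<in>{L \<in> lagrangians n ?C. red_lattice X \<subseteq> L}. ?h ` ?h' ` L = L"
      by (intro ballI hh' lagrangian_subset[of _ n]) simp
    show "(`) ?h ` {L \<in> lagrangians n ?C. ?W \<subseteq> L} \<subseteq> {L \<in> lagrangians n ?C. red_lattice X \<subseteq> L}"
    proof (rule image_subsetI)
      fix L assume "L \<in> {L \<in> lagrangians n ?C. ?W \<subseteq> L}"
      then have L: "L \<in> lagrangians n ?C" "?W \<subseteq> L" by simp_all
      have "?h ` ?W \<subseteq> ?h ` L" by (rule image_mono[OF L(2)])
      then show "?h ` L \<in> {L \<in> lagrangians n ?C. red_lattice X \<subseteq> L}"
        unfolding X using lagrangian_image[OF U U'(1,3) L(1)] by simp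
    qed
    show "(`) ?h' ` {L \<in> lagrangians n ?C. red_lattice X \<subseteq> L} \<subseteq> {L \<in> lagrangians n ?C. ?W \<subseteq> L}"
    proof (rule image_subsetI)
      fix L assume "L \<in> {L \<in> lagrangians n ?C. red_lattice X \<subseteq> L}"
      then have L: "L \<in> lagrangians n ?C" "red_lattice X \<subseteq> L" by simp_all
      have "?h' ` ?h ` ?W \<subseteq> ?h' ` L" using L(2) unfolding X by (rule image_mono)
      then show "?h' ` L \<in> {L \<in> lagrangians n ?C. ?W \<subseteq> L}"
        unfolding h'h[OF WC] using lagrangian_image[OF U'(1) U U'(2) L(1)] by simp
    qed
  qed
  from bij_betw_same_card[OF this]
  show "card {L \<in> lagrangians n ?C. red_lattice X \<subseteq> L} = (\<Prod>i = 1..j. CARD('p) ^ i + 1)"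
    using card_lagrangians_above_coord[OF j, where 'a = "'p mod_ring"] by simp
qed

section \<open>The similitude group and its topology\<close>

abbreviation emb_mat :: "'p :: prime_card padic_int mat \<Rightarrow> 'p padic mat" where
  "emb_mat \<equiv> map_mat to_fract"

lemma pp_nonzero [simp]: "(pp :: 'p :: prime_card padic) \<noteq> 0"
  by (metis to_fract_pi pi_nonzero to_fract_eq_0_iff)

lemma emb_mat_inj: "emb_mat A = emb_mat B \<longleftrightarrow> A = B"
  using emb.mat_hom_inj by blast

lemma emb_mat_transpose: "emb_mat (A\<^sup>T) = (emb_mat A)\<^sup>T"
  by (intro eq_matI) auto

lemma emb_mat_form:
  assumes A: "A \<in> carrier_mat (2 * n) (2 * n)"
  shows "(emb_mat A)\<^sup>T * J_mat n * emb_mat A = emb_mat (A\<^sup>T * J_mat n * A)"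
proof -
  have AT: "A\<^sup>T \<in> carrier_mat (2 * n) (2 * n)" using A by simp
  show ?thesis
    by (simp only: emb.mat_hom_mult[OF mult_carrier_mat[OF AT J_mat_carrier] A]
        emb.mat_hom_mult[OF AT J_mat_carrier] emb_mat_transpose emb.J_mat_hom)
qed

lemma emb_mat_smult: "emb_mat (c \<cdot>\<^sub>m A) = to_fract c \<cdot>\<^sub>m emb_mat A"
  by (intro eq_matI) auto

text \<open>The map f is arbitrary because this is used both for the embedding of Z_p and for that
  embedding followed by multiplication by p.\<close>

lemma integral_matrix_entries:
  assumes "\<And>i j. i < a \<Longrightarrow> j < b \<Longrightarrow> g $$ (i, j) \<in> range f" "g \<in> carrier_mat a b"
  shows "\<exists>A\<in>carrier_mat a b. g = map_mat f A"
proof -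
  have "\<forall>i j. \<exists>c. i < a \<longrightarrow> j < b \<longrightarrow> g $$ (i, j) = f c" using assms(1) by blast
  then obtain c where c: "\<And>i j. i < a \<Longrightarrow> j < b \<Longrightarrow> g $$ (i, j) = f (c i j)" by metis
  have "g = map_mat f (mat a b (\<lambda>(i, j). c i j))"
    using assms(2) c by (intro eq_matI) auto
  then show ?thesis by (intro bexI[of _ "mat a b (\<lambda>(i, j). c i j)"]) auto
qed

lemma integral_mat_iff:
  assumes "g \<in> carrier_mat a b"
  shows "integral_mat g \<longleftrightarrow> (\<exists>A\<in>carrier_mat a b. g = emb_mat A)"
proof
  assume "integral_mat g"
  then have "g $$ (i, j) \<in> range to_fract" if "i < a" "j < b" for i j
    using elements_matI[OF assms that refl] unfolding integral_mat_def Zp_eq by blast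
  then show "\<exists>A\<in>carrier_mat a b. g = emb_mat A" using assms by (rule integral_matrix_entries)
next
  assume "\<exists>A\<in>carrier_mat a b. g = emb_mat A"
  then show "integral_mat g" unfolding integral_mat_def Zp_eq by (auto elim!: elements_matD)
qed

lemma O_set_eq: "(O_set n r :: 'p :: prime_card padic mat set) = emb_mat ` integral_sims n r"
proof (intro equalityI subsetI)
  fix g :: "'p padic mat" assume g: "g \<in> O_set n r"
  then obtain A where A: "A \<in> carrier_mat (2 * n) (2 * n)" "g = emb_mat A"
    using integral_mat_iff[of g "2 * n" "2 * n"] unfolding O_set_def by blast
  have "emb_mat (A\<^sup>T * J_mat n * A) = emb_mat (\<pi> ^ r \<cdot>\<^sub>m J_mat n)"
    unfolding emb_mat_form[OF A(1), symmetric] emb_mat_smult emb.J_mat_hom emb.hom_power to_fract_pi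
    using g A(2) unfolding O_set_def by blast
  then show "g \<in> emb_mat ` integral_sims n r"
    using A unfolding emb_mat_inj integral_sims_def by blast
next
  fix g :: "'p padic mat" assume "g \<in> emb_mat ` integral_sims n r"
  then obtain A where A: "A \<in> integral_sims n r" "g = emb_mat A" by blast
  note Ac = integral_simsD(1)[OF A(1)]
  have "g\<^sup>T * J_mat n * g = pp ^ r \<cdot>\<^sub>m J_mat n"
    unfolding A(2) emb_mat_form[OF Ac] integral_simsD(2)[OF A(1)]
    by (simp only: emb_mat_smult emb.J_mat_hom emb.hom_power to_fract_pi)
  moreover have "g \<in> carrier_mat (2 * n) (2 * n)" using A(2) Ac by simp
  ultimately show "g \<in> O_set n r"
    unfolding O_set_def using integral_mat_iff[of g "2 * n" "2 * n"] A(2) Ac by blast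
qed

lemma Sp_Zp_eq: "Sp_Zp n = emb_mat ` integral_sims n 0"
  unfolding O_set_eq[symmetric] Sp_Zp_def O_set_def by (simp add: one_smult_mat)

lemma sim_group_simps [simp]:
  "x \<otimes>\<^bsub>sim_group n\<^esub> y = x * y" "\<one>\<^bsub>sim_group n\<^esub> = 1\<^sub>m (2 * n)"
  by (simp_all add: sim_group_def)

lemma sim_group_carrier:
  "g \<in> carrier (sim_group n) \<longleftrightarrow> g \<in> carrier_mat (2 * n) (2 * n) \<and>
    (\<exists>r :: int. g\<^sup>T * J_mat n * g = (pp powi r) \<cdot>\<^sub>m J_mat n)"
  by (simp add: sim_group_def)

lemma sim_group_group: "group (sim_group n :: 'p :: prime_card padic mat monoid)"
proof (rule groupI)
  let ?G = "sim_group n :: 'p padic mat monoid"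
  have Gc: "x \<in> carrier_mat (2 * n) (2 * n)" if "x \<in> carrier ?G" for x
    using that sim_group_carrier by blast
  show "x \<otimes>\<^bsub>?G\<^esub> y \<in> carrier ?G" if x: "x \<in> carrier ?G" and y: "y \<in> carrier ?G" for x y
  proof -
    obtain r where r: "x\<^sup>T * J_mat n * x = (pp powi r) \<cdot>\<^sub>m J_mat n" using x sim_group_carrier by blast
    obtain s where s: "y\<^sup>T * J_mat n * y = (pp powi s) \<cdot>\<^sub>m J_mat n" using y sim_group_carrier by blast
    have "(x * y)\<^sup>T * J_mat n * (x * y) = (pp powi (r + s)) \<cdot>\<^sub>m J_mat n"
      unfolding sim_form_prod[OF Gc[OF x] r Gc[OF y]] s smult_smult_mat
      by (simp add: power_int_add)
    moreover have "x * y \<in> carrier_mat (2 * n) (2 * n)" by (rule mult_carrier_mat[OF Gc[OF x] Gc[OF y]])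
    ultimately show ?thesis unfolding sim_group_carrier sim_group_simps by blast
  qed
  have J1: "(1\<^sub>m (2 * n))\<^sup>T * J_mat n * 1\<^sub>m (2 * n) = (J_mat n :: 'p padic mat)"
    by (simp add: left_mult_one_mat[OF J_mat_carrier] right_mult_one_mat[OF J_mat_carrier])
  then have "(1\<^sub>m (2 * n))\<^sup>T * J_mat n * 1\<^sub>m (2 * n) = (pp powi 0) \<cdot>\<^sub>m (J_mat n :: 'p padic mat)"
    by (simp add: one_smult_mat)
  then show "\<one>\<^bsub>?G\<^esub> \<in> carrier ?G"
    unfolding sim_group_carrier sim_group_simps using one_carrier_mat by blast
  show "x \<otimes>\<^bsub>?G\<^esub> y \<otimes>\<^bsub>?G\<^esub> z = x \<otimes>\<^bsub>?G\<^esub> (y \<otimes>\<^bsub>?G\<^esub> z)"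
    if "x \<in> carrier ?G" "y \<in> carrier ?G" "z \<in> carrier ?G" for x y z
    unfolding sim_group_simps by (rule assoc_mult_mat[OF Gc[OF that(1)] Gc[OF that(2)] Gc[OF that(3)]])
  show "\<one>\<^bsub>?G\<^esub> \<otimes>\<^bsub>?G\<^esub> x = x" if "x \<in> carrier ?G" for x
    unfolding sim_group_simps by (rule left_mult_one_mat[OF Gc[OF that]])
  show "\<exists>y\<in>carrier ?G. y \<otimes>\<^bsub>?G\<^esub> x = \<one>\<^bsub>?G\<^esub>" if x: "x \<in> carrier ?G" for x
  proof -
    obtain r where r: "x\<^sup>T * J_mat n * x = (pp powi r) \<cdot>\<^sub>m J_mat n" using x sim_group_carrier by blast
    let ?c = "pp powi r :: 'p padic" and ?d = "pp powi (- r) :: 'p padic"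
    have dc: "?d * ?c = 1" by (simp flip: power_int_add)
    \<comment> \<open>The adjoint divided by the similitude factor is the inverse.\<close>
    define y where "y = ?d \<cdot>\<^sub>m sp_adjoint n x"
    have y: "y \<in> carrier_mat (2 * n) (2 * n)" unfolding y_def using Gc[OF x] by simp
    have yx: "y * x = 1\<^sub>m (2 * n)"
      unfolding y_def mult_smult_assoc_mat[OF sp_adjoint_carrier[OF Gc[OF x]] Gc[OF x]]
        sp_adjoint_mult[OF Gc[OF x] r] smult_smult_mat dc by (rule one_smult_mat)
    have xy: "x * y = 1\<^sub>m (2 * n)" by (rule mat_mult_left_right_inverse[OF y Gc[OF x] yx])
    \<comment> \<open>Factors are multiplicative, so the factor of y is read off from x y =
      1.\<close>
    have "?c \<cdot>\<^sub>m (y\<^sup>T * J_mat n * y) = J_mat n"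
      unfolding sim_form_prod[OF Gc[OF x] r y, symmetric] xy by (rule J1)
    then have "?d \<cdot>\<^sub>m (?c \<cdot>\<^sub>m (y\<^sup>T * J_mat n * y)) = ?d \<cdot>\<^sub>m J_mat n" by (rule arg_cong)
    then have "y\<^sup>T * J_mat n * y = ?d \<cdot>\<^sub>m J_mat n" unfolding smult_smult_mat dc one_smult_mat .
    then have "y \<in> carrier ?G" unfolding sim_group_carrier using y by blast
    with yx show ?thesis by auto
  qed
qed

lemma O_set_subset_sim_group: "(O_set n r :: 'p :: prime_card padic mat set) \<subseteq> carrier (sim_group n)"
proof
  fix g :: "'p padic mat" assume "g \<in> O_set n r"
  then have "g \<in> carrier_mat (2 * n) (2 * n)" "g\<^sup>T * J_mat n * g = (pp powi int r) \<cdot>\<^sub>m J_mat n"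
    unfolding O_set_def by simp_all
  then show "g \<in> carrier (sim_group n)" unfolding sim_group_carrier by blast
qed

lemma Sp_Zp_subset_sim_group: "Sp_Zp n \<subseteq> carrier (sim_group n)"
  using O_set_subset_sim_group[of n 0] unfolding O_set_eq Sp_Zp_eq .

lemma emb_mat_mult_sims:
  assumes "A \<in> integral_sims n a" "B \<in> integral_sims n b"
  shows "emb_mat A * emb_mat B = emb_mat (A * B)"
  by (rule emb.mat_hom_mult[OF integral_simsD(1)[OF assms(1)] integral_simsD(1)[OF assms(2)], symmetric])

lemma double_coset_eq:
  assumes X: "X \<in> integral_sims n r"
  shows "double_coset n (emb_mat X) =
    {emb_mat (U * X * V) | U V. U \<in> integral_sims n 0 \<and> V \<in> integral_sims n 0}"
proof -
  have eq: "emb_mat U * emb_mat X * emb_mat V = emb_mat (U * X * V)"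
    if "U \<in> integral_sims n 0" "V \<in> integral_sims n 0" for U V
    using emb_mat_mult_sims[OF that(1) X] emb_mat_mult_sims[OF integral_sims_mult[OF that(1) X] that(2)]
    by simp
  have "double_coset n (emb_mat X) =
      {emb_mat U * emb_mat X * emb_mat V | U V. U \<in> integral_sims n 0 \<and> V \<in> integral_sims n 0}"
    unfolding double_coset_def set_mult_def Sp_Zp_eq by auto
  also have "\<dots> = {emb_mat (U * X * V) | U V. U \<in> integral_sims n 0 \<and> V \<in> integral_sims n 0}"
    using eq by (intro Collect_cong) metis
  finally show ?thesis .
qed

section \<open>Openness of the cosets of K\<close>

lemma Zp_add: "x \<in> Zp \<Longrightarrow> y \<in> Zp \<Longrightarrow> x + y \<in> Zp"
  unfolding Zp_eq by (auto simp flip: to_fract_add)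

lemma Zp_zero: "0 \<in> Zp"
  unfolding Zp_eq by (metis to_fract_0 rangeI)

lemma Zp_sum: "(\<And>i. i \<in> I \<Longrightarrow> f i \<in> Zp) \<Longrightarrow> sum f I \<in> Zp"
  by (induction I rule: infinite_finite_induct) (auto intro: Zp_add Zp_zero)

lemma common_denominator:
  fixes F :: "'p :: prime_card padic set"
  assumes "finite F"
  shows "\<exists>s. \<forall>z\<in>F. pp ^ s * z \<in> Zp"
  using assms
proof induction
  case (insert z F)
  then obtain s where s: "\<forall>z\<in>F. pp ^ s * z \<in> Zp" by blast
  obtain t where t: "pp ^ t * z \<in> Zp" using padic_denominator by blast
  have "pp ^ (s + t) * y \<in> Zp" if "y \<in> insert z F" for y
  proof (cases "y = z")
    case True
    have "pp ^ s * (pp ^ t * z) \<in> Zp" by (rule Zp_mult[OF pp_power_in_Zp t])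
    then show ?thesis using True by (simp add: power_add mult.assoc)
  next
    case False
    then have "pp ^ t * (pp ^ s * y) \<in> Zp" using that s by (simp add: Zp_mult pp_power_in_Zp)
    then show ?thesis by (simp add: power_add ac_simps)
  qed
  then show ?case by blast
qed auto

text \<open>An element of the similitude group congruent to 1 modulo \<open>p\<close> has a unit similitude factor,
  hence factor 1: the factor is a power of \<open>p\<close>.\<close>

lemma congruent_one_in_Sp_Zp:
  fixes W :: "'p :: prime_card padic_int mat"
  assumes n: "n \<ge> 1" and W: "W \<in> carrier_mat (2 * n) (2 * n)"
    and u: "emb_mat (1\<^sub>m (2 * n) + \<pi> \<cdot>\<^sub>m W) \<in> carrier (sim_group n)"
  shows "emb_mat (1\<^sub>m (2 * n) + \<pi> \<cdot>\<^sub>m W) \<in> Sp_Zp n"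
proof -
  define U where "U = 1\<^sub>m (2 * n) + \<pi> \<cdot>\<^sub>m W"
  have U: "U \<in> carrier_mat (2 * n) (2 * n)" unfolding U_def using W by auto
  obtain t :: int where "(emb_mat U)\<^sup>T * J_mat n * emb_mat U = (pp powi t) \<cdot>\<^sub>m J_mat n"
    using u sim_group_carrier U_def by blast
  then have t: "emb_mat (U\<^sup>T * J_mat n * U) = (pp powi t) \<cdot>\<^sub>m J_mat n"
    unfolding emb_mat_form[OF U] .
  \<comment> \<open>The entry of J at (0, n) is 1, so c is the similitude factor of U, now seen as
    an element of Z_p.\<close>
  define c where "c = (U\<^sup>T * J_mat n * U) $$ (0, n)"
  have dims: "0 < 2 * n" "n < 2 * n" using n by auto
  have "to_fract c = emb_mat (U\<^sup>T * J_mat n * U) $$ (0, n)"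
    unfolding c_def using dims U by (intro index_map_mat(1)[symmetric]) auto
  also have "\<dots> = pp powi t" unfolding t using dims by (simp add: J_mat_index)
  finally have c: "to_fract c = pp powi t" .
  have colc: "col U i \<in> carrier_vec (2 * n)" for i using col_dim[of U i] U by auto
  have red_col: "map_vec red (col U i) = unit_vec (2 * n) i" if "i < 2 * n" for i
    using that W by (intro eq_vecI) (auto simp: U_def red.hom_add red.hom_mult)
  have "red c = sp_form n (map_vec red (col U 0)) (map_vec red (col U n))"
    unfolding c_def transpose_J_mult_index[OF U U dims] by (rule red.sp_form_hom[OF colc colc, symmetric])
  also have "\<dots> = 1"
    unfolding red_col[OF dims(1)] red_col[OF dims(2)] sp_form_unit_left[OF unit_vec_carrier dims(1)]
    using n by simp
  finally have red_c: "red c = 1" .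
  have "t = 0"
  proof (rule ccontr)
    assume "t \<noteq> 0"
    then consider "t > 0" | "t < 0" by linarith
    then show False
    proof cases
      case 1
      then have "to_fract c = to_fract (\<pi> ^ nat t)"
        unfolding c emb.hom_power to_fract_pi by (simp add: power_int_def)
      then have "c = \<pi> ^ nat t" by simp
      then have "red c = 0" using 1 by (simp add: red.hom_power)
      then show False using red_c by simp
    next
      case 2
      \<comment> \<open>A negative exponent would make p invertible in Z_p, which fails modulo
        p.\<close>
      have "to_fract (c * \<pi> ^ nat (- t)) = pp powi t * pp powi (- t)"
        using 2 by (simp add: c emb.hom_power to_fract_pi power_int_def)
      also have "\<dots> = to_fract 1" by (simp flip: power_int_add)
      finally have "c * \<pi> ^ nat (- t) = 1" by (simp only: to_fract_eq_iff)
      then have "red c * red \<pi> ^ nat (- t) = 1"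
        by (metis red.hom_mult red.hom_power red.hom_one)
      then show False using 2 by (simp add: power_0_left)
    qed
  qed
  then have "emb_mat (U\<^sup>T * J_mat n * U) = emb_mat (\<pi> ^ 0 \<cdot>\<^sub>m J_mat n)"
    unfolding t by (simp add: one_smult_mat emb.J_mat_hom)
  then have "U \<in> integral_sims n 0" using U unfolding emb_mat_inj integral_sims_def by blast
  then show ?thesis unfolding Sp_Zp_eq U_def by blast
qed

text \<open>For h close to g the quotient of h by g on the left is congruent to 1 modulo p, hence
  lies in K, and h lies in the coset gK.\<close>

lemma right_invariant_open:
  fixes S :: "'p :: prime_card padic mat set"
  assumes n: "n \<ge> 1" and S: "S \<subseteq> carrier (sim_group n)"
    and inv: "\<And>g k. g \<in> S \<Longrightarrow> k \<in> Sp_Zp n \<Longrightarrow> g * k \<in> S"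
  shows "openin (sim_topology n) S"
  unfolding openin_sim_topology padic_open_def
proof (intro conjI ballI S)
  interpret G: group "sim_group n :: 'p padic mat monoid" by (rule sim_group_group)
  fix g assume g: "g \<in> S"
  then have gG: "g \<in> carrier (sim_group n)" using S by blast
  define y where "y = inv\<^bsub>sim_group n\<^esub> g"
  have yG: "y \<in> carrier (sim_group n)" unfolding y_def using gG by simp
  have yg: "y * g = 1\<^sub>m (2 * n)" "g * y = 1\<^sub>m (2 * n)"
    using G.l_inv[OF gG] G.r_inv[OF gG] by (simp_all add: y_def)
  have gc: "g \<in> carrier_mat (2 * n) (2 * n)" and yc: "y \<in> carrier_mat (2 * n) (2 * n)"
    using gG yG sim_group_carrier by blast+
  \<comment> \<open>p^s clears the denominators of the inverse y of g. Nearness modulo p^(s+1) then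
    leaves one factor p after multiplication by y.\<close>
  obtain s where s: "\<forall>z\<in>(\<lambda>(i, k). y $$ (i, k)) ` ({..<2 * n} \<times> {..<2 * n}). pp ^ s * z \<in> Zp"
    using common_denominator[of "(\<lambda>(i, k). y $$ (i, k)) ` ({..<2 * n} \<times> {..<2 * n})"] by auto
  have "h \<in> S" if hG: "h \<in> carrier (sim_group n)"
    and el: "elements_mat (h - g) \<subseteq> (\<lambda>z. pp ^ Suc s * z) ` Zp" for h
  proof -
    have hc: "h \<in> carrier_mat (2 * n) (2 * n)" using hG sim_group_carrier by blast
    have hgc: "h - g \<in> carrier_mat (2 * n) (2 * n)" using gc by (rule minus_carrier_mat)
    define w where "w = y * (h - g)"
    have wc: "w \<in> carrier_mat (2 * n) (2 * n)" unfolding w_def using yc hgc by (rule mult_carrier_mat)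
    have "w $$ (i, j) \<in> range (\<lambda>c. pp * to_fract c)" if ij: "i < 2 * n" "j < 2 * n" for i j
    proof -
      have "\<forall>k. \<exists>z. k < 2 * n \<longrightarrow> z \<in> Zp \<and> (h - g) $$ (k, j) = pp ^ Suc s * z"
        using el elements_matI[OF hgc _ ij(2) refl] by blast
      then obtain z where z: "\<And>k. k < 2 * n \<Longrightarrow> z k \<in> Zp \<and> (h - g) $$ (k, j) = pp ^ Suc s * z k"
        by metis
      have "w $$ (i, j) = (\<Sum>k<2 * n. y $$ (i, k) * (h - g) $$ (k, j))"
        unfolding w_def using ij yc hgc by (simp add: scalar_prod_def lessThan_atLeast0 del: index_minus_mat)
      also have "\<dots> = (\<Sum>k<2 * n. pp * ((pp ^ s * y $$ (i, k)) * z k))"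
        using z by (intro sum.cong) (auto simp: ac_simps)
      also have "\<dots> = pp * (\<Sum>k<2 * n. (pp ^ s * y $$ (i, k)) * z k)"
        by (rule sum_distrib_left[symmetric])
      finally have "w $$ (i, j) = pp * (\<Sum>k<2 * n. (pp ^ s * y $$ (i, k)) * z k)" .
      moreover have "(\<Sum>k<2 * n. (pp ^ s * y $$ (i, k)) * z k) \<in> Zp"
        using s z ij by (rule_tac Zp_sum, rule_tac Zp_mult) auto
      then obtain c where "(\<Sum>k<2 * n. (pp ^ s * y $$ (i, k)) * z k) = to_fract c"
        unfolding Zp_eq by blast
      ultimately show ?thesis by simp
    qed
    then obtain W where W: "W \<in> carrier_mat (2 * n) (2 * n)" "w = map_mat (\<lambda>c. pp * to_fract c) W"
      using integral_matrix_entries[OF _ wc, of "\<lambda>c. pp * to_fract c"] by blast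
    have "y * h = y * (g + (h - g))" using gc hc by (intro arg_cong[of _ _ "(*) y"] eq_matI) auto
    also have "\<dots> = 1\<^sub>m (2 * n) + w" unfolding w_def by (simp only: mult_add_distrib_mat[OF yc gc hgc] yg)
    also have "\<dots> = emb_mat (1\<^sub>m (2 * n) + \<pi> \<cdot>\<^sub>m W)"
      unfolding W(2) using W(1) by (intro eq_matI) (auto simp: to_fract_pi)
    finally have yh: "y * h = emb_mat (1\<^sub>m (2 * n) + \<pi> \<cdot>\<^sub>m W)" .
    have "y * h \<in> carrier (sim_group n)" using G.m_closed[OF yG hG] by simp
    then have "y * h \<in> Sp_Zp n" unfolding yh by (rule congruent_one_in_Sp_Zp[OF n W(1)])
    then have "g * (y * h) \<in> S" by (rule inv[OF g])
    also have "g * (y * h) = h"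
      unfolding assoc_mult_mat[OF gc yc hc, symmetric] yg(2) by (rule left_mult_one_mat[OF hc])
    finally show ?thesis .
  qed
  then show "\<exists>m. \<forall>h\<in>carrier (sim_group n).
      elements_mat (h - g) \<subseteq> (\<lambda>z. pp ^ m * z) ` Zp \<longrightarrow> h \<in> S" by blast
qed

section \<open>Compactness of O_n(p^r)\<close>

definition mat_cong :: "nat \<Rightarrow> nat \<Rightarrow> 'p :: prime_card padic_int mat \<Rightarrow> 'p padic_int mat \<Rightarrow> bool" where
  "mat_cong N m A B \<longleftrightarrow> (\<forall>i<N. \<forall>j<N. residue (A $$ (i, j)) m = residue (B $$ (i, j)) m)"

lemma mat_cong_trans: "mat_cong N m A B \<Longrightarrow> mat_cong N m B C \<Longrightarrow> mat_cong N m A C"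
  unfolding mat_cong_def by metis

lemma residue_eq_iff_dvd:
  fixes x y :: "'p :: prime_card padic_int"
  shows "residue x m = residue y m \<longleftrightarrow> \<pi> ^ m dvd x - y"
proof -
  have "residue (x - y) m = 0 \<longleftrightarrow> residue x m mod int CARD('p) ^ m = residue y m mod int CARD('p) ^ m"
    unfolding minus_padic_int.rep_eq by (simp only: mod_eq_dvd_iff dvd_eq_mod_eq_0)
  then show ?thesis unfolding pi_power_dvd_iff by simp
qed

lemma sp_form_cong:
  fixes v :: "'p :: prime_card padic_int vec"
  assumes c: "v \<in> carrier_vec (2 * n)" "v' \<in> carrier_vec (2 * n)" "w \<in> carrier_vec (2 * n)" "w' \<in> carrier_vec (2 * n)"
    and d: "\<And>i. i < 2 * n \<Longrightarrow> d dvd v $ i - v' $ i" "\<And>i. i < 2 * n \<Longrightarrow> d dvd w $ i - w' $ i"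
  shows "d dvd sp_form n v w - sp_form n v' w'"
proof -
  have "sp_form n v w - sp_form n v' w' = sp_form n (v - v') w - sp_form n (w - w') v'"
    using c sp_form_swap[of n w v'] sp_form_swap[of n w' v'] by (simp add: sp_form_diff_left)
  moreover have "d dvd sp_form n (v - v') w" "d dvd sp_form n (w - w') v'"
    using c d by (auto intro!: dvd_sp_form)
  ultimately show ?thesis by (simp add: dvd_diff)
qed

text \<open>Level k of the limit is read from A k. Since the limit and A k agree modulo p^k, the
  defining equation holds for the limit modulo every p^k, hence exactly.\<close>

lemma integral_sims_limit:
  fixes A :: "nat \<Rightarrow> 'p :: prime_card padic_int mat"
  assumes A: "\<And>m. A m \<in> integral_sims n r" and cong: "\<And>m. mat_cong (2 * n) m (A m) (A (Suc m))"
  shows "\<exists>L\<in>integral_sims n r. \<forall>m. mat_cong (2 * n) m L (A m)"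
proof -
  define x where "x i j k = residue (A k $$ (i, j)) k" for i j k
  define L where "L = mat (2 * n) (2 * n) (\<lambda>(i, j). Abs_padic_int (x i j) :: 'p padic_int)"
  have Lc: "L \<in> carrier_mat (2 * n) (2 * n)" by (simp add: L_def)
  have "residue (L $$ (i, j)) k = residue (A k $$ (i, j)) k" if ij: "i < 2 * n" "j < 2 * n" for i j k
  proof -
    have "x i j k = x i j (Suc k) mod int CARD('p) ^ k" for k
      using cong[of k] residue_mod_le[of k "Suc k" "A (Suc k) $$ (i, j)"] ij
      by (simp add: mat_cong_def x_def)
    then have "residue (Abs_padic_int (x i j) :: 'p padic_int) = x i j"
      by (intro Abs_padic_int_inverse CollectI allI)
    then show ?thesis using ij by (simp add: L_def x_def)
  qed
  then have LA: "mat_cong (2 * n) m L (A m)" for m by (simp add: mat_cong_def)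
  have "sp_form n (col L i) (col L j) = \<pi> ^ r * J_mat n $$ (i, j)" if ij: "i < 2 * n" "j < 2 * n" for i j
  proof -
    have "\<pi> ^ k dvd sp_form n (col L i) (col L j) - \<pi> ^ r * J_mat n $$ (i, j)" for k
    proof -
      note Ac = integral_simsD(1)[OF A[of k]]
      have "sp_form n (col (A k) i) (col (A k) j) = \<pi> ^ r * J_mat n $$ (i, j)"
        using integral_simsD(2)[OF A[of k]] ij unfolding sim_form_iff[OF Ac] by blast
      moreover have "\<pi> ^ k dvd col L b $ a - col (A k) b $ a" if "a < 2 * n" "b < 2 * n" for a b
        using LA[of k] that Lc Ac unfolding mat_cong_def residue_eq_iff_dvd by simp
      moreover have "col L b \<in> carrier_vec (2 * n)" "col (A k) b \<in> carrier_vec (2 * n)" for b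
        using col_dim[of L b] col_dim[of "A k" b] Lc Ac by auto
      ultimately show ?thesis using ij by (metis sp_form_cong)
    qed
    then have "sp_form n (col L i) (col L j) - \<pi> ^ r * J_mat n $$ (i, j) = 0"
      by (rule not_all_pi_powers_dvd)
    then show ?thesis by simp
  qed
  then have "L \<in> integral_sims n r"
    using Lc sim_form_iff[OF Lc, of "\<pi> ^ r"] by (simp add: integral_sims_def)
  with LA show ?thesis by blast
qed

text \<open>A table of residues modulo p^m has finitely many possible values. The representatives
  are chosen inside S, so in the compactness proof they are again similitudes.\<close>

lemma finite_mat_cong_classes:
  fixes S :: "'p :: prime_card padic_int mat set"
  shows "\<exists>T. finite T \<and> T \<subseteq> S \<and> (\<forall>B\<in>S. \<exists>C\<in>T. mat_cong N m C B)"
proof -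
  define key where "key B = (\<lambda>(i, j) \<in> {..<N} \<times> {..<N}. residue (B $$ (i, j)) m)"
    for B :: "'p padic_int mat"
  have "key ` S \<subseteq> PiE ({..<N} \<times> {..<N}) (\<lambda>_. {0..<int CARD('p) ^ m})"
    unfolding key_def image_subset_iff restrict_PiE_iff
    using residue_range[where 'p = 'p] by (simp add: split_beta)
  moreover have "finite (PiE ({..<N} \<times> {..<N}) (\<lambda>_. {0..<int CARD('p) ^ m}))"
    by (intro finite_PiE) auto
  ultimately have "finite (key ` S)" by (rule finite_subset)
  from finite_subset_image[OF this order_refl]
  obtain T where T: "T \<subseteq> S" "finite T" "key ` S = key ` T" by blast
  have "\<exists>C\<in>T. mat_cong N m C B" if "B \<in> S" for B
  proof -
    have "key B \<in> key ` T" unfolding T(3)[symmetric] using that by (rule imageI)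
    then obtain C where C: "C \<in> T" "key B = key C" by (rule imageE)
    have "residue (C $$ (i, j)) m = residue (B $$ (i, j)) m" if "i < N" "j < N" for i j
      using fun_cong[OF C(2)[unfolded key_def], of "(i, j)"] that by simp
    with C(1) show ?thesis unfolding mat_cong_def by blast
  qed
  with T show ?thesis by blast
qed

lemma mat_cong_ball:
  fixes A B :: "'p :: prime_card padic_int mat"
  assumes "A \<in> carrier_mat N N" "B \<in> carrier_mat N N" "mat_cong N m A B"
  shows "elements_mat (emb_mat B - emb_mat A) \<subseteq> (\<lambda>z. pp ^ m * z) ` Zp"
proof
  fix z assume "z \<in> elements_mat (emb_mat B - emb_mat A)"
  then obtain i j where ij: "i < N" "j < N" "z = (emb_mat B - emb_mat A) $$ (i, j)"
    using assms(1) by (auto dest!: elements_matD)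
  have "residue (B $$ (i, j)) m = residue (A $$ (i, j)) m"
    using assms(3) ij by (simp add: mat_cong_def)
  then obtain c where c: "B $$ (i, j) - A $$ (i, j) = \<pi> ^ m * c"
    unfolding residue_eq_iff_dvd by blast
  have "z = to_fract (B $$ (i, j) - A $$ (i, j))" using ij assms(1,2) by simp
  also have "\<dots> = pp ^ m * to_fract c" unfolding c by (simp add: emb.hom_power to_fract_pi)
  finally show "z \<in> (\<lambda>z. pp ^ m * z) ` Zp" unfolding Zp_eq by blast
qed

text \<open>Koenig's lemma on the tree of residue classes modulo \<open>p ^ m\<close>.\<close>

lemma compactin_O_set: "compactin (sim_topology n) (O_set n r :: 'p :: prime_card padic mat set)"
  unfolding compactin_def
proof (intro conjI allI impI)
  show "O_set n r \<subseteq> topspace (sim_topology n :: 'p padic mat topology)"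
    unfolding topspace_sim_topology by (rule O_set_subset_sim_group)
  fix \<U> :: "'p padic mat set set"
  assume cover: "Ball \<U> (openin (sim_topology n)) \<and> O_set n r \<subseteq> \<Union>\<U>"
  define cls where "cls m A = {B \<in> integral_sims n r. mat_cong (2 * n) m A B}"
    for m and A :: "'p padic_int mat"
  \<comment> \<open>The infinite branch will run through classes that no finite subfamily
    covers.\<close>
  define bad where "bad m A \<longleftrightarrow> A \<in> integral_sims n r \<and> (\<forall>\<F>. finite \<F> \<longrightarrow> \<F> \<subseteq> \<U> \<longrightarrow> \<not> emb_mat ` cls m A \<subseteq> \<Union>\<F>)"
    for m A
  show "\<exists>\<F>. finite \<F> \<and> \<F> \<subseteq> \<U> \<and> O_set n r \<subseteq> \<Union>\<F>"
  proof (rule ccontr)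
    assume no: "\<nexists>\<F>. finite \<F> \<and> \<F> \<subseteq> \<U> \<and> O_set n r \<subseteq> \<Union>\<F>"
    have "O_set n r \<noteq> ({} :: 'p padic mat set)"
    proof
      assume e: "O_set n r = ({} :: 'p padic mat set)"
      have "\<exists>\<F>. finite \<F> \<and> \<F> \<subseteq> \<U> \<and> O_set n r \<subseteq> \<Union>\<F>"
        by (rule exI[of _ "{}"]) (simp add: e)
      with no show False by (rule notE)
    qed
    then obtain A0 :: "'p padic_int mat" where A0: "A0 \<in> integral_sims n r" unfolding O_set_eq by blast
    have "residue x 0 = 0" for x :: "'p padic_int"
      using residue_range[of x 0] by simp
    then have cls0: "cls 0 A0 = integral_sims n r" by (simp add: cls_def mat_cong_def)
    have "bad 0 A0" unfolding bad_def cls0 O_set_eq[symmetric] using A0 no by blast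
    \<comment> \<open>The class of A is exhausted by finitely many classes modulo p^(m+1); finite
      subfamilies covering each of these would combine to one covering the class.\<close>
    moreover have "\<exists>B. bad (Suc m) B \<and> mat_cong (2 * n) m A B" if bad: "bad m A" for m A
    proof (rule ccontr)
      assume nob: "\<nexists>B. bad (Suc m) B \<and> mat_cong (2 * n) m A B"
      obtain T where T: "finite T" "T \<subseteq> cls m A" "\<forall>B\<in>cls m A. \<exists>C\<in>T. mat_cong (2 * n) (Suc m) C B"
        using finite_mat_cong_classes[of "cls m A" "2 * n" "Suc m"] by blast
      have "\<exists>\<F>. finite \<F> \<and> \<F> \<subseteq> \<U> \<and> emb_mat ` cls (Suc m) C \<subseteq> \<Union>\<F>" if "C \<in> T" for C
      proof -
        have C: "C \<in> integral_sims n r" "mat_cong (2 * n) m A C"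
          using subsetD[OF T(2) that] by (simp_all add: cls_def)
        then have "\<not> bad (Suc m) C" using nob by blast
        then show ?thesis using C(1) unfolding bad_def by blast
      qed
      then obtain F where F: "\<And>C. C \<in> T \<Longrightarrow> finite (F C) \<and> F C \<subseteq> \<U> \<and> emb_mat ` cls (Suc m) C \<subseteq> \<Union>(F C)"
        by metis
      have "emb_mat ` cls m A \<subseteq> \<Union>(\<Union>C\<in>T. F C)"
      proof
        fix g assume "g \<in> emb_mat ` cls m A"
        then obtain B where B: "B \<in> cls m A" "g = emb_mat B" by blast
        obtain C where C: "C \<in> T" "mat_cong (2 * n) (Suc m) C B" using T(3) B(1) by blast
        have "B \<in> cls (Suc m) C" using B(1) C(2) unfolding cls_def by blast
        then show "g \<in> \<Union>(\<Union>C\<in>T. F C)" using F[OF C(1)] C(1) B(2) by blast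
      qed
      moreover have "finite (\<Union>C\<in>T. F C)" "(\<Union>C\<in>T. F C) \<subseteq> \<U>" using T(1) F by auto
      ultimately show False using bad unfolding bad_def by blast
    qed
    ultimately obtain A where A: "\<And>m. bad m (A m)" "\<And>m. mat_cong (2 * n) m (A m) (A (Suc m))"
      using dependent_nat_choice[of bad "\<lambda>m. mat_cong (2 * n) m"] by blast
    have As: "A m \<in> integral_sims n r" for m using A(1) unfolding bad_def by blast
    obtain L where L: "L \<in> integral_sims n r" "\<And>m. mat_cong (2 * n) m L (A m)"
      using integral_sims_limit[of A, OF As A(2)] by blast
    have "emb_mat L \<in> O_set n r" unfolding O_set_eq using L(1) by (rule imageI)
    then have "emb_mat L \<in> \<Union>\<U>" by (rule subsetD[OF conjunct2[OF cover]])
    then obtain U where U: "U \<in> \<U>" "emb_mat L \<in> U" by (rule UnionE)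
    have "padic_open n U" using bspec[OF conjunct1[OF cover] U(1)] unfolding openin_sim_topology .
    then have "\<forall>g\<in>U. \<exists>m. \<forall>h\<in>carrier (sim_group n).
        elements_mat (h - g) \<subseteq> (\<lambda>z. pp ^ m * z) ` Zp \<longrightarrow> h \<in> U"
      unfolding padic_open_def by (rule conjunct2)
    from bspec[OF this U(2)] obtain m where m: "\<And>h. h \<in> carrier (sim_group n) \<Longrightarrow>
        elements_mat (h - emb_mat L) \<subseteq> (\<lambda>z. pp ^ m * z) ` Zp \<Longrightarrow> h \<in> U"
      by blast
    \<comment> \<open>The open set U contains all members of the group congruent to L modulo p^m,
      hence the whole class of A m. A single member of the cover thus covers a bad class.\<close>
    have "emb_mat B \<in> U" if B: "B \<in> cls m (A m)" for B
    proof -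
      have Bs: "B \<in> integral_sims n r" and "mat_cong (2 * n) m (A m) B"
        using B by (simp_all add: cls_def)
      from L(2) this(2) have "mat_cong (2 * n) m L B" by (rule mat_cong_trans)
      note el = mat_cong_ball[OF integral_simsD(1)[OF L(1)] integral_simsD(1)[OF Bs] this]
      have "emb_mat B \<in> O_set n r" unfolding O_set_eq using Bs by (rule imageI)
      then have "emb_mat B \<in> carrier (sim_group n)" by (rule subsetD[OF O_set_subset_sim_group])
      then show ?thesis using el by (rule m)
    qed
    then have "emb_mat ` cls m (A m) \<subseteq> \<Union>{U}" by blast
    moreover have "finite {U}" "{U} \<subseteq> \<U>" using U(1) by auto
    ultimately show False using A(1)[of m] unfolding bad_def by blast
  qed
qed

lemma Sp_Zp_mult:
  assumes k: "k \<in> Sp_Zp n" and l: "l \<in> Sp_Zp n"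
  shows "k * l \<in> Sp_Zp n"
proof -
  obtain A where A: "k = emb_mat A" "A \<in> integral_sims n 0" using k unfolding Sp_Zp_eq by (rule imageE)
  obtain B where B: "l = emb_mat B" "B \<in> integral_sims n 0" using l unfolding Sp_Zp_eq by (rule imageE)
  have "A * B \<in> integral_sims n 0" using integral_sims_mult[OF A(2) B(2)] by simp
  then show ?thesis unfolding A(1) B(1) emb_mat_mult_sims[OF A(2) B(2)] Sp_Zp_eq by (rule imageI)
qed

lemma Sp_Zp_inverse:
  assumes "k \<in> Sp_Zp n"
  shows "\<exists>l\<in>Sp_Zp n. k * l = 1\<^sub>m (2 * n) \<and> l * k = 1\<^sub>m (2 * n)"
proof -
  obtain A where A: "A \<in> integral_sims n 0" "k = emb_mat A" using assms unfolding Sp_Zp_eq by blast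
  obtain B where B: "B \<in> integral_sims n 0" "A * B = 1\<^sub>m (2 * n)" "B * A = 1\<^sub>m (2 * n)"
    using integral_sims_inverse[OF A(1)] by blast
  have "k * emb_mat B = 1\<^sub>m (2 * n)" "emb_mat B * k = 1\<^sub>m (2 * n)"
    unfolding A(2) emb_mat_mult_sims[OF A(1) B(1)] emb_mat_mult_sims[OF B(1) A(1)] B(2,3)
    by (rule emb.mat_hom_one)+
  then show ?thesis using B(1) unfolding Sp_Zp_eq by blast
qed

lemma sim_group_carrier_mat: "g \<in> carrier (sim_group n) \<Longrightarrow> g \<in> carrier_mat (2 * n) (2 * n)"
  unfolding sim_group_carrier by blast

lemma Sp_Zp_carrier_mat: "g \<in> Sp_Zp n \<Longrightarrow> g \<in> carrier_mat (2 * n) (2 * n)"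
  unfolding Sp_Zp_def by blast

text \<open>Both S and its complement are unions of cosets gK, so S is open and closed. This gives
  local constancy and, inside the compact O_n(p^r), a compact support.\<close>

lemma indicator_in_hecke_algebra:
  fixes S :: "'p :: prime_card padic mat set"
  assumes n: "n \<ge> 1" and S: "S \<subseteq> O_set n r"
    and inv: "\<And>g k. g \<in> S \<Longrightarrow> k \<in> Sp_Zp n \<Longrightarrow> k * g \<in> S" "\<And>g k. g \<in> S \<Longrightarrow> k \<in> Sp_Zp n \<Longrightarrow> g * k \<in> S"
  shows "(indicator S :: _ \<Rightarrow> real) \<in> hecke_algebra n"
proof -
  let ?G = "carrier (sim_group n) :: 'p padic mat set"
  interpret G: group "sim_group n :: 'p padic mat monoid" by (rule sim_group_group)
  note closed = G.m_closed[unfolded sim_group_simps]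
  have SG: "S \<subseteq> ?G" using S O_set_subset_sim_group by blast
  have right: "g \<in> S" if g: "g \<in> ?G" and k: "k \<in> Sp_Zp n" and gk: "g * k \<in> S" for g k
  proof -
    obtain l where l: "l \<in> Sp_Zp n" "k * l = 1\<^sub>m (2 * n)" using Sp_Zp_inverse[OF k] by blast
    note gc = sim_group_carrier_mat[OF g]
    have "g * k * l = g"
      unfolding assoc_mult_mat[OF gc Sp_Zp_carrier_mat[OF k] Sp_Zp_carrier_mat[OF l(1)]] l(2)
      by (rule right_mult_one_mat[OF gc])
    then show ?thesis using inv(2)[OF gk l(1)] by simp
  qed
  have left: "g \<in> S" if g: "g \<in> ?G" and k: "k \<in> Sp_Zp n" and kg: "k * g \<in> S" for g k
  proof -
    obtain l where l: "l \<in> Sp_Zp n" "l * k = 1\<^sub>m (2 * n)" using Sp_Zp_inverse[OF k] by blast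
    note gc = sim_group_carrier_mat[OF g]
    have "l * (k * g) = g"
      unfolding assoc_mult_mat[OF Sp_Zp_carrier_mat[OF l(1)] Sp_Zp_carrier_mat[OF k] gc, symmetric] l(2)
      by (rule left_mult_one_mat[OF gc])
    then show ?thesis using inv(1)[OF kg l(1)] by simp
  qed
  have opS: "openin (sim_topology n) S"
    by (rule right_invariant_open[OF n SG inv(2)])
  \<comment> \<open>If gk lies in S, then so does g, by multiplying with the inverse of k; the
    complement is therefore invariant too.\<close>
  have opC: "openin (sim_topology n) (?G - S)"
  proof (rule right_invariant_open[OF n])
    fix g k :: "'p padic mat" assume g: "g \<in> ?G - S" and k: "k \<in> Sp_Zp n"
    have gG: "g \<in> ?G" and gS: "g \<notin> S" using g by simp_all
    have "g * k \<in> ?G" by (rule closed[OF gG subsetD[OF Sp_Zp_subset_sim_group k]])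
    moreover have "g * k \<notin> S" using right[OF gG k] gS by blast
    ultimately show "g * k \<in> ?G - S" by (rule DiffI)
  qed blast
  have cl: "closedin (sim_topology n) S"
    unfolding closedin_def topspace_sim_topology using SG opC by blast
  have supp: "{x. (indicator S x :: real) \<noteq> 0} = S" by (auto simp: indicator_def)
  have "compactin (sim_topology n) (sim_topology n closure_of {x. (indicator S x :: real) \<noteq> 0})"
    unfolding supp closure_of_closedin[OF cl] using compactin_O_set S cl by (rule closed_compactin)
  moreover have "\<exists>U. openin (sim_topology n) U \<and> x \<in> U \<and> (\<forall>y\<in>U. (indicator S y :: real) = indicator S x)"
    if "x \<in> ?G" for x
  proof (cases "x \<in> S")
    case True
    then show ?thesis using opS by (intro exI[of _ S]) auto
  next
    case False
    then show ?thesis using opC that by (intro exI[of _ "?G - S"]) auto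
  qed
  moreover have "(indicator S (k * x * l) :: real) = indicator S x"
    if k: "k \<in> Sp_Zp n" and l: "l \<in> Sp_Zp n" and x: "x \<in> ?G" for k l x
  proof -
    have kx: "k * x \<in> ?G" by (rule closed[OF subsetD[OF Sp_Zp_subset_sim_group k] x])
    have "k * x * l \<in> S \<longleftrightarrow> x \<in> S"
    proof
      assume "x \<in> S"
      then show "k * x * l \<in> S" by (rule inv(2)[OF inv(1)[OF _ k] l])
    next
      assume "k * x * l \<in> S"
      then show "x \<in> S" by (rule left[OF x k right[OF kx l]])
    qed
    then show ?thesis by (simp only: indicator_def)
  qed
  moreover have "(indicator S x :: real) \<in> \<int>" for x
    unfolding indicator_def by simp
  moreover have "(indicator S x :: real) = 0" if "x \<notin> ?G" for x
    using contra_subsetD[OF SG that] unfolding indicator_def by simp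
  ultimately show ?thesis unfolding hecke_algebra_def sim_group_simps by blast
qed

section \<open>Convolution\<close>

text \<open>An integral quotient is a matrix Z with X = Y Z. Cancellation gives Z the factor p, so
  the condition is divisibility of X by Y, which is visible modulo p.\<close>

lemma integral_quotient_iff:
  fixes X Y :: "'p :: prime_card padic_int mat"
  assumes Y: "Y \<in> integral_sims n 1" and X: "X \<in> integral_sims n 2"
  shows "inv\<^bsub>sim_group n\<^esub> (emb_mat Y) * emb_mat X \<in> O_set n 1 \<longleftrightarrow> red_lattice X \<subseteq> red_lattice Y"
proof -
  interpret G: group "sim_group n :: 'p padic mat monoid" by (rule sim_group_group)
  let ?G = "carrier (sim_group n) :: 'p padic mat set"
  have emb_G: "emb_mat A \<in> ?G" if "A \<in> integral_sims n r" for A and r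
    using O_set_subset_sim_group[of n r] imageI[OF that, of emb_mat] unfolding O_set_eq by (rule subsetD)
  note yG = emb_G[OF Y] and xG = emb_G[OF X]
  have quot: "inv\<^bsub>sim_group n\<^esub> (emb_mat Y) * emb_mat X = emb_mat Z \<longleftrightarrow> X = Y * Z"
    if Z: "Z \<in> integral_sims n 1" for Z
  proof -
    have "inv\<^bsub>sim_group n\<^esub> (emb_mat Y) \<otimes>\<^bsub>sim_group n\<^esub> emb_mat X = emb_mat Z \<longleftrightarrow>
        emb_mat X = emb_mat Y \<otimes>\<^bsub>sim_group n\<^esub> emb_mat Z"
      using G.inv_solve_left'[OF emb_G[OF Z] yG xG] by (simp only: eq_commute)
    then show ?thesis
      unfolding sim_group_simps emb_mat_mult_sims[OF Y Z] emb_mat_inj .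
  qed
  have "inv\<^bsub>sim_group n\<^esub> (emb_mat Y) * emb_mat X \<in> O_set n 1 \<longleftrightarrow> (\<exists>Z\<in>integral_sims n 1. X = Y * Z)"
  proof
    assume "inv\<^bsub>sim_group n\<^esub> (emb_mat Y) * emb_mat X \<in> O_set n 1"
    then obtain Z where Z: "inv\<^bsub>sim_group n\<^esub> (emb_mat Y) * emb_mat X = emb_mat Z" "Z \<in> integral_sims n 1"
      unfolding O_set_eq by (rule imageE)
    then show "\<exists>Z\<in>integral_sims n 1. X = Y * Z" using quot[OF Z(2)] by (intro bexI[of _ Z]) simp_all
  next
    assume "\<exists>Z\<in>integral_sims n 1. X = Y * Z"
    then obtain Z where Z: "Z \<in> integral_sims n 1" "X = Y * Z" by (rule bexE)
    have "inv\<^bsub>sim_group n\<^esub> (emb_mat Y) * emb_mat X = emb_mat Z" by (rule iffD2[OF quot[OF Z(1)] Z(2)])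
    then show "inv\<^bsub>sim_group n\<^esub> (emb_mat Y) * emb_mat X \<in> O_set n 1"
      unfolding O_set_eq using Z(1) by (rule image_eqI)
  qed
  also have "\<dots> \<longleftrightarrow> (\<exists>Z\<in>carrier_mat (2 * n) (2 * n). X = Y * Z)"
  proof
    assume "\<exists>Z\<in>carrier_mat (2 * n) (2 * n). X = Y * Z"
    then obtain Z where Z: "Z \<in> carrier_mat (2 * n) (2 * n)" "X = Y * Z" by (rule bexE)
    have "Y * Z \<in> integral_sims n (1 + 1)" using X unfolding Z(2) by (simp add: numeral_2_eq_2)
    from integral_sims_cancel[OF Y Z(1) this] show "\<exists>Z\<in>integral_sims n 1. X = Y * Z"
      using Z(2) by (intro bexI[of _ Z])
  next
    assume "\<exists>Z\<in>integral_sims n 1. X = Y * Z"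
    then show "\<exists>Z\<in>carrier_mat (2 * n) (2 * n). X = Y * Z" using integral_simsD(1) by blast
  qed
  also have "\<dots> \<longleftrightarrow> red_lattice X \<subseteq> red_lattice Y"
    by (rule left_divisible_iff_red[OF Y integral_simsD(1)[OF X]])
  finally show ?thesis .
qed

text \<open>The cosets are open, hence Borel, and left invariance gives them the volume of
  K.\<close>

lemma haar_coset:
  fixes \<mu> :: "'p :: prime_card padic mat measure"
  assumes n: "n \<ge> 1" and \<mu>: "normalized_haar n \<mu>" and g: "g \<in> carrier (sim_group n)"
  shows "(\<lambda>k. g * k) ` Sp_Zp n \<in> sets \<mu>" "emeasure \<mu> ((\<lambda>k. g * k) ` Sp_Zp n) = 1"
proof -
  let ?G = "carrier (sim_group n) :: 'p padic mat set"
  interpret G: group "sim_group n :: 'p padic mat monoid" by (rule sim_group_group)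
  have open_sets: "S \<in> sets \<mu>" if "openin (sim_topology n) S" for S
    using \<mu> that unfolding normalized_haar_def by (auto intro: sigma_sets.Basic)
  have "openin (sim_topology n) (Sp_Zp n :: 'p padic mat set)"
    by (rule right_invariant_open[OF n Sp_Zp_subset_sim_group Sp_Zp_mult])
  then have Ks: "Sp_Zp n \<in> sets \<mu>" by (rule open_sets)
  have eq: "g <#\<^bsub>sim_group n\<^esub> Sp_Zp n = (\<lambda>k. g * k) ` Sp_Zp n"
    unfolding l_coset_def by auto
  have "emeasure \<mu> (g <#\<^bsub>sim_group n\<^esub> Sp_Zp n) = emeasure \<mu> (Sp_Zp n)"
    using \<mu> g Ks unfolding normalized_haar_def by blast
  also have "\<dots> = 1" using \<mu> unfolding normalized_haar_def by blast
  finally show "emeasure \<mu> ((\<lambda>k. g * k) ` Sp_Zp n) = 1" unfolding eq .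
  have "openin (sim_topology n) ((\<lambda>k. g * k) ` Sp_Zp n)"
  proof (rule right_invariant_open[OF n])
    show "(\<lambda>k. g * k) ` Sp_Zp n \<subseteq> ?G"
    proof (rule image_subsetI)
      fix k :: "'p padic mat" assume "k \<in> Sp_Zp n"
      from G.m_closed[OF g subsetD[OF Sp_Zp_subset_sim_group this]] show "g * k \<in> ?G" by simp
    qed
    fix h k :: "'p padic mat" assume h: "h \<in> (\<lambda>k. g * k) ` Sp_Zp n" and k: "k \<in> Sp_Zp n"
    obtain l where l: "h = g * l" "l \<in> Sp_Zp n" using h by (rule imageE)
    have "h * k = g * (l * k)"
      unfolding l(1) by (rule assoc_mult_mat[OF sim_group_carrier_mat[OF g] Sp_Zp_carrier_mat[OF l(2)] Sp_Zp_carrier_mat[OF k]])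
    then show "h * k \<in> (\<lambda>k. g * k) ` Sp_Zp n" using Sp_Zp_mult[OF l(2) k] by (rule image_eqI)
  qed
  then show "(\<lambda>k. g * k) ` Sp_Zp n \<in> sets \<mu>" by (rule open_sets)
qed

text \<open>Each Lagrangian accounts for one coset of K, hence for volume 1: the bridge from the
  integral to counting.\<close>

lemma sims_with_red_lattice:
  fixes A :: "'p :: prime_card padic_int mat"
  assumes A: "A \<in> integral_sims n 1"
  shows "emb_mat ` {Y \<in> integral_sims n 1. red_lattice Y = red_lattice A} = (\<lambda>k. emb_mat A * k) ` Sp_Zp n"
proof (intro equalityI subsetI)
  fix y assume "y \<in> emb_mat ` {Y \<in> integral_sims n 1. red_lattice Y = red_lattice A}"
  then obtain Y where Y: "Y \<in> integral_sims n 1" "red_lattice A = red_lattice Y" "y = emb_mat Y" by auto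
  then obtain Z where Z: "Z \<in> integral_sims n 0" "Y = A * Z"
    using red_lattice_eq_iff[OF A Y(1)] by blast
  have "y = emb_mat A * emb_mat Z" unfolding Y(3) Z(2) by (rule emb_mat_mult_sims[OF A Z(1), symmetric])
  then show "y \<in> (\<lambda>k. emb_mat A * k) ` Sp_Zp n"
    unfolding Sp_Zp_eq using imageI[OF Z(1)] by (rule image_eqI)
next
  fix y assume "y \<in> (\<lambda>k. emb_mat A * k) ` Sp_Zp n"
  then obtain Z where Z: "Z \<in> integral_sims n 0" "y = emb_mat A * emb_mat Z" unfolding Sp_Zp_eq by auto
  have AZ: "A * Z \<in> integral_sims n 1" using integral_sims_mult[OF A Z(1)] by simp
  have "red_lattice A = red_lattice (A * Z)" using red_lattice_eq_iff[OF A AZ] Z(1) by blast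
  moreover have "y = emb_mat (A * Z)" unfolding Z(2) by (rule emb_mat_mult_sims[OF A Z(1)])
  ultimately show "y \<in> emb_mat ` {Y \<in> integral_sims n 1. red_lattice Y = red_lattice A}"
    using AZ by (intro image_eqI[of _ _ "A * Z"]) auto
qed

text \<open>The cosets \<open>y K\<close> contributing to the convolution at \<open>x\<close> correspond to the Lagrangian
  subspaces of \<open>F\<^sub>p\<^sup>2\<^sup>n\<close> containing the image of \<open>x\<close> modulo \<open>p\<close>.\<close>

lemma convolution_O_set:
  fixes \<mu> :: "'p :: prime_card padic mat measure"
  assumes n: "n \<ge> 1" and \<mu>: "normalized_haar n \<mu>" and X: "X \<in> integral_sims n 2"
  shows "convolution n \<mu> (indicator (O_set n 1)) (indicator (O_set n 1)) (emb_mat X) =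
    real (card {L \<in> lagrangians n (carrier_vec (2 * n)). red_lattice X \<subseteq> L})"
proof -
  let ?C = "carrier_vec (2 * n) :: 'p mod_ring vec set"
  define \<Lambda> where "\<Lambda> = {L \<in> lagrangians n ?C. red_lattice X \<subseteq> L}"
  define F where "F L = emb_mat ` {Y \<in> integral_sims n 1. red_lattice Y = L}"
    for L :: "'p mod_ring vec set"
  have xG: "emb_mat X \<in> carrier (sim_group n)"
    using O_set_subset_sim_group[of n 2] imageI[OF X, of emb_mat] unfolding O_set_eq by (rule subsetD)
  have F: "F L \<in> sets \<mu> \<and> emeasure \<mu> (F L) = 1" if L: "L \<in> \<Lambda>" for L
  proof -
    have "L \<in> lagrangians n ?C" using L by (simp add: \<Lambda>_def)
    from red_lattice_surj[OF this] obtain A where A: "A \<in> integral_sims n 1" "red_lattice A = L"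
      by (rule bexE)
    have "emb_mat A \<in> carrier (sim_group n)"
      using O_set_subset_sim_group[of n 1] imageI[OF A(1), of emb_mat] unfolding O_set_eq by (rule subsetD)
    then show ?thesis
      unfolding F_def A(2)[symmetric] sims_with_red_lattice[OF A(1)] using haar_coset[OF n \<mu>] by blast
  qed
  have fin: "finite \<Lambda>"
    unfolding \<Lambda>_def by (rule finite_subset[OF _ finite_lagrangians[of n ?C]]) (auto simp: subspace_vec_def)
  have disj: "disjoint_family_on F \<Lambda>"
    unfolding disjoint_family_on_def F_def by (auto simp: emb_mat_inj)
  \<comment> \<open>The integrand is the indicator function of S, so the convolution is the volume
    of S, a disjoint union of one coset per Lagrangian.\<close>
  define S where "S = {y \<in> O_set n 1. inv\<^bsub>sim_group n\<^esub> y * emb_mat X \<in> O_set n 1}"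
  have S: "S = (\<Union>L\<in>\<Lambda>. F L)"
  proof (intro equalityI subsetI)
    fix y assume "y \<in> S"
    then have y: "y \<in> O_set n 1" "inv\<^bsub>sim_group n\<^esub> y * emb_mat X \<in> O_set n 1" by (simp_all add: S_def)
    from y(1) obtain Y where Y: "y = emb_mat Y" "Y \<in> integral_sims n 1" unfolding O_set_eq by (rule imageE)
    have "red_lattice X \<subseteq> red_lattice Y" using y(2) unfolding Y(1) integral_quotient_iff[OF Y(2) X] .
    then have "red_lattice Y \<in> \<Lambda>" using red_lattice_lagrangian[OF Y(2)] by (simp add: \<Lambda>_def)
    moreover have "y \<in> F (red_lattice Y)" unfolding F_def Y(1) using Y(2) by (intro imageI) simp
    ultimately show "y \<in> (\<Union>L\<in>\<Lambda>. F L)" by (rule UN_I)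
  next
    fix y assume "y \<in> (\<Union>L\<in>\<Lambda>. F L)"
    then obtain L where L: "L \<in> \<Lambda>" "y \<in> F L" by (rule UN_E)
    then obtain Y where Y: "y = emb_mat Y" "Y \<in> integral_sims n 1" "red_lattice Y = L"
      unfolding F_def by auto
    have "red_lattice X \<subseteq> red_lattice Y" using L(1) Y(3) by (simp add: \<Lambda>_def)
    then have "inv\<^bsub>sim_group n\<^esub> y * emb_mat X \<in> O_set n 1"
      unfolding Y(1) integral_quotient_iff[OF Y(2) X] .
    moreover have "y \<in> O_set n 1" unfolding Y(1) O_set_eq using Y(2) by (rule imageI)
    ultimately show "y \<in> S" by (simp add: S_def)
  qed
  have Ss: "S \<in> sets \<mu>" unfolding S using F fin by (intro sets.finite_UN) auto
  have "emeasure \<mu> S = (\<Sum>L\<in>\<Lambda>. emeasure \<mu> (F L))"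
    unfolding S using F fin disj by (intro sum_emeasure[symmetric]) auto
  also have "\<dots> = (\<Sum>L\<in>\<Lambda>. 1)" using F by (intro sum.cong) auto
  finally have emS: "emeasure \<mu> S = of_nat (card \<Lambda>)" by simp
  have integrand: "indicator (O_set n 1) y * indicator (O_set n 1) (inv\<^bsub>sim_group n\<^esub> y * emb_mat X)
      = (indicator S y :: real)" for y
    by (simp add: S_def indicator_def)
  have "convolution n \<mu> (indicator (O_set n 1)) (indicator (O_set n 1)) (emb_mat X) =
      (\<integral>y. indicator S y \<partial>\<mu>)"
    unfolding convolution_def sim_group_simps integrand using xG by (rule if_P)
  also have "\<dots> = measure \<mu> S"
    using Ss sets.sets_into_space[OF Ss] by (simp add: Int_absorb2)
  also have "\<dots> = real (card \<Lambda>)" unfolding measure_def emS by simp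
  finally show ?thesis unfolding \<Lambda>_def .
qed

text \<open>If y and its quotient into x are both integral of factor p, their product x is integral
  of factor p^2.\<close>

lemma convolution_O_set_outside:
  fixes x :: "'p :: prime_card padic mat"
  assumes x: "x \<notin> O_set n 2"
  shows "convolution n \<mu> (indicator (O_set n 1)) (indicator (O_set n 1)) x = 0"
proof (cases "x \<in> carrier (sim_group n)")
  case False
  then show ?thesis by (simp add: convolution_def)
next
  case True
  interpret G: group "sim_group n :: 'p padic mat monoid" by (rule sim_group_group)
  have "inv\<^bsub>sim_group n\<^esub> y * x \<notin> O_set n 1" if y: "y \<in> O_set n 1" for y
  proof
    assume z: "inv\<^bsub>sim_group n\<^esub> y * x \<in> O_set n 1"
    obtain Y where Y: "y = emb_mat Y" "Y \<in> integral_sims n 1" using y unfolding O_set_eq by (rule imageE)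
    obtain Z where Z: "inv\<^bsub>sim_group n\<^esub> y * x = emb_mat Z" "Z \<in> integral_sims n 1"
      using z unfolding O_set_eq by (rule imageE)
    have yG: "y \<in> carrier (sim_group n)" and zG: "emb_mat Z \<in> carrier (sim_group n)"
      using y z O_set_subset_sim_group[of n 1] unfolding Z(1) by auto
    have "emb_mat Z = inv\<^bsub>sim_group n\<^esub> y \<otimes>\<^bsub>sim_group n\<^esub> x" unfolding sim_group_simps Z(1) ..
    then have "x = y \<otimes>\<^bsub>sim_group n\<^esub> emb_mat Z"
      using G.inv_solve_left[OF zG yG True] by blast
    then have "x = emb_mat (Y * Z)" unfolding sim_group_simps Y(1) emb_mat_mult_sims[OF Y(2) Z(2)] .
    moreover have "Y * Z \<in> integral_sims n 2"
      using integral_sims_mult[OF Y(2) Z(2)] by (simp add: numeral_2_eq_2)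
    ultimately have "x \<in> O_set n 2" unfolding O_set_eq by (rule image_eqI)
    with x show False by (rule notE)
  qed
  then have "indicator (O_set n 1) y * indicator (O_set n 1) (inv\<^bsub>sim_group n\<^esub> y * x) = (0 :: real)" for y
    by (cases "y \<in> O_set n 1") simp_all
  note zero = this
  show ?thesis unfolding convolution_def sim_group_simps zero by simp
qed

section \<open>Double cosets\<close>

lemma double_coset_iff:
  "h \<in> double_coset n g \<longleftrightarrow> (\<exists>k\<in>Sp_Zp n. \<exists>l\<in>Sp_Zp n. h = k * g * l)"
  unfolding double_coset_def set_mult_def by simp

lemma double_coset_mult_subset:
  fixes g :: "'p :: prime_card padic mat"
  assumes g: "g \<in> carrier (sim_group n)" and k: "k \<in> Sp_Zp n" and l: "l \<in> Sp_Zp n"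
  shows "double_coset n (k * g * l) \<subseteq> double_coset n g"
proof
  fix h assume "h \<in> double_coset n (k * g * l)"
  then obtain k' l' where h: "h = k' * (k * g * l) * l'" and k': "k' \<in> Sp_Zp n" and l': "l' \<in> Sp_Zp n"
    unfolding double_coset_iff by blast
  interpret G: group "sim_group n :: 'p padic mat monoid" by (rule sim_group_group)
  note KG = subsetD[OF Sp_Zp_subset_sim_group]
  have "h = k' \<otimes>\<^bsub>sim_group n\<^esub> (k \<otimes>\<^bsub>sim_group n\<^esub> g \<otimes>\<^bsub>sim_group n\<^esub> l) \<otimes>\<^bsub>sim_group n\<^esub> l'"
    unfolding h sim_group_simps ..
  also have "\<dots> = (k' \<otimes>\<^bsub>sim_group n\<^esub> k) \<otimes>\<^bsub>sim_group n\<^esub> g \<otimes>\<^bsub>sim_group n\<^esub> (l \<otimes>\<^bsub>sim_group n\<^esub> l')"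
    by (simp only: G.m_assoc G.m_closed KG[OF k] KG[OF l] KG[OF k'] KG[OF l'] g)
  finally have "h = (k' * k) * g * (l * l')" unfolding sim_group_simps .
  then show "h \<in> double_coset n g"
    unfolding double_coset_iff using Sp_Zp_mult[OF k' k] Sp_Zp_mult[OF l l'] by blast
qed

text \<open>The inclusion just shown, applied once to k and l and once to their inverses.\<close>

lemma double_coset_mult:
  fixes g :: "'p :: prime_card padic mat"
  assumes g: "g \<in> carrier (sim_group n)" and k: "k \<in> Sp_Zp n" and l: "l \<in> Sp_Zp n"
  shows "double_coset n (k * g * l) = double_coset n g"
proof (rule equalityI[OF double_coset_mult_subset[OF assms]])
  interpret G: group "sim_group n :: 'p padic mat monoid" by (rule sim_group_group)
  note KG = subsetD[OF Sp_Zp_subset_sim_group]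
  obtain k' where k': "k' \<in> Sp_Zp n" "k' * k = 1\<^sub>m (2 * n)" using Sp_Zp_inverse[OF k] by blast
  obtain l' where l': "l' \<in> Sp_Zp n" "l * l' = 1\<^sub>m (2 * n)" using Sp_Zp_inverse[OF l] by blast
  have e: "k' \<otimes>\<^bsub>sim_group n\<^esub> k = \<one>\<^bsub>sim_group n\<^esub>" "l \<otimes>\<^bsub>sim_group n\<^esub> l' = \<one>\<^bsub>sim_group n\<^esub>"
    unfolding sim_group_simps by (fact k'(2), fact l'(2))
  have kgl: "k \<otimes>\<^bsub>sim_group n\<^esub> g \<otimes>\<^bsub>sim_group n\<^esub> l \<in> carrier (sim_group n)"
    by (simp only: G.m_closed KG[OF k] KG[OF l] g)
  have "k' \<otimes>\<^bsub>sim_group n\<^esub> (k \<otimes>\<^bsub>sim_group n\<^esub> g \<otimes>\<^bsub>sim_group n\<^esub> l) \<otimes>\<^bsub>sim_group n\<^esub> l'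
      = (k' \<otimes>\<^bsub>sim_group n\<^esub> k) \<otimes>\<^bsub>sim_group n\<^esub> g \<otimes>\<^bsub>sim_group n\<^esub> (l \<otimes>\<^bsub>sim_group n\<^esub> l')"
    by (simp only: G.m_assoc G.m_closed KG[OF k] KG[OF l] KG[OF k'(1)] KG[OF l'(1)] g)
  also have "\<dots> = g" unfolding e by (simp only: G.l_one G.r_one g)
  finally have "k' * (k * g * l) * l' = g" unfolding sim_group_simps .
  then show "double_coset n g \<subseteq> double_coset n (k * g * l)"
    using double_coset_mult_subset[OF kgl[unfolded sim_group_simps] k'(1) l'(1)] by simp
qed

lemma double_coset_self:
  assumes "g \<in> carrier (sim_group n)"
  shows "g \<in> double_coset n g"
proof -
  have one: "1\<^sub>m (2 * n) \<in> Sp_Zp n"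
    unfolding Sp_Zp_eq by (rule image_eqI[OF _ integral_sims_one]) (simp only: emb.mat_hom_one)
  have "g = 1\<^sub>m (2 * n) * g * 1\<^sub>m (2 * n)"
    using sim_group_carrier_mat[OF assms] by simp
  then show ?thesis unfolding double_coset_iff using one by blast
qed

lemma double_coset_subset_O_set:
  fixes g :: "'p :: prime_card padic mat"
  assumes "g \<in> O_set n r"
  shows "double_coset n g \<subseteq> O_set n r"
proof
  fix h assume h: "h \<in> double_coset n g"
  obtain X where X: "g = emb_mat X" "X \<in> integral_sims n r" using assms unfolding O_set_eq by (rule imageE)
  obtain U V where UV: "h = emb_mat (U * X * V)" "U \<in> integral_sims n 0" "V \<in> integral_sims n 0"
    using h unfolding X(1) double_coset_eq[OF X(2)] by blast
  have "U * X * V \<in> integral_sims n r"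
    using integral_sims_mult[OF integral_sims_mult[OF UV(2) X(2)] UV(3)] by simp
  then show "h \<in> O_set n r" unfolding UV(1) O_set_eq by (rule imageI)
qed

lemma double_coset_indicator_in_hecke_algebra:
  fixes g :: "'p :: prime_card padic mat"
  assumes n: "n \<ge> 1" and g: "g \<in> O_set n r"
  shows "(indicator (double_coset n g) :: _ \<Rightarrow> real) \<in> hecke_algebra n"
proof (rule indicator_in_hecke_algebra[OF n double_coset_subset_O_set[OF g]])
  note gc = sim_group_carrier_mat[OF subsetD[OF O_set_subset_sim_group g]]
  fix h k :: "'p padic mat" assume "h \<in> double_coset n g" and k: "k \<in> Sp_Zp n"
  then obtain a b where ab: "h = a * g * b" "a \<in> Sp_Zp n" "b \<in> Sp_Zp n" unfolding double_coset_iff by blast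
  note kc = Sp_Zp_carrier_mat[OF k] and ac = Sp_Zp_carrier_mat[OF ab(2)] and bc = Sp_Zp_carrier_mat[OF ab(3)]
  have "k * h = (k * a) * g * b"
    unfolding ab(1) assoc_mult_mat[OF kc mult_carrier_mat[OF ac gc] bc, symmetric]
      assoc_mult_mat[OF kc ac gc, symmetric] ..
  then show "k * h \<in> double_coset n g" unfolding double_coset_iff using Sp_Zp_mult[OF k ab(2)] ab(3) by blast
  have "h * k = a * g * (b * k)"
    unfolding ab(1) by (rule assoc_mult_mat[OF mult_carrier_mat[OF ac gc] bc kc])
  then show "h * k \<in> double_coset n g" unfolding double_coset_iff using Sp_Zp_mult[OF ab(3) k] ab(2) by blast
qed

lemma O_set_indicator_in_hecke_algebra:
  assumes n: "n \<ge> 1"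
  shows "(indicator (O_set n r :: 'p :: prime_card padic mat set) :: _ \<Rightarrow> real) \<in> hecke_algebra n"
proof (rule indicator_in_hecke_algebra[OF n order_refl])
  fix g k :: "'p padic mat" assume g: "g \<in> O_set n r" and k: "k \<in> Sp_Zp n"
  obtain X where X: "g = emb_mat X" "X \<in> integral_sims n r" using g unfolding O_set_eq by (rule imageE)
  obtain U where U: "k = emb_mat U" "U \<in> integral_sims n 0" using k unfolding Sp_Zp_eq by (rule imageE)
  have "U * X \<in> integral_sims n r" using integral_sims_mult[OF U(2) X(2)] by simp
  then show "k * g \<in> O_set n r"
    unfolding X(1) U(1) emb_mat_mult_sims[OF U(2) X(2)] O_set_eq by (rule imageI)
  have "X * U \<in> integral_sims n r" using integral_sims_mult[OF X(2) U(2)] by simp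
  then show "g * k \<in> O_set n r"
    unfolding X(1) U(1) emb_mat_mult_sims[OF X(2) U(2)] O_set_eq by (rule imageI)
qed

section \<open>The Hecke operators as indicator functions\<close>

lemma emb_mat_diag: "emb_mat (mat_diag N f) = mat_diag N (\<lambda>i. to_fract (f i))"
  unfolding mat_diag_def by (intro eq_matI) auto

lemma mat_diag_cong: "(\<And>i. i < N \<Longrightarrow> f i = g i) \<Longrightarrow> mat_diag N f = mat_diag N g"
  unfolding mat_diag_def by (intro eq_matI) auto

text \<open>For factor p there is one normal form, so O_n(p) is a single double coset.\<close>

lemma T_p_eq: "(T_p n :: 'p :: prime_card padic mat \<Rightarrow> real) = indicator (O_set n 1)"
proof -
  let ?D = "sp_diag n 1 (\<lambda>_. 0) :: 'p padic_int mat"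
  have D: "?D \<in> integral_sims n 1" by (intro sp_diag_integral_sims) simp
  have "diag_list (replicate n 1 @ replicate n pp) = emb_mat ?D"
    unfolding diag_list_def sp_diag_def emb_mat_diag length_append length_replicate mult_2[symmetric]
    by (intro mat_diag_cong) (auto simp: nth_append to_fract_pi)
  moreover have "double_coset n (emb_mat ?D) = O_set n 1"
  proof (rule equalityI[OF double_coset_subset_O_set])
    show "emb_mat ?D \<in> O_set n 1" unfolding O_set_eq using D by (rule imageI)
    show "O_set n 1 \<subseteq> double_coset n (emb_mat ?D)"
      unfolding O_set_eq double_coset_eq[OF D] using integral_sims_1_decomp[of _ n, where 'p = 'p] by blast
  qed
  ultimately show ?thesis unfolding T_p_def by simp
qed

lemma T_p2_eq:
  assumes "j \<le> n"
  shows "(T_p2 n j :: 'p :: prime_card padic mat \<Rightarrow> real) = indicator (double_coset n (emb_mat (sp2_diag n j)))"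
proof -
  have len: "(n - j) + (j + ((n - j) + j)) = 2 * n" using assms by simp
  have "diag_list (replicate (n - j) 1 @ replicate j pp @ replicate (n - j) (pp ^ 2) @ replicate j pp)
      = emb_mat (sp2_diag n j :: 'p padic_int mat)"
    unfolding diag_list_def sp2_diag_def sp_diag_def emb_mat_diag length_append length_replicate len
    using assms by (intro mat_diag_cong) (auto simp: nth_append to_fract_pi emb.hom_power)
  then show ?thesis unfolding T_p2_def by simp
qed

text \<open>The factorization of x is kept beside the equality of double cosets, because the counts
  modulo p are stated for the product U D V, with D the diagonal normal form.\<close>

lemma O_set_2_double_coset:
  fixes x :: "'p :: prime_card padic mat"
  assumes "x \<in> O_set n 2"
  shows "\<exists>j\<le>n. \<exists>U\<in>integral_sims n 0. \<exists>V\<in>integral_sims n 0. x = emb_mat (U * sp2_diag n j * V) \<and>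
    double_coset n x = double_coset n (emb_mat (sp2_diag n j))"
proof -
  obtain X where X: "x = emb_mat X" "X \<in> integral_sims n 2" using assms unfolding O_set_eq by (rule imageE)
  obtain j U V where j: "j \<le> n" and U: "U \<in> integral_sims n 0" and V: "V \<in> integral_sims n 0"
    and XUV: "X = U * sp2_diag n j * V"
    using integral_sims_2_decomp[OF X(2)] by blast
  let ?D = "sp2_diag n j :: 'p padic_int mat"
  note D = sp2_diag_integral_sims[of n j, where 'a = 'p]
  have "x = emb_mat U * emb_mat ?D * emb_mat V"
    unfolding X(1) XUV emb_mat_mult_sims[OF U D] emb_mat_mult_sims[OF integral_sims_mult[OF U D] V] ..
  moreover have "emb_mat ?D \<in> carrier (sim_group n)"
    by (rule subsetD[OF O_set_subset_sim_group[of n 2]]) (unfold O_set_eq, rule imageI[OF D])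
  moreover have "emb_mat U \<in> Sp_Zp n" "emb_mat V \<in> Sp_Zp n"
    unfolding Sp_Zp_eq by (rule imageI[OF U], rule imageI[OF V])
  ultimately have "double_coset n x = double_coset n (emb_mat ?D)"
    by (simp only: double_coset_mult)
  with j U V X(1) XUV show ?thesis by blast
qed

text \<open>The sum runs over double cosets as sets, so none is repeated; a point of O_n(p^2) lies
  in exactly one of them, which leaves one summand.\<close>

lemma T_pow_2_eq: "(T_pow n 2 :: 'p :: prime_card padic mat \<Rightarrow> real) = indicator (O_set n 2)"
proof
  fix x :: "'p padic mat"
  let ?\<D> = "double_coset n ` (O_set n 2 :: 'p padic mat set)"
  \<comment> \<open>A sum over an infinite set is 0 by convention, so finiteness has to be
    established. The n + 1 normal forms provide it.\<close>
  have fin: "finite ?\<D>"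
  proof (rule finite_subset)
    show "?\<D> \<subseteq> (\<lambda>j. double_coset n (emb_mat (sp2_diag n j))) ` {..n}"
    proof (rule image_subsetI)
      fix g :: "'p padic mat" assume "g \<in> O_set n 2"
      then obtain j where "j \<le> n" "double_coset n g = double_coset n (emb_mat (sp2_diag n j))"
        using O_set_2_double_coset by blast
      then show "double_coset n g \<in> (\<lambda>j. double_coset n (emb_mat (sp2_diag n j))) ` {..n}" by simp
    qed
  qed simp
  have mem: "x \<in> D \<longleftrightarrow> x \<in> O_set n 2 \<and> D = double_coset n x" if D: "D \<in> ?\<D>" for D
  proof -
    obtain g where g: "D = double_coset n g" "g \<in> O_set n 2" using D by (rule imageE)
    note gG = subsetD[OF O_set_subset_sim_group g(2)]
    show ?thesis
    proof
      assume x: "x \<in> D"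
      then obtain k l where "x = k * g * l" "k \<in> Sp_Zp n" "l \<in> Sp_Zp n"
        unfolding g(1) double_coset_iff by blast
      then have "D = double_coset n x" unfolding g(1) using double_coset_mult[OF gG] by simp
      moreover have "x \<in> O_set n 2" using x double_coset_subset_O_set[OF g(2)] unfolding g(1) by blast
      ultimately show "x \<in> O_set n 2 \<and> D = double_coset n x" by simp
    next
      assume "x \<in> O_set n 2 \<and> D = double_coset n x"
      then have "x \<in> O_set n 2" "D = double_coset n x" by simp_all
      then show "x \<in> D" using double_coset_self[OF subsetD[OF O_set_subset_sim_group]] by metis
    qed
  qed
  have "T_pow n 2 x = (\<Sum>D\<in>?\<D>. if D = double_coset n x then indicator (O_set n 2) x else 0)"
    unfolding T_pow_def by (intro sum.cong refl) (simp add: mem indicator_def)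
  also have "\<dots> = indicator (O_set n 2) x"
    using fin by (auto simp: sum.delta indicator_def)
  finally show "T_pow n 2 x = indicator (O_set n 2) x" .
qed

theorem theorem3p5:
  fixes n :: nat and \<mu> :: "'p :: prime_card padic mat measure" and c :: "nat \<Rightarrow> real"
  assumes "n \<ge> 1"
    and "normalized_haar n \<mu>"
    and "\<And>s. s \<in> {1..n} \<Longrightarrow>
      c s = (\<Sum>i = 1..s. real CARD('p) ^ (i * (i + 1) div 2) * gauss_binomial CARD('p) s i)"
  shows "(T_p n :: 'p padic mat \<Rightarrow> real) \<in> hecke_algebra n \<and>
    (\<forall>s\<in>{1..n}. (T_p2 n s :: 'p padic mat \<Rightarrow> real) \<in> hecke_algebra n) \<and>
    (T_pow n 2 :: 'p padic mat \<Rightarrow> real) \<in> hecke_algebra n \<and>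
    T_pow n 2 = (\<lambda>x. convolution n \<mu> (T_p n) (T_p n) x - (\<Sum>s = 1..n. c s * T_p2 n s x)) \<and>
    (\<forall>s\<in>{1..n}. c s > 0 \<and> c s = (\<Prod>i = 1..s. (real CARD('p) ^ i + 1)) - 1)"
proof (intro conjI ballI)
  let ?q = "CARD('p)" and ?P = "\<lambda>s. \<Prod>i = 1..s. (real CARD('p) ^ i + 1)"
  have q: "?q \<ge> 2" using prime_gt_one[where 'p = 'p] by simp
  have c: "c s = ?P s - 1" if "s \<in> {1..n}" for s
    unfolding assms(3)[OF that] by (rule q_binomial_coefficient[OF q])
  have D_O: "emb_mat (sp2_diag n s) \<in> O_set n 2" for s
    unfolding O_set_eq using sp2_diag_integral_sims by (rule imageI)
  show "(T_p n :: 'p padic mat \<Rightarrow> real) \<in> hecke_algebra n"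
    unfolding T_p_eq by (rule O_set_indicator_in_hecke_algebra[OF assms(1)])
  show "(T_pow n 2 :: 'p padic mat \<Rightarrow> real) \<in> hecke_algebra n"
    unfolding T_pow_2_eq by (rule O_set_indicator_in_hecke_algebra[OF assms(1)])
  show "(T_p2 n s :: 'p padic mat \<Rightarrow> real) \<in> hecke_algebra n" if "s \<in> {1..n}" for s
  proof -
    have "s \<le> n" using that by simp
    then show ?thesis
      unfolding T_p2_eq[OF \<open>s \<le> n\<close>] using D_O by (intro double_coset_indicator_in_hecke_algebra[OF assms(1)])
  qed
  show "c s = ?P s - 1" if "s \<in> {1..n}" for s by (rule c[OF that])
  show "c s > 0" if s: "s \<in> {1..n}" for s
  proof -
    \<comment> \<open>The factor i = s alone exceeds 1, and the remaining factors are at least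
      1.\<close>
    have "1 < real ?q ^ s + 1" using q by simp
    also have "\<dots> \<le> (real ?q ^ s + 1) * (\<Prod>i\<in>{1..s} - {s}. (real ?q ^ i + 1))"
    proof -
      have "1 \<le> (\<Prod>i\<in>{1..s} - {s}. (real ?q ^ i + 1))" by (intro prod_ge_1) simp
      from mult_left_mono[OF this, of "real ?q ^ s + 1"] show ?thesis by simp
    qed
    also have "\<dots> = ?P s" using s by (intro prod.remove[symmetric]) auto
    finally show ?thesis using c[OF s] by simp
  qed
  show "T_pow n 2 = (\<lambda>x. convolution n \<mu> (T_p n) (T_p n) x - (\<Sum>s = 1..n. c s * T_p2 n s x))"
  proof
    fix x :: "'p padic mat"
    show "T_pow n 2 x = convolution n \<mu> (T_p n) (T_p n) x - (\<Sum>s = 1..n. c s * T_p2 n s x)"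
    proof (cases "x \<in> O_set n 2")
      case False
      have "T_p2 n s x = 0" if "s \<in> {1..n}" for s
      proof -
        have "s \<le> n" using that by simp
        moreover have "x \<notin> double_coset n (emb_mat (sp2_diag n s))"
          using double_coset_subset_O_set[OF D_O] False by blast
        ultimately show ?thesis by (simp add: T_p2_eq)
      qed
      then show ?thesis
        unfolding T_pow_2_eq T_p_eq convolution_O_set_outside[OF False] using False by simp
    next
      case True
      obtain j U V where j: "j \<le> n" and U: "U \<in> integral_sims n 0" and V: "V \<in> integral_sims n 0"
        and x: "x = emb_mat (U * sp2_diag n j * V)"
        using O_set_2_double_coset[OF True] by blast
      define X where "X = U * sp2_diag n j * V"
      have X: "X \<in> integral_sims n 2"
        unfolding X_def using integral_sims_mult[OF integral_sims_mult[OF U sp2_diag_integral_sims] V]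
        by (simp add: numeral_2_eq_2)
      have conv: "convolution n \<mu> (T_p n) (T_p n) x = ?P j"
        unfolding T_p_eq x X_def[symmetric] convolution_O_set[OF assms(1,2) X]
        unfolding X_def card_lagrangians_above_sp2[OF U V j] by (simp add: add.commute)
      have T: "T_p2 n s x = (if s = j then 1 else 0)" if "s \<in> {1..n}" for s
      proof -
        have s: "s \<le> n" using that by simp
        have "x \<in> double_coset n (emb_mat (sp2_diag n s)) \<longleftrightarrow> s = j"
        proof
          assume "x \<in> double_coset n (emb_mat (sp2_diag n s))"
          then obtain U' V' where UV': "U' \<in> integral_sims n 0" "V' \<in> integral_sims n 0"
            and x': "x = emb_mat (U' * sp2_diag n s * V')"
            unfolding double_coset_eq[OF sp2_diag_integral_sims] by blast
          have "U' * sp2_diag n s * V' = U * sp2_diag n j * V"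
            using x x' by (simp only: emb_mat_inj)
          \<comment> \<open>The size of the image modulo p is an invariant of the double coset, and
            it determines the index.\<close>
          then have "?q ^ (n - s) = ?q ^ (n - j)"
            using card_red_lattice_sp2[OF UV' s] card_red_lattice_sp2[OF U V j] by simp
          then have "n - s = n - j" using q by simp
          then show "s = j" using s j by simp
        next
          assume "s = j"
          then show "x \<in> double_coset n (emb_mat (sp2_diag n s))"
            unfolding double_coset_eq[OF sp2_diag_integral_sims] x using U V by blast
        qed
        then show ?thesis unfolding T_p2_eq[OF s] by (simp add: indicator_def)
      qed
      have "(\<Sum>s = 1..n. c s * T_p2 n s x) = (\<Sum>s = 1..n. if s = j then c j else 0)"
        using T by (intro sum.cong) auto
      \<comment> \<open>For j = 0 no summand contributes, and the empty product minus 1 is 0 as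
        well.\<close>
      also have "\<dots> = ?P j - 1" using j c[of j] by (cases "j = 0") auto
      finally show ?thesis unfolding conv T_pow_2_eq using True by simp
    qed
  qed
qed

end
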